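(* (i) Let $\Lambda$ be a selfdual lattice of rank $24$ with $\sigma(\Lambda)=16$. Then for every $m=2\cdot4^a$ ($a\ge0$), each of the shells $\Lambda_m$ and $\mathrm{Sh}(\Lambda)_m$ that is nonempty is a spherical $3$-design. (ii) Let $\Lambda=\mathbb Z^3\oplus W_8$. Then for every $m=4^a(8b+7)$ ($a,b\ge0$), the shell $\Lambda_m$ is a spherical $3$-design.
   Context: A selfdual lattice is an integral lattice equal to its dual. Shadow: $\mathrm{Sh}(\Lambda)=\Lambda$ if $\Lambda$ is even; otherwise $\mathrm{Sh}(\Lambda)=\Lambda_0^\sharp\setminus\Lambda$ where $\Lambda_0$ is the sublattice of vectors of even norm. $\sigma(\Lambda)=4\min\{\langle x,x\rangle:x\in\mathrm{Sh}(\Lambda)\}$. Shell $A_m=\{x\in A:\langle x,x\rangle=m\}$. $\mathbb Z^3$ is the cubic lattice and $W_8=\{x\in\mathbb R^8:2x_i\in\mathbb Z,\ x_i-x_1\in\mathbb Z,\ \sum x_i\in2\mathbb Z\}$. A nonempty finite antipodal set $X$ on a sphere centred at $0$ is a spherical $3$-design iff $\sum_{x\in X}P(x)=0$ for every homogeneous harmonic polynomial $P$ of degree $2$. *)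

theory Defs
  imports "HOL-Analysis.Analysis"
begin

definition is_lattice :: "'a::euclidean_space set \<Rightarrow> bool" where
  "is_lattice L \<longleftrightarrow> (\<exists>B. independent B \<and> span B = UNIV \<and>
     L = {x. \<exists>c::'a \<Rightarrow> int. x = (\<Sum>b\<in>B. of_int (c b) *\<^sub>R b)})"

definition dual_lattice :: "'a::euclidean_space set \<Rightarrow> 'a set" where
  "dual_lattice L = {y. \<forall>x\<in>L. inner x y \<in> \<int>}"

definition integral_lattice :: "'a::euclidean_space set \<Rightarrow> bool" where
  "integral_lattice L \<longleftrightarrow> is_lattice L \<and> (\<forall>x\<in>L. \<forall>y\<in>L. inner x y \<in> \<int>)"

definition selfdual_lattice :: "'a::euclidean_space set \<Rightarrow> bool" where
  "selfdual_lattice L \<longleftrightarrow> integral_lattice L \<and> dual_lattice L = L"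

definition even_lattice :: "'a::euclidean_space set \<Rightarrow> bool" where
  "even_lattice L \<longleftrightarrow> (\<forall>x\<in>L. inner x x / 2 \<in> \<int>)"

definition even_sublattice :: "'a::euclidean_space set \<Rightarrow> 'a set" where
  "even_sublattice L = {x\<in>L. inner x x / 2 \<in> \<int>}"

definition shadow :: "'a::euclidean_space set \<Rightarrow> 'a set" where
  "shadow L = (if even_lattice L then L else dual_lattice (even_sublattice L) - L)"

definition sigma :: "'a::euclidean_space set \<Rightarrow> real" where
  "sigma L = 4 * Inf {inner x x | x. x \<in> shadow L}"

definition shell :: "'a::euclidean_space set \<Rightarrow> real \<Rightarrow> 'a set" where
  "shell A m = {x\<in>A. inner x x = m}"

text \<open>Spherical 3-design for a nonempty finite antipodal set on a sphere centred at 0: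
  the sum of every homogeneous harmonic polynomial of degree 2 vanishes. Such a polynomial is
  \<open>P(x) = \<Sum>i j. c i j * x_i * x_j\<close> (coordinates w.r.t. the orthonormal basis) with
  Laplacian \<open>2 * \<Sum>i. c i i = 0\<close>.\<close>
definition spherical_3_design :: "'a::euclidean_space set \<Rightarrow> bool" where
  "spherical_3_design X \<longleftrightarrow> finite X \<and> X \<noteq> {} \<and> (\<exists>r. \<forall>x\<in>X. norm x = r) \<and>
     (\<forall>x\<in>X. - x \<in> X) \<and>
     (\<forall>c::'a \<Rightarrow> 'a \<Rightarrow> real. (\<Sum>i\<in>Basis. c i i) = 0 \<longrightarrow>
        (\<Sum>x\<in>X. \<Sum>i\<in>Basis. \<Sum>j\<in>Basis. c i j * (inner x i) * (inner x j)) = 0)"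

definition Zn_lattice :: "(real^'n) set" where
  "Zn_lattice = {u. \<forall>i. u $ i \<in> \<int>}"

definition W8 :: "(real^8) set" where
  "W8 = {x. (\<forall>i. 2 * x $ i \<in> \<int>) \<and> (\<forall>i. x $ i - x $ 1 \<in> \<int>) \<and> (\<Sum>i\<in>UNIV. x $ i) / 2 \<in> \<int>}"

definition Z3_W8 :: "((real^3) \<times> (real^8)) set" where
  "Z3_W8 = {(u, w). u \<in> Zn_lattice \<and> w \<in> W8}"

end

theory Submission
  imports Defs "HOL-Probability.Probability" "HOL-Complex_Analysis.Complex_Analysis"
    "HOL-Computational_Algebra.Primes"
begin

text \<open>
  Part (i). For a harmonic quadratic form \<open>P\<close> let \<open>f\<close>, \<open>f\<^sub>1\<close> and \<open>g\<close> be the \<open>P\<close>-weighted theta series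
  of \<open>L\<close>, of \<open>L\<close> twisted by the character \<open>x \<mapsto> (-1)\<^bsup>(x,x)\<^esup>\<close>, and of the shadow. In weight 14 the
  modular group permutes them. Hence \<open>f + f\<^sub>1 + g\<close> and the trace
  \<open>f\<^sub>1(2\<tau>) + 2\<^bsup>-14\<^esup> (g(\<tau>/2) + g((\<tau>+1)/2))\<close> are cusp forms of weight 14 and level one, so both vanish.
  With \<open>b\<^sub>m\<close> and \<open>s\<^sub>m\<close> the sums of \<open>P\<close> over the shells of \<open>L\<close> and of the shadow, this says
  \<open>s\<^sub>m = -2 b\<^sub>m\<close> and \<open>s\<^sub>4\<^sub>m = 2\<^bsup>12\<^esup> s\<^sub>m\<close> for even \<open>m\<close>. Since \<open>\<sigma>(L) = 16\<close> forces the shadow to have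
  even norms at least 4, \<open>s\<^sub>2 = 0\<close>, and the vanishing propagates to all \<open>m = 2 * 4\<^sup>a\<close>.

  The transformation law of the theta series of \<open>L\<close> is reduced to one-dimensional Gaussian sums by
  an orthogonal sublattice of finite index. There is no cusp form \<open>h\<close> of weight 14: the period
  relations force the period polynomial of its 13-fold antiderivative to be a multiple of
  \<open>1 - \<tau>\<^bsup>12\<^esup>\<close>, so the antiderivative differs by a constant from a form of weight \<open>-12\<close> that is
  holomorphic at the cusp; and such a form vanishes, because \<open>\<tau> \<mapsto> -1/\<tau>\<close> maps
  \<open>Im \<tau> = 1/2\<close>, \<open>|Re \<tau>| \<le> 1/2\<close> into \<open>Im \<tau> \<ge> 1\<close>.

  Part (ii). The coordinate symmetries leave only the harmonic form \<open>8 |u|\<^sup>2 - 3 |w|\<^sup>2\<close>, whose theta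
  series is the bracket \<open>8 \<theta>' E - 3 \<theta> E'\<close> of \<open>\<theta> = \<theta>\<^sub>3\<^sup>3\<close> and
  \<open>E = (\<theta>\<^sub>2\<^sup>8 + \<theta>\<^sub>3\<^sup>8 + \<theta>\<^sub>4\<^sup>8)/2\<close>. Writing everything in \<open>A = \<theta>\<^sub>3(4\<tau>)\<close> and \<open>B = \<theta>\<^sub>2(4\<tau>)\<close>, it equals
  the Wronskian of \<open>A\<close> and \<open>B\<close> times a polynomial in \<open>A\<close> and \<open>B\<close>, and Jacobi's identity
  \<open>\<theta>\<^sub>3\<^sup>4 = \<theta>\<^sub>2\<^sup>4 + \<theta>\<^sub>4\<^sup>4\<close> shows that its coefficients vanish at \<open>8b + 7\<close> and are multiplied by 64
  under \<open>m \<mapsto> 4 m\<close>.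
\<close>

section \<open>Poisson summation for Gaussians\<close>

text \<open>In part (i) the three series are conjugates of one form of level 2: g is invariant under
  the matrices with even lower left entry, f_1 is its image under \<tau> \<mapsto> -1/\<tau>, and f
  is f_1 translated by 1. The first sum is the trace of g to the full modular group, the second the
  trace of its image under \<tau> \<mapsto> -1/(2\<tau>). The weight is 24/2 + 2, and 14 is the
  largest even weight without cusp forms, which is why rank 24 and harmonic degree 2 fit together.
  The theta law is proved on the imaginary axis only, where Gaussians are real. An orthogonal frame
  turns the Gaussian, and enough harmonic forms, into products over coordinates; the price is a
  periodic weight, the indicator of a coset, whose finite Fourier transform follows from
  orthogonality of characters. In part (ii) the numbers 8 and 3 are the two dimensions swapped,
  which makes the form trace-free, and also twice the weights 4 and 3/2. The series is therefore a
  Rankin-Cohen bracket, and this is why a Wronskian splits off.\<close>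

lemma power_le_fact_exp:
  fixes x :: real
  assumes "x \<ge> 0"
  shows "x ^ j \<le> fact j * exp x"
proof -
  have s: "(\<lambda>n. x ^ n / fact n) sums exp x"
    using exp_converges[of x] by (simp add: divide_inverse mult.commute)
  have "sum (\<lambda>n. x ^ n / fact n) {j} \<le> exp x"
    using sums_unique[OF s] sum_le_suminf[OF sums_summable[OF s], of "{j}"] assms by simp
  then show ?thesis by (simp add: field_simps)
qed

lemma gaussian_term_bound:
  fixes t R :: real
  assumes "t > 0" "R \<ge> 0"
  obtains K where "K \<ge> 0"
    "\<And>n u. \<bar>u\<bar> \<le> R \<Longrightarrow> \<bar>real_of_int n\<bar> ^ j * exp (- (pi * t * (real_of_int n)\<^sup>2) + real_of_int n * u)
         \<le> K * exp (- \<bar>real_of_int n\<bar>)"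
proof
  \<comment> \<open>The square must absorb \<open>R * m\<close> from the linear term,
    \<open>m\<close> from bounding \<open>m ^ j\<close> by \<open>fact j * exp m\<close>, and a
    further \<open>m\<close> that survives as the decay on the right.\<close>
  define c where "c = R + 2"
  define K where "K = fact j * exp (c\<^sup>2 / (4 * pi * t))"
  show "K \<ge> 0" by (simp add: K_def)
  fix n :: int and u :: real
  assume u: "\<bar>u\<bar> \<le> R"
  define m where "m = \<bar>real_of_int n\<bar>"
  have pt: "pi * t > 0" using assms by simp
  have "0 \<le> (2 * (pi * t) * m - c)\<^sup>2" by simp
  then have "4 * (pi * t) * (m * c) \<le> 4 * (pi * t) * (pi * t * m\<^sup>2) + c\<^sup>2"
    by (simp add: power2_eq_square algebra_simps)
  then have "m * c \<le> pi * t * m\<^sup>2 + c\<^sup>2 / (4 * pi * t)"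
    using pt assms by (simp add: field_simps power2_eq_square)
  moreover have "real_of_int n * u \<le> m * R"
  proof -
    have "real_of_int n * u \<le> \<bar>real_of_int n\<bar> * \<bar>u\<bar>" by (metis abs_ge_self abs_mult)
    also have "\<dots> \<le> m * R" unfolding m_def by (intro mult_left_mono u) auto
    finally show ?thesis .
  qed
  ultimately have "m + (- (pi * t * m\<^sup>2) + real_of_int n * u) \<le> c\<^sup>2 / (4 * pi * t) + - m"
    by (simp add: c_def algebra_simps)
  then have e: "exp m * exp (- (pi * t * m\<^sup>2) + real_of_int n * u) \<le> exp (c\<^sup>2 / (4 * pi * t)) * exp (- m)"
    by (simp flip: exp_add)
  have "m ^ j * exp (- (pi * t * m\<^sup>2) + real_of_int n * u) \<le> fact j * exp m * exp (- (pi * t * m\<^sup>2) + real_of_int n * u)"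
    by (intro mult_right_mono power_le_fact_exp) (auto simp: m_def)
  also have "\<dots> \<le> fact j * (exp (c\<^sup>2 / (4 * pi * t)) * exp (- m))"
    using e by (simp add: mult.assoc)
  finally show "\<bar>real_of_int n\<bar> ^ j * exp (- (pi * t * (real_of_int n)\<^sup>2) + real_of_int n * u)
         \<le> K * exp (- \<bar>real_of_int n\<bar>)"
    by (simp add: m_def K_def mult.assoc)
qed

lemma summable_on_int:
  fixes f :: "int \<Rightarrow> real"
  assumes "(\<lambda>n. f (int n)) summable_on UNIV" "(\<lambda>n. f (- int n - 1)) summable_on UNIV"
  shows "f summable_on UNIV"
proof -
  have U: "(UNIV :: int set) = range int \<union> range (\<lambda>n. - int n - 1)"
  proof -
    have "k \<in> range int \<union> range (\<lambda>n. - int n - 1)" for k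
    proof (cases "k \<ge> 0")
      case True then show ?thesis by (metis UnI1 nonneg_int_cases rangeI)
    next
      case False
      then have "k = - int (nat (- k - 1)) - 1" by simp
      then show ?thesis by blast
    qed
    then show ?thesis by auto
  qed
  have "f summable_on range int"
    using assms(1) by (subst summable_on_reindex) (auto simp: o_def inj_on_def)
  moreover have "f summable_on range (\<lambda>n. - int n - 1)"
    using assms(2) by (subst summable_on_reindex) (auto simp: o_def inj_on_def)
  ultimately show ?thesis
    unfolding U by (rule summable_on_Un_disjoint) auto
qed

lemma summable_on_exp_abs_int: "(\<lambda>n::int. K * exp (- \<bar>real_of_int n\<bar>)) summable_on UNIV"
proof -
  have g: "summable (\<lambda>n::nat. exp (- 1 :: real) ^ n)"
    by (rule summable_geometric) simp
  have e: "exp (- real n) = exp (- 1 :: real) ^ n" for n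
    by (simp flip: exp_of_nat_mult)
  have a: "(\<lambda>n::nat. exp (- real n)) summable_on UNIV"
    unfolding e by (rule summable_nonneg_imp_summable_on[OF g]) simp
  have "(\<lambda>n::int. exp (- \<bar>real_of_int n\<bar>)) summable_on UNIV"
  proof (rule summable_on_int)
    show "(\<lambda>n::nat. exp (- \<bar>real_of_int (int n)\<bar>)) summable_on UNIV"
      using a by simp
    have "exp (- \<bar>real_of_int (- int n - 1)\<bar>) = exp (-1) * exp (- real n)" for n
      by (simp flip: exp_add)
    then show "(\<lambda>n::nat. exp (- \<bar>real_of_int (- int n - 1)\<bar>)) summable_on UNIV"
      using summable_on_cmult_right[OF a, of "exp (-1)"] by simp
  qed
  then show ?thesis by (rule summable_on_cmult_right)
qed

section \<open>The theta function of one variable and its derivatives\<close>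

text \<open>The factor \<open>n ^ j\<close> makes \<open>jtheta j t\<close> the \<open>j\<close>-th
  derivative in \<open>z\<close> of \<open>jtheta 0 t\<close>. A complex \<open>z\<close> and a real
  \<open>t\<close> are enough: moments come from differentiating in \<open>z\<close>, while the
  modular variable stays on the imaginary axis.\<close>

definition jtheta_term :: "nat \<Rightarrow> real \<Rightarrow> complex \<Rightarrow> int \<Rightarrow> complex" where
  "jtheta_term j t z n = of_int n ^ j * exp (of_real (- (pi * t * (of_int n)\<^sup>2)) + of_int n * z)"

definition jtheta :: "nat \<Rightarrow> real \<Rightarrow> complex \<Rightarrow> complex" where
  "jtheta j t z = (\<Sum>\<^sub>\<infinity>n. jtheta_term j t z n)"

lemma norm_jtheta_term:
  "norm (jtheta_term j t z n) =
     \<bar>real_of_int n\<bar> ^ j * exp (- (pi * t * (real_of_int n)\<^sup>2) + real_of_int n * Re z)"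
  by (simp add: jtheta_term_def norm_mult norm_power)

lemma jtheta_term_bound:
  assumes "t > 0" "R \<ge> 0"
  obtains K where "K \<ge> 0"
    "\<And>n z. norm z \<le> R \<Longrightarrow> norm (jtheta_term j t z n) \<le> K * exp (- \<bar>real_of_int n\<bar>)"
proof -
  obtain K where "K \<ge> 0" and K: "\<And>n u. \<bar>u\<bar> \<le> R \<Longrightarrow>
      \<bar>real_of_int n\<bar> ^ j * exp (- (pi * t * (real_of_int n)\<^sup>2) + real_of_int n * u) \<le> K * exp (- \<bar>real_of_int n\<bar>)"
    using gaussian_term_bound[OF assms] by metis
  moreover have "\<bar>Re z\<bar> \<le> R" if "norm z \<le> R" for z
    using abs_Re_le_cmod[of z] that by linarith
  ultimately show ?thesis
    using that[of K] by (auto simp: norm_jtheta_term)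
qed

lemma jtheta_term_abs_summable:
  assumes "t > 0"
  shows "(\<lambda>n. norm (jtheta_term j t z n)) summable_on UNIV"
proof -
  obtain K where K: "\<And>n w. norm w \<le> norm z \<Longrightarrow> norm (jtheta_term j t w n) \<le> K * exp (- \<bar>real_of_int n\<bar>)"
    using jtheta_term_bound[OF assms, of "norm z"] by (metis norm_ge_zero)
  show ?thesis
    by (rule Infinite_Sum.abs_summable_on_comparison_test'[OF summable_on_exp_abs_int[of K]]) (use K in auto)
qed

lemma jtheta_uniform_limit:
  assumes "t > 0" 
  shows "uniform_limit (cball 0 R) (\<lambda>X z. \<Sum>n\<in>X. jtheta_term j t z n) (jtheta j t) (finite_subsets_at_top UNIV)"
proof (cases "R \<ge> 0")
  case True
  obtain K where K: "\<And>n w. norm w \<le> R \<Longrightarrow> norm (jtheta_term j t w n) \<le> K * exp (- \<bar>real_of_int n\<bar>)"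
    using jtheta_term_bound[OF assms True] by metis
  show ?thesis unfolding jtheta_def
    by (rule Weierstrass_m_test_general[OF _ summable_on_exp_abs_int[of K]]) (use K in auto)
qed auto

text \<open>Termwise differentiation: the finite partial sums converge uniformly on a ball around 0
  that contains \<open>z\<close>, so their derivatives, which are the partial sums for
  \<open>Suc j\<close>, converge to the derivative of the limit.\<close>

lemma jtheta_has_derivative:
  assumes "t > 0"
  shows "(jtheta j t has_field_derivative jtheta (Suc j) t z) (at z)"
proof -
  define R where "R = norm z + 1"
  have d: "((\<lambda>w. \<Sum>n\<in>X. jtheta_term j t w n) has_field_derivative (\<Sum>n\<in>X. jtheta_term (Suc j) t w n)) (at w)" for X w
    unfolding jtheta_term_def by (auto intro!: derivative_eq_intros sum.cong simp: algebra_simps)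
  have ev: "\<forall>\<^sub>F X in finite_subsets_at_top UNIV. continuous_on (cball 0 R) (\<lambda>w. \<Sum>n\<in>X. jtheta_term j t w n) \<and>
      (\<forall>w\<in>ball 0 R. ((\<lambda>w. \<Sum>n\<in>X. jtheta_term j t w n) has_field_derivative (\<Sum>n\<in>X. jtheta_term (Suc j) t w n)) (at w))"
    using d by (intro always_eventually) (auto intro!: continuous_at_imp_continuous_on DERIV_isCont)
  have "0 < R" by (simp add: R_def add_nonneg_pos)
  then obtain g' where g': "\<And>w. w \<in> ball 0 R \<Longrightarrow> (jtheta j t has_field_derivative g' w) (at w) \<and>
      ((\<lambda>X. \<Sum>n\<in>X. jtheta_term (Suc j) t w n) \<longlongrightarrow> g' w) (finite_subsets_at_top UNIV)"
    using has_complex_derivative_uniform_limit[OF ev jtheta_uniform_limit[OF assms] finite_subsets_at_top_neq_bot]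
    by metis
  have z: "z \<in> ball 0 R" by (simp add: R_def)
  have "(jtheta_term (Suc j) t z has_sum jtheta (Suc j) t z) UNIV"
    unfolding jtheta_def
    by (rule has_sum_infsum, rule abs_summable_summable, rule jtheta_term_abs_summable[OF assms])
  then have "g' z = jtheta (Suc j) t z"
    using g' z unfolding has_sum_def by (intro tendsto_unique[OF finite_subsets_at_top_neq_bot]) auto
  then show ?thesis using g'[OF z] by simp
qed

text \<open>An even periodic function is a function of \<open>cos (2 \<pi> x)\<close>, so polynomial approximation on \<open>[-1, 1]\<close> applies.\<close>

lemma even_periodic_eq_0I:
  fixes D :: "real \<Rightarrow> real"
  assumes cont: "continuous_on UNIV D"
    and per: "\<And>x. D (x + 1) = D x" and even: "\<And>x. D (- x) = D x"
    and coeff: "\<And>l::nat. integral {0..1} (\<lambda>x. D x * cos (2 * pi * real l * x)) = 0"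
  shows "D x = 0"
proof -
  note [continuous_intros] = continuous_on_subset[OF cont subset_UNIV]
  define f where "f y = D (arccos y / (2 * pi))" for y
  have fc: "continuous_on {-1..1} f" unfolding f_def
    by (rule continuous_on_compose2[OF cont]) (auto intro!: continuous_intros continuous_on_arccos')
  have Df: "D x = f (cos (2 * pi * x))" if "x \<in> {0..1}" for x
  proof (cases "x \<le> 1/2")
    case True
    then have "arccos (cos (2 * pi * x)) = 2 * pi * x"
      using that by (intro arccos_cos) (auto simp: mult_le_cancel_left1 )
    then show ?thesis by (simp add: f_def)
  next
    case False
    have "cos (2 * pi * x) = cos (2 * pi * (1 - x))"
      by (simp add: right_diff_distrib cos_diff)
    moreover have "arccos (cos (2 * pi * (1 - x))) = 2 * pi * (1 - x)"
      using that False by (intro arccos_cos) (auto simp: mult_le_cancel_left1)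
    moreover have "D (1 - x) = D x" using per[of "- x"] even[of x] by (simp add: add.commute)
    ultimately show ?thesis by (simp add: f_def)
  qed
  \<comment> \<open>The induction needs all \<open>l\<close> at once, since one more cosine factor
    replaces the frequency \<open>l\<close> by the mean of its two neighbours. For
    \<open>l = 0\<close> both neighbours are the frequency 1.\<close>
  have mom: "\<forall>l::nat. integral {0..1} (\<lambda>x. D x * (cos (2 * pi * x) ^ n * cos (2 * pi * real l * x))) = 0" for n
  proof (induction n)
    case 0
    show ?case using coeff by simp
  next
    case (Suc n)
    show ?case
    proof
      fix l :: nat
      obtain a b :: nat where ab: "\<And>x. cos (2 * pi * x) * cos (2 * pi * real l * x) =
          (cos (2 * pi * real a * x) + cos (2 * pi * real b * x)) / 2"
      proof (cases l)
        case 0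
        then show ?thesis by (intro that[of 1 1]) simp
      next
        case (Suc k)
        show ?thesis
          by (intro that[of k "k+2"]) (simp add: Suc cos_times_cos algebra_simps)
      qed
      have "integral {0..1} (\<lambda>x. D x * (cos (2 * pi * x) ^ Suc n * cos (2 * pi * real l * x)))
        = integral {0..1} (\<lambda>x. (D x * (cos (2 * pi * x) ^ n * cos (2 * pi * real a * x)) +
             D x * (cos (2 * pi * x) ^ n * cos (2 * pi * real b * x))) / 2)"
      proof (rule integral_cong)
        fix x
        have "D x * (cos (2 * pi * x) ^ Suc n * cos (2 * pi * real l * x)) =
          D x * cos (2 * pi * x) ^ n * (cos (2 * pi * x) * cos (2 * pi * real l * x))" by simp
        also have "\<dots> = (D x * (cos (2 * pi * x) ^ n * cos (2 * pi * real a * x)) +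
             D x * (cos (2 * pi * x) ^ n * cos (2 * pi * real b * x))) / 2"
          unfolding ab by (simp add: algebra_simps)
        finally show "D x * (cos (2 * pi * x) ^ Suc n * cos (2 * pi * real l * x)) = \<dots>" .
      qed
      also have "\<dots> = (integral {0..1} (\<lambda>x. D x * (cos (2 * pi * x) ^ n * cos (2 * pi * real a * x))) +
             integral {0..1} (\<lambda>x. D x * (cos (2 * pi * x) ^ n * cos (2 * pi * real b * x)))) / 2"
        by (subst integral_divide, subst integral_add) (auto intro!: integrable_continuous_real continuous_intros)
      finally show "integral {0..1} (\<lambda>x. D x * (cos (2 * pi * x) ^ Suc n * cos (2 * pi * real l * x))) = 0"
        using Suc.IH by simp
    qed
  qed
  have pow: "integral {0..1} (\<lambda>x. D x * cos (2 * pi * x) ^ n) = 0" for n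
    using mom[of n] by (auto dest!: spec[of _ 0])
  define I where "I = integral {0..1} (\<lambda>x. \<bar>D x\<bar>)"
  have I0: "I \<ge> 0" unfolding I_def by (rule Henstock_Kurzweil_Integration.integral_nonneg) (auto intro!: integrable_continuous_real continuous_intros)
  \<comment> \<open>\<open>D\<close> is orthogonal to every polynomial in
    \<open>cos (2 * pi * x)\<close>. In the square one factor \<open>D x\<close>, which is
    \<open>f\<close> of this cosine, may thus be replaced by the approximation error
    \<open>f - p\<close>.\<close>
  have small: "integral {0..1} (\<lambda>x. (D x)\<^sup>2) \<le> e * I" if e: "e > 0" for e
  proof -
    obtain p where "real_polynomial_function p" and p: "\<And>y. y \<in> {-1..1} \<Longrightarrow> \<bar>f y - p y\<bar> < e"
      using Stone_Weierstrass_real_polynomial_function[OF compact_Icc fc e] by metis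
    then obtain a n where pa: "p = (\<lambda>x. \<Sum>i\<le>n. a i * x ^ i)"
      by (auto simp: real_polynomial_function_iff_sum)
    have "integral {0..1} (\<lambda>x. D x * p (cos (2 * pi * x))) =
        integral {0..1} (\<lambda>x. \<Sum>i\<le>n. a i * (D x * cos (2 * pi * x) ^ i))"
      by (simp add: pa sum_distrib_left mult_ac)
    also have "\<dots> = (\<Sum>i\<le>n. integral {0..1} (\<lambda>x. a i * (D x * cos (2 * pi * x) ^ i)))"
      by (rule integral_sum) (auto intro!: integrable_continuous_real continuous_intros)
    also have "\<dots> = 0" by (simp add: pow)
    finally have z: "integral {0..1} (\<lambda>x. D x * p (cos (2 * pi * x))) = 0" .
    have pc: "continuous_on {0..1} (\<lambda>x. p (cos (2 * pi * x)))"
      unfolding pa by (auto intro!: continuous_intros)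
    have "integral {0..1} (\<lambda>x. (D x)\<^sup>2) = integral {0..1} (\<lambda>x. (D x)\<^sup>2) - integral {0..1} (\<lambda>x. D x * p (cos (2 * pi * x)))"
      using z by simp
    also have "\<dots> = integral {0..1} (\<lambda>x. (D x)\<^sup>2 - D x * p (cos (2 * pi * x)))"
      by (subst integral_diff) (auto intro!: integrable_continuous_real continuous_intros pc)
    also have "\<dots> \<le> integral {0..1} (\<lambda>x. e * \<bar>D x\<bar>)"
    proof (rule integral_le)
      fix x :: real assume x: "x \<in> {0..1}"
      have "(D x)\<^sup>2 - D x * p (cos (2 * pi * x)) = D x * (f (cos (2 * pi * x)) - p (cos (2 * pi * x)))"
        using Df[OF x] by (simp add: power2_eq_square algebra_simps)
      also have "\<dots> \<le> \<bar>D x\<bar> * \<bar>f (cos (2 * pi * x)) - p (cos (2 * pi * x))\<bar>"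
        by (metis abs_ge_self abs_mult)
      also have "\<dots> \<le> \<bar>D x\<bar> * e"
        using p[of "cos (2 * pi * x)"] by (intro mult_left_mono) auto
      finally show "(D x)\<^sup>2 - D x * p (cos (2 * pi * x)) \<le> e * \<bar>D x\<bar>" by (simp add: mult.commute)
    qed (auto intro!: integrable_continuous_real continuous_intros pc)
    also have "\<dots> = e * I" by (simp add: I_def)
    finally show ?thesis .
  qed
  have "integral {0..1} (\<lambda>x. (D x)\<^sup>2) \<le> 0"
  proof (rule ccontr)
    assume "\<not> ?thesis"
    then have "integral {0..1} (\<lambda>x. (D x)\<^sup>2) > 0" (is "?J > 0") by simp
    then have "?J \<le> ?J / (2 * (I + 1)) * I"
      using I0 by (intro small) auto
    also have "\<dots> = ?J * (I / (2 * (I + 1)))" by simp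
    also have "\<dots> < ?J * 1"
      using I0 \<open>?J > 0\<close> by (intro mult_strict_left_mono) (auto simp: field_simps)
    finally show False by simp
  qed
  moreover have "integral {0..1} (\<lambda>x. (D x)\<^sup>2) \<ge> 0"
    by (rule Henstock_Kurzweil_Integration.integral_nonneg) (auto intro!: integrable_continuous_real continuous_intros)
  ultimately have "\<forall>x\<in>{0..1}. (D x)\<^sup>2 = 0"
    by (subst integral_eq_0_iff[symmetric]) (auto intro!: continuous_intros)
  then have z: "D x = 0" if "x \<in> {0..1}" for x using that by simp
  have pn: "D (x + real n) = D x" for x n
  proof (induction n)
    case (Suc n)
    have "D (x + real (Suc n)) = D ((x + real n) + 1)" by (simp add: add_ac)
    then show ?case using per[of "x + real n"] Suc.IH by simp
  qed simp
  have "D x = D (frac x)"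
  proof (cases "\<lfloor>x\<rfloor> \<ge> 0")
    case True
    then have "x = frac x + real (nat \<lfloor>x\<rfloor>)" by (simp add: frac_def)
    then show ?thesis using pn by metis
  next
    case False
    then have "frac x = x + real (nat (-\<lfloor>x\<rfloor>))" by (simp add: frac_def)
    then show ?thesis using pn by metis
  qed
  then show ?thesis using z[of "frac x"] frac_lt_1[of x] by (simp add: less_imp_le)
qed

section \<open>Fourier coefficients of Gaussians and Poisson summation on the line\<close>

text \<open>This is the characteristic function of the standard normal distribution. The scale
  \<open>c = sqrt (2 * pi * t)\<close> turns the exponent \<open>x\<^sup>2 / 2\<close> of its
  density into \<open>pi * t * x\<^sup>2\<close>.\<close>

lemma gaussian_cos_integral:
  fixes t :: real
  assumes "t > 0"
  shows "integrable lborel (\<lambda>x. exp (- (pi * t * x\<^sup>2)) * cos (2 * pi * l * x))"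
    and "(LBINT x. exp (- (pi * t * x\<^sup>2)) * cos (2 * pi * l * x)) = exp (- (pi * l\<^sup>2 / t)) / sqrt t"
proof -
  define c where "c = sqrt (2 * pi * t)"
  have c: "c > 0" "c\<^sup>2 = 2 * pi * t" using assms by (auto simp: c_def)
  define s where "s = 2 * pi * l / c"
  have int: "integrable lborel (\<lambda>x. std_normal_density x)" by simp
  have intc: "integrable lborel (\<lambda>x. std_normal_density x * cos (s * x))"
    by (rule Bochner_Integration.integrable_bound[OF int])
       (auto intro!: AE_I2 simp: abs_mult mult_left_le)
  have intcx: "integrable lborel (\<lambda>x. std_normal_density x *\<^sub>R iexp (s * x))"
    by (rule Bochner_Integration.integrable_bound[OF int])
       (auto intro!: AE_I2 simp: abs_mult mult_left_le)
  have "char std_normal_distribution s = (LBINT x. std_normal_density x *\<^sub>R iexp (s * x))"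
    unfolding char_def by (subst integral_density) (auto simp: normal_density_nonneg)
  then have "exp (- (s\<^sup>2) / 2) = Re (LBINT x. std_normal_density x *\<^sub>R iexp (s * x))"
    by (metis Re_complex_of_real char_std_normal_distribution)
  also have "\<dots> = (LBINT x. Re (std_normal_density x *\<^sub>R iexp (s * x)))"
    by (rule integral_Re[symmetric, OF intcx])
  also have "\<dots> = (LBINT x. std_normal_density x * cos (s * x))"
    by (simp add: Re_exp)
  finally have v: "(LBINT x. std_normal_density x * cos (s * x)) = exp (- (s\<^sup>2) / 2)" ..
  have sub: "std_normal_density (0 + c * x) * cos (s * (0 + c * x)) =
      1 / sqrt (2 * pi) * (exp (- (pi * t * x\<^sup>2)) * cos (2 * pi * l * x))" for x
    using c by (simp add: std_normal_density_def s_def power_mult_distrib mult.assoc)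
  have "has_bochner_integral lborel (\<lambda>x. std_normal_density x * cos (s * x)) (exp (- (s\<^sup>2) / 2))"
    using intc v by (simp add: has_bochner_integral_iff)
  then have hb: "has_bochner_integral lborel (\<lambda>x. std_normal_density (0 + c * x) * cos (s * (0 + c * x)))
       (exp (- (s\<^sup>2) / 2) /\<^sub>R \<bar>c\<bar>)"
    using c by (intro lborel_has_bochner_integral_real_affine_iff[THEN iffD1]) auto
  then have hb2: "has_bochner_integral lborel (\<lambda>x. exp (- (pi * t * x\<^sup>2)) * cos (2 * pi * l * x))
      (sqrt (2 * pi) * (exp (- (s\<^sup>2) / 2) /\<^sub>R \<bar>c\<bar>))"
    unfolding sub
    using has_bochner_integral_mult_right[OF hb[unfolded sub], of "sqrt (2 * pi)"] by simp
  have "s\<^sup>2 / 2 = pi * l\<^sup>2 / t"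
    using c assms by (simp add: s_def power_divide power_mult_distrib field_simps power2_eq_square)
  then have "sqrt (2 * pi) * (exp (- (s\<^sup>2) / 2) /\<^sub>R \<bar>c\<bar>) = exp (- (pi * l\<^sup>2 / t)) / sqrt t"
    using c assms by (simp add: c_def real_sqrt_mult field_simps)
  with hb2 show "integrable lborel (\<lambda>x. exp (- (pi * t * x\<^sup>2)) * cos (2 * pi * l * x))"
    and "(LBINT x. exp (- (pi * t * x\<^sup>2)) * cos (2 * pi * l * x)) = exp (- (pi * l\<^sup>2 / t)) / sqrt t"
    by (auto simp: has_bochner_integral_iff)
qed

text \<open>Passes from limits along finite sets of integers to limits of sequences. The interval is
  open on the right because the unit intervals [n, n + 1] with -N \<le> n < N tile [-N, N].\<close>

lemma filterlim_int_intervals: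
  "filterlim (\<lambda>N::nat. {- int N..<int N}) (finite_subsets_at_top UNIV) sequentially"
  unfolding filterlim_finite_subsets_at_top
proof safe
  fix X :: "int set" assume "finite X"
  define M where "M = nat (Max (insert 0 (abs ` X))) + 1"
  have M: "\<bar>x\<bar> < int M" if "x \<in> X" for x
  proof -
    have "\<bar>x\<bar> \<le> Max (insert 0 (abs ` X))" using \<open>finite X\<close> that by (intro Max_ge) auto
    then show ?thesis unfolding M_def by linarith
  qed
  show "\<forall>\<^sub>F N in sequentially. finite {- int N..<int N} \<and> X \<subseteq> {- int N..<int N} \<and> {- int N..<int N} \<subseteq> UNIV"
    using eventually_ge_at_top[of M] by eventually_elim (use M in fastforce)
qed

lemma integral_sum_shifts:
  fixes G :: "real \<Rightarrow> real"
  assumes "continuous_on UNIV G"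
  shows "integral {0..1} (\<lambda>x. \<Sum>n\<in>{- int N..<int N}. G (x + of_int n)) = integral {- real N..real N} G"
proof -
  note c = continuous_on_subset[OF assms subset_UNIV]
  have cs: "continuous_on A (\<lambda>x. G (x + d))" for A d
    by (rule continuous_on_compose2[OF assms]) (auto intro!: continuous_intros)
  have sh: "integral {0..1} (\<lambda>x. G (x + d)) = integral {d..d+1} G" for d
    using integral_shift[of 0 d 1 G] c by (simp add: add.commute o_def)
  show ?thesis
  proof (induction N)
    case (Suc N)
    have "{- int (Suc N)..<int (Suc N)} = insert (- int N - 1) (insert (int N) {- int N..<int N})" by auto
    then have "integral {0..1} (\<lambda>x. \<Sum>n\<in>{- int (Suc N)..<int (Suc N)}. G (x + of_int n)) =
       integral {0..1} (\<lambda>x. G (x + (- real N - 1)) + (G (x + real N) + (\<Sum>n\<in>{- int N..<int N}. G (x + of_int n))))"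
      by simp
    also have "\<dots> = integral {- real N - 1..- real N} G + (integral {real N..real N + 1} G + integral {- real N..real N} G)"
      by (subst integral_add, (auto intro!: integrable_continuous_real continuous_intros cs)[2],
          subst integral_add, (auto intro!: integrable_continuous_real continuous_intros cs)[2])
         (simp add: Suc.IH sh)
    also have "\<dots> = integral {- real N - 1..real N + 1} G"
    proof -
      have "integral {- real N - 1..- real N} G + integral {- real N..real N} G = integral {- real N - 1..real N} G"
        by (rule Henstock_Kurzweil_Integration.integral_combine) (auto intro!: integrable_continuous_real c)
      moreover have "integral {- real N - 1..real N} G + integral {real N..real N + 1} G = integral {- real N - 1..real N + 1} G"
        by (rule Henstock_Kurzweil_Integration.integral_combine) (auto intro!: integrable_continuous_real c)
      ultimately show ?thesis by simp
    qed
    finally have *: "integral {0..1} (\<lambda>x. \<Sum>n\<in>{- int (Suc N)..<int (Suc N)}. G (x + of_int n)) = integral {- real N - 1..real N + 1} G" .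
    have "{- real (Suc N)..real (Suc N)} = {- real N - 1..real N + 1}" by auto
    then show ?case unfolding * by (rule arg_cong[symmetric])
  qed simp
qed

lemma integral_tendsto_lborel:
  fixes G :: "real \<Rightarrow> real"
  assumes "integrable lborel G"
  shows "(\<lambda>N::nat. integral {- real N..real N} G) \<longlonglongrightarrow> (LBINT x. G x)"
proof -
  have "(\<lambda>N::nat. LBINT x. indicator {- real N..real N} x * G x) \<longlonglongrightarrow> (LBINT x. G x)"
  proof (rule integral_dominated_convergence[where w = "\<lambda>x. \<bar>G x\<bar>"])
    show "AE x in lborel. (\<lambda>N. indicator {- real N..real N} x * G x) \<longlonglongrightarrow> G x"
    proof (rule AE_I2)
      fix x :: real
      obtain M :: nat where M: "\<bar>x\<bar> \<le> real M" using real_arch_simple by blast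
      have "\<forall>\<^sub>F N in sequentially. indicator {- real N..real N} x * G x = G x"
        using eventually_ge_at_top[of M]
      proof eventually_elim
        case (elim N)
        then have "real M \<le> real N" by simp
        with M have "x \<in> {- real N..real N}" by auto
        then show ?case by simp
      qed
      then show "(\<lambda>N. indicator {- real N..real N} x * G x) \<longlonglongrightarrow> G x"
        by (rule tendsto_eventually)
    qed
  qed (use assms in \<open>auto simp: indicator_def\<close>)
  moreover have "(LBINT x. indicator {- real N..real N} x * G x) = integral {- real N..real N} G" for N
    using set_borel_integral_eq_integral(2)[of "{- real N..real N}" G] assms
    by (simp add: set_lebesgue_integral_def set_integrable_def integrable_mult_indicator flip: real_scaleR_def del: real_scaleR_def)
  ultimately show ?thesis by simp
qed

lemma integral_cos_2pi:
  "integral {0..1} (\<lambda>x. cos (2 * pi * of_int n * x)) = (if n = (0::int) then 1 else 0)"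
proof (cases "n = 0")
  case False
  have "((\<lambda>x. cos (2 * pi * of_int n * x)) has_integral
      (sin (2 * pi * of_int n * 1) / (2 * pi * of_int n) - sin (2 * pi * of_int n * 0) / (2 * pi * of_int n))) {0..1}"
    by (rule fundamental_theorem_of_calculus)
       (use False in \<open>auto intro!: derivative_eq_intros simp flip: has_real_derivative_iff_has_vector_derivative\<close>)
  then show ?thesis using False sin_int_2pin[of n] by (simp add: integral_unique mult_ac)
qed simp

text \<open>Both sides are continuous, even and of period 1, so it suffices to compare cosine
  coefficients. On the left the integral over [0, 1] unfolds to a Gaussian integral over the line;
  on the right orthogonality of the cosines picks out \<open>h (int l)\<close>.\<close>

lemma gaussian_poisson_real:
  fixes t x :: real
  assumes "t > 0"
  shows "(\<Sum>\<^sub>\<infinity>n::int. exp (- (pi * t * (x + of_int n)\<^sup>2))) =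
         (\<Sum>\<^sub>\<infinity>n::int. exp (- (pi * (of_int n)\<^sup>2 / t)) * cos (2 * pi * of_int n * x)) / sqrt t"
proof -
  define F where "F x = (\<Sum>\<^sub>\<infinity>n::int. exp (- (pi * t * (x + of_int n)\<^sup>2)))" for x
  define h where "h n = exp (- (pi * (of_int n)\<^sup>2 / t)) / sqrt t" for n :: int
  define H where "H x = (\<Sum>\<^sub>\<infinity>n::int. h n * cos (2 * pi * of_int n * x))" for x
  let ?fs = "finite_subsets_at_top (UNIV :: int set)"
  have unifF: "uniform_limit {-R..R} (\<lambda>X x. \<Sum>n\<in>X. exp (- (pi * t * (x + of_int n)\<^sup>2))) F ?fs" if R: "R \<ge> 0" for R
  proof -
    have R': "0 \<le> 2 * pi * t * R" using R assms by simp
    obtain K where K: "K \<ge> 0" "\<And>n u. \<bar>u\<bar> \<le> 2 * pi * t * R \<Longrightarrow> \<bar>real_of_int n\<bar> ^ 0 * exp (- (pi * t * (real_of_int n)\<^sup>2) + real_of_int n * u)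
         \<le> K * exp (- \<bar>real_of_int n\<bar>)"
      using gaussian_term_bound[OF assms R', of 0] by blast
    show ?thesis unfolding F_def
    proof (rule Weierstrass_m_test_general[OF _ summable_on_exp_abs_int[of K]])
      fix n :: int and x :: real assume "x \<in> {-R..R}"
      then have "\<bar>- (2 * pi * t * x)\<bar> \<le> 2 * pi * t * R" using assms by (auto simp: abs_mult)
      from K(2)[OF this, of n] have "exp (- (pi * t * (real_of_int n)\<^sup>2) + real_of_int n * - (2 * pi * t * x)) \<le> K * exp (- \<bar>real_of_int n\<bar>)"
        by simp
      moreover have "- (pi * t * (x + of_int n)\<^sup>2) \<le> - (pi * t * (real_of_int n)\<^sup>2) + real_of_int n * - (2 * pi * t * x)"
        using assms by (simp add: power2_sum algebra_simps)
      ultimately show "norm (exp (- (pi * t * (x + of_int n)\<^sup>2))) \<le> K * exp (- \<bar>real_of_int n\<bar>)"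
        by (simp add: order.trans[OF exp_le_cancel_iff[THEN iffD2]])
    qed
  qed
  have hsum: "h summable_on UNIV"
  proof -
    obtain K where K: "K \<ge> 0" "\<And>n u. \<bar>u\<bar> \<le> 0 \<Longrightarrow> \<bar>real_of_int n\<bar> ^ 0 * exp (- (pi * (1/t) * (real_of_int n)\<^sup>2) + real_of_int n * u)
         \<le> K * exp (- \<bar>real_of_int n\<bar>)"
      using gaussian_term_bound[of "1/t" 0 0, OF _ order.refl] assms by (metis zero_less_divide_1_iff)
    have "(\<lambda>n. norm (h n)) summable_on UNIV"
    proof (rule Infinite_Sum.abs_summable_on_comparison_test'[OF summable_on_exp_abs_int[of "K / sqrt t"]])
      fix n
      show "norm (h n) \<le> K / sqrt t * exp (- \<bar>real_of_int n\<bar>)"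
        using K(2)[of 0 n] assms by (simp add: h_def field_simps)
    qed
    then show ?thesis by (rule abs_summable_summable)
  qed
  have h0: "h n \<ge> 0" for n using assms by (simp add: h_def)
  have unifH: "uniform_limit A (\<lambda>X x. \<Sum>n\<in>X. h n * cos (2 * pi * of_int n * x)) H ?fs" for A
    unfolding H_def by (rule Weierstrass_m_test_general[OF _ hsum]) (use h0 in \<open>auto simp: abs_mult mult_left_le\<close>)
  have contF: "continuous_on UNIV F"
  proof -
    have "isCont F x" for x
    proof -
      have "continuous_on {-(\<bar>x\<bar>+1)..\<bar>x\<bar>+1} F"
        by (rule uniform_limit_theorem[OF _ unifF]) (auto intro!: continuous_intros always_eventually)
      then have "continuous_on {-(\<bar>x\<bar>+1)<..<\<bar>x\<bar>+1} F" by (rule continuous_on_subset) auto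
      then show ?thesis by (rule continuous_on_interior) (auto simp: interior_open)
    qed
    then show ?thesis by (simp add: continuous_at_imp_continuous_on)
  qed
  have contH: "continuous_on UNIV H"
    by (rule uniform_limit_theorem[OF _ unifH]) (auto intro!: continuous_intros always_eventually)
  have intF: "integral {0..1} (\<lambda>x. F x * cos (2 * pi * real l * x)) = h (int l)" for l :: nat
  proof -
    let ?G = "\<lambda>x. exp (- (pi * t * x\<^sup>2)) * cos (2 * pi * real l * x)"
    \<comment> \<open>The cosine has period 1, so it can be shifted together with the Gaussian, and
      the sum of the shifts unfolds.\<close>
    have cc: "cos (2 * pi * real l * x) = cos (2 * pi * real l * (x + of_int n))" for x n
    proof -
      have "sin (2 * pi * real l * of_int n) = 0" "cos (2 * pi * real l * of_int n) = 1"
        using sin_int_2pin[of "int l * n"] cos_int_2pin[of "int l * n"] by (simp_all add: mult_ac)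
      then show ?thesis by (simp add: cos_add ring_distribs)
    qed
    have "bounded ((\<lambda>x. cos (2 * pi * real l * x)) ` {0..1::real})"
      by (rule boundedI[of _ 1]) auto
    moreover have "bounded (F ` {0..1})"
      by (intro compact_imp_bounded compact_continuous_image continuous_on_subset[OF contF]) auto
    ultimately have "uniform_limit {0..1} (\<lambda>X x. (\<Sum>n\<in>X. exp (- (pi * t * (x + of_int n)\<^sup>2))) * cos (2 * pi * real l * x))
        (\<lambda>x. F x * cos (2 * pi * real l * x)) ?fs"
      by (intro uniform_lim_mult uniform_limit_on_subset[OF unifF[of 1]] uniform_limit_const) auto
    then obtain I J where I: "\<And>X. ((\<lambda>x. (\<Sum>n\<in>X. exp (- (pi * t * (x + of_int n)\<^sup>2))) * cos (2 * pi * real l * x)) has_integral I X) {0..1}"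
        and J: "((\<lambda>x. F x * cos (2 * pi * real l * x)) has_integral J) {0..1}" and IJ: "(I \<longlongrightarrow> J) ?fs"
      by (rule uniform_limit_integral) (auto intro!: continuous_intros)
    have "(\<lambda>N. I {- int N..<int N}) \<longlonglongrightarrow> J"
      by (rule filterlim_compose[OF IJ filterlim_int_intervals])
    moreover have "I {- int N..<int N} = integral {- real N..real N} ?G" for N
    proof -
      have "I {- int N..<int N} = integral {0..1} (\<lambda>x. (\<Sum>n\<in>{- int N..<int N}. exp (- (pi * t * (x + of_int n)\<^sup>2))) * cos (2 * pi * real l * x))"
        by (rule integral_unique[OF I, symmetric])
      also have "\<dots> = integral {0..1} (\<lambda>x. \<Sum>n\<in>{- int N..<int N}. ?G (x + of_int n))"
        by (simp only: sum_distrib_right cc[symmetric])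
      also have "\<dots> = integral {- real N..real N} ?G"
        by (rule integral_sum_shifts) (auto intro!: continuous_intros)
      finally show ?thesis .
    qed
    moreover have "(\<lambda>N. integral {- real N..real N} ?G) \<longlonglongrightarrow> h (int l)"
      using integral_tendsto_lborel[OF gaussian_cos_integral(1)[OF assms]] gaussian_cos_integral(2)[OF assms]
      by (simp add: h_def)
    ultimately have "J = h (int l)" using LIMSEQ_unique by simp
    then show ?thesis using J integral_unique by blast
  qed
  have intH: "integral {0..1} (\<lambda>x. H x * cos (2 * pi * real l * x)) = h (int l)" for l :: nat
  proof -
    have "bounded ((\<lambda>x. cos (2 * pi * real l * x)) ` {0..1::real})"
      by (rule boundedI[of _ 1]) auto
    moreover have "bounded (H ` {0..1})"
      by (intro compact_imp_bounded compact_continuous_image continuous_on_subset[OF contH]) auto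
    ultimately have "uniform_limit {0..1} (\<lambda>X x. (\<Sum>n\<in>X. h n * cos (2 * pi * of_int n * x)) * cos (2 * pi * real l * x))
        (\<lambda>x. H x * cos (2 * pi * real l * x)) ?fs"
      by (intro uniform_lim_mult unifH uniform_limit_const) auto
    then obtain I J where I: "\<And>X. ((\<lambda>x. (\<Sum>n\<in>X. h n * cos (2 * pi * of_int n * x)) * cos (2 * pi * real l * x)) has_integral I X) {0..1}"
        and J: "((\<lambda>x. H x * cos (2 * pi * real l * x)) has_integral J) {0..1}" and IJ: "(I \<longlongrightarrow> J) ?fs"
      by (rule uniform_limit_integral) (auto intro!: continuous_intros)
    have prod: "integral {0..1} (\<lambda>x. cos (2 * pi * of_int n * x) * cos (2 * pi * real l * x)) =
        ((if n = int l then 1 else 0) + (if n = - int l then 1 else 0)) / 2" for n :: int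
    proof -
      have "(\<lambda>x. cos (2 * pi * of_int n * x) * cos (2 * pi * real l * x)) =
          (\<lambda>x. (cos (2 * pi * of_int (n - int l) * x) + cos (2 * pi * of_int (n + int l) * x)) / 2)"
        by (simp add: cos_times_cos algebra_simps)
      then have "integral {0..1} (\<lambda>x. cos (2 * pi * of_int n * x) * cos (2 * pi * real l * x)) =
         (integral {0..1} (\<lambda>x. cos (2 * pi * of_int (n - int l) * x)) + integral {0..1} (\<lambda>x. cos (2 * pi * of_int (n + int l) * x))) / 2"
        by (simp only: integral_divide)
           (subst integral_add, auto intro!: integrable_continuous_real continuous_intros)
      also have "\<dots> = ((if n - int l = 0 then 1 else 0) + (if n + int l = 0 then 1 else 0)) / 2"
        unfolding integral_cos_2pi ..
      also have "\<dots> = ((if n = int l then 1 else 0) + (if n = - int l then 1 else 0)) / 2"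
        by (simp add: add_eq_0_iff2)
      finally show ?thesis .
    qed
    have IX: "I X = (\<Sum>n\<in>X. h n * ((if n = int l then 1 else 0) + (if n = - int l then 1 else 0)) / 2)" for X
    proof -
      have "I X = integral {0..1} (\<lambda>x. \<Sum>n\<in>X. h n * (cos (2 * pi * of_int n * x) * cos (2 * pi * real l * x)))"
        using integral_unique[OF I[of X]] by (simp add: sum_distrib_right mult.assoc)
      also have "\<dots> = (\<Sum>n\<in>X. integral {0..1} (\<lambda>x. h n * (cos (2 * pi * of_int n * x) * cos (2 * pi * real l * x))))"
        by (cases "finite X", subst integral_sum) (auto intro!: integrable_continuous_real continuous_intros)
      also have "\<dots> = (\<Sum>n\<in>X. h n * ((if n = int l then 1 else 0) + (if n = - int l then 1 else 0)) / 2)"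
        by (simp add: prod)
      finally show ?thesis .
    qed
    have hm: "h (- n) = h n" for n by (simp add: h_def)
    have "\<forall>\<^sub>F X in ?fs. I X = h (int l)"
      unfolding eventually_finite_subsets_at_top
    proof (intro exI[of _ "{int l, - int l}"] conjI allI impI)
      fix X assume X: "finite X \<and> {int l, - int l} \<subseteq> X \<and> X \<subseteq> UNIV"
      have "I X = (\<Sum>n\<in>X. (if n = int l then h n / 2 else 0) + (if n = - int l then h n / 2 else 0))"
        unfolding IX by (rule sum.cong) auto
      \<comment> \<open>The frequencies \<open>l\<close> and \<open>- l\<close> give one half each;
        for \<open>l = 0\<close> they coincide and the same term supplies both halves.\<close>
      also have "\<dots> = h (int l) / 2 + h (- int l) / 2"
        using X by (simp add: sum.distrib)
      finally show "I X = h (int l)" by (simp add: hm)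
    qed auto
    then have "(I \<longlongrightarrow> h (int l)) ?fs" by (rule tendsto_eventually)
    then have "J = h (int l)" using IJ tendsto_unique[OF finite_subsets_at_top_neq_bot] by blast
    then show ?thesis using J integral_unique by blast
  qed
  have "F x - H x = 0"
  proof (rule even_periodic_eq_0I[where D = "\<lambda>x. F x - H x"])
    show "continuous_on UNIV (\<lambda>x. F x - H x)" by (intro continuous_intros contF contH)
    fix x
    have "F (x + 1) = F x"
      unfolding F_def by (rule infsum_reindex_bij_witness[of _ "\<lambda>n. n - 1" "\<lambda>n. n + 1"]) (auto simp: algebra_simps)
    moreover have "cos (2 * pi * of_int n * (x + 1)) = cos (2 * pi * of_int n * x)" for n
      using sin_int_2pin[of n] cos_int_2pin[of n] by (simp add: ring_distribs cos_add mult_ac)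
    then have "H (x + 1) = H x" unfolding H_def by simp
    ultimately show "F (x + 1) - H (x + 1) = F x - H x" by simp
    have "F (- x) = F x"
      unfolding F_def by (rule infsum_reindex_bij_witness[of _ uminus uminus]) (auto simp: power2_eq_square algebra_simps)
    moreover have "H (- x) = H x" unfolding H_def by simp
    ultimately show "F (- x) - H (- x) = F x - H x" by simp
  next
    fix l :: nat
    have "integral {0..1} (\<lambda>x. (F x - H x) * cos (2 * pi * real l * x)) =
      integral {0..1} (\<lambda>x. F x * cos (2 * pi * real l * x)) - integral {0..1} (\<lambda>x. H x * cos (2 * pi * real l * x))"
      unfolding left_diff_distrib
      by (rule integral_diff) (auto intro!: integrable_continuous_real continuous_intros continuous_on_subset[OF contF] continuous_on_subset[OF contH])
    then show "integral {0..1} (\<lambda>x. (F x - H x) * cos (2 * pi * real l * x)) = 0"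
      using intF intH by simp
  qed
  moreover have "H x = (\<Sum>\<^sub>\<infinity>n::int. exp (- (pi * (of_int n)\<^sup>2 / t)) * cos (2 * pi * of_int n * x)) / sqrt t"
    unfolding H_def h_def using infsum_cmult_left'[of "\<lambda>n::int. exp (- (pi * (of_int n)\<^sup>2 / t)) * cos (2 * pi * of_int n * x)" "inverse (sqrt t)" UNIV]
    by (simp add: field_simps)
  ultimately show ?thesis by (simp add: F_def)
qed

lemma jtheta_term_summable: "t > 0 \<Longrightarrow> jtheta_term j t z summable_on UNIV"
  by (rule abs_summable_summable, rule jtheta_term_abs_summable)

lemma infsum_complex_of_real: "(\<Sum>\<^sub>\<infinity>x\<in>A. complex_of_real (f x)) = of_real (infsum f A)"
proof (cases "f summable_on A")
  case True
  then show ?thesis by (intro infsumI has_sum_of_real has_sum_infsum)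
next
  case False
  then have "\<not> (\<lambda>x. complex_of_real (f x)) summable_on A"
    using summable_on_Re by fastforce
  with False show ?thesis by (simp add: infsum_not_exists)
qed

lemma has_sum_divide_complex: "(f has_sum a) A \<Longrightarrow> ((\<lambda>x. f x / c) has_sum (a / c)) A" for c :: complex
  using has_sum_cmult_left[of f A a "inverse c"] by (simp add: divide_inverse)

lemma has_sum_diff_complex:
  fixes f g :: "'a \<Rightarrow> complex"
  shows "(f has_sum a) A \<Longrightarrow> (g has_sum b) A \<Longrightarrow> ((\<lambda>x. f x - g x) has_sum (a - b)) A"
  using has_sum_add[of f A a "\<lambda>x. - g x" "- b"] by (simp add: has_sum_uminus)

lemma jtheta_imaginary:
  assumes "t > 0"
  shows "jtheta 0 t (\<i> * of_real y) = of_real (\<Sum>\<^sub>\<infinity>n::int. exp (- (pi * t * (of_int n)\<^sup>2)) * cos (of_int n * y))"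
proof -
  let ?f = "jtheta_term 0 t (\<i> * of_real y)"
  have "(\<Sum>\<^sub>\<infinity>n. ?f n) = (\<Sum>\<^sub>\<infinity>n. ?f (- n))"
    by (rule infsum_reindex_bij_witness[of _ uminus uminus]) auto
  moreover have sm: "(\<lambda>n. ?f (- n)) summable_on UNIV"
    using summable_on_reindex[of uminus UNIV ?f] jtheta_term_summable[OF assms, of 0 "\<i> * of_real y"]
    by (simp add: o_def)
  ultimately have "2 * jtheta 0 t (\<i> * of_real y) = (\<Sum>\<^sub>\<infinity>n. ?f n + ?f (- n))"
    using jtheta_term_summable[OF assms, of 0 "\<i> * of_real y"] by (subst infsum_add) (auto simp: jtheta_def)
  also have "?f n + ?f (- n) = 2 * of_real (exp (- (pi * t * (of_int n)\<^sup>2)) * cos (of_int n * y))" for n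
  proof -
    have "?f n + ?f (- n) = exp (of_real (- (pi * t * (of_int n)\<^sup>2))) * (exp (\<i> * of_real (of_int n * y)) + exp (- (\<i> * of_real (of_int n * y))))"
      by (simp add: jtheta_term_def algebra_simps flip: exp_add)
    also have "exp (\<i> * of_real (of_int n * y)) + exp (- (\<i> * of_real (of_int n * y))) = 2 * cos (of_real (of_int n * y))"
      by (simp add: cos_exp_eq)
    also have "exp (of_real (- (pi * t * (of_int n)\<^sup>2))) * (2 * cos (of_real (of_int n * y))) =
       2 * complex_of_real (exp (- (pi * t * (of_int n)\<^sup>2)) * cos (of_int n * y))"
      by (simp only: exp_of_real cos_of_real of_real_mult[symmetric]) (simp add: mult_ac)
    finally show ?thesis .
  qed
  then have "(\<Sum>\<^sub>\<infinity>n. ?f n + ?f (- n)) = (\<Sum>\<^sub>\<infinity>n. 2 * complex_of_real (exp (- (pi * t * (of_int n)\<^sup>2)) * cos (of_int n * y)))"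
    by simp
  also have "\<dots> = 2 * (\<Sum>\<^sub>\<infinity>n. complex_of_real (exp (- (pi * t * (of_int n)\<^sup>2)) * cos (of_int n * y)))"
    by (rule infsum_cmult_right')
  also have "\<dots> = 2 * of_real (\<Sum>\<^sub>\<infinity>n::int. exp (- (pi * t * (of_int n)\<^sup>2)) * cos (of_int n * y))"
    by (simp only: infsum_complex_of_real)
  finally show ?thesis by simp
qed

lemma gaussian_shift_term:
  "exp (- (of_real (pi * t) * z\<^sup>2)) * jtheta_term 0 t (- (of_real (2 * pi * t) * z)) n =
     exp (- (of_real (pi * t) * (z + of_int n)\<^sup>2))"
  by (simp add: jtheta_term_def power2_sum algebra_simps flip: exp_add)

text \<open>For real \<open>z\<close> this is Poisson summation, since the left side is the sum of
  the shifted Gaussians by \<open>gaussian_shift_term\<close>. Both sides are entire, so the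
  identity continues to the plane and can be differentiated there.\<close>

lemma jtheta_modular:
  assumes "t > 0"
  shows "exp (- (of_real (pi * t) * z\<^sup>2)) * jtheta 0 t (- (of_real (2 * pi * t) * z)) =
         jtheta 0 (1 / t) (\<i> * of_real (2 * pi) * z) / of_real (sqrt t)"
proof -
  let ?A = "\<lambda>z. exp (- (of_real (pi * t) * z\<^sup>2)) * jtheta 0 t (- (of_real (2 * pi * t) * z))"
  let ?B = "\<lambda>z. jtheta 0 (1 / t) (\<i> * of_real (2 * pi) * z) / of_real (sqrt t)"
  have real: "?A (of_real x) = ?B (of_real x)" for x
  proof -
    have "?A (of_real x) = (\<Sum>\<^sub>\<infinity>n. exp (- (of_real (pi * t) * (of_real x)\<^sup>2)) * jtheta_term 0 t (- (of_real (2 * pi * t) * of_real x)) n)"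
      unfolding jtheta_def by (rule infsum_cmult_right'[symmetric])
    also have "\<dots> = (\<Sum>\<^sub>\<infinity>n. exp (- (of_real (pi * t) * (of_real x + of_int n)\<^sup>2)))"
      by (simp only: gaussian_shift_term)
    also have "\<dots> = (\<Sum>\<^sub>\<infinity>n::int. of_real (exp (- (pi * t * (x + of_int n)\<^sup>2))))"
      by (simp flip: exp_of_real)
    also have "\<dots> = of_real (\<Sum>\<^sub>\<infinity>n::int. exp (- (pi * t * (x + of_int n)\<^sup>2)))"
      by (rule infsum_complex_of_real)
    also have "\<dots> = of_real ((\<Sum>\<^sub>\<infinity>n::int. exp (- (pi * (1 / t) * (of_int n)\<^sup>2)) * cos (of_int n * (2 * pi * x))) / sqrt t)"
      unfolding gaussian_poisson_real[OF assms] by (simp add: mult_ac)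
    also have "\<dots> = jtheta 0 (1 / t) (\<i> * of_real (2 * pi * x)) / of_real (sqrt t)"
      using assms by (subst jtheta_imaginary) auto
    finally show ?thesis by (simp add: mult.assoc)
  qed
  have hol: "jtheta 0 s holomorphic_on UNIV" if "s > 0" for s
    using jtheta_has_derivative[OF that] by (auto simp: holomorphic_on_def field_differentiable_def intro: has_field_derivative_at_within)
  have holc: "(\<lambda>z. jtheta 0 s (c * z)) holomorphic_on UNIV" if "s > 0" for s c
    using holomorphic_on_compose_gen[OF _ hol[OF that], of "\<lambda>z. c * z" UNIV] by (auto simp: o_def intro!: holomorphic_intros)
  have "?A z - ?B z = 0"
  proof (rule analytic_continuation[of "\<lambda>z. ?A z - ?B z" UNIV "range of_real" 0])
    show "(\<lambda>z. ?A z - ?B z) holomorphic_on UNIV"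
      using holc[OF assms, of "- of_real (2 * pi * t)"] holc[of "1/t" "\<i> * of_real (2 * pi)"] assms
      by (intro holomorphic_intros) auto
    show "0 islimpt range complex_of_real"
      unfolding islimpt_approachable
    proof safe
      fix e :: real assume "e > 0"
      then show "\<exists>x'\<in>range complex_of_real. x' \<noteq> 0 \<and> dist x' 0 < e"
        by (intro bexI[of _ "of_real (e/2)"] rangeI) auto
    qed
  qed (use real in auto)
  then show ?thesis by simp
qed

text \<open>The transformation law is differentiated once and twice in \<open>z\<close>. The left
  sides are the first and second moments of \<open>z + n\<close> against the Gaussian. The extra
  \<open>jtheta 0\<close> in the second law reflects that a square alone is not harmonic.\<close>

lemma jtheta_modular_derivs:
  assumes t: "t > 0"
  defines "u \<equiv> \<lambda>z::complex. - (of_real (2 * pi * t) * z)" and "v \<equiv> \<lambda>z. \<i> * of_real (2 * pi) * z"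
    and "E \<equiv> \<lambda>z. exp (- (of_real (pi * t) * z\<^sup>2))"
  shows "E z * (z * jtheta 0 t (u z) + jtheta 1 t (u z)) =
           - (\<i> / of_real t) * jtheta 1 (1/t) (v z) / of_real (sqrt t)"
    and "E z * (z\<^sup>2 * jtheta 0 t (u z) + 2 * z * jtheta 1 t (u z) + jtheta 2 t (u z)) =
           (jtheta 0 (1/t) (v z) / of_real (2 * pi * t) - jtheta 2 (1/t) (v z) / of_real (t\<^sup>2)) / of_real (sqrt t)"
proof -
  have t': "1/t > 0" using t by simp
  have st: "complex_of_real (sqrt t) \<noteq> 0" using t by simp
  have dJ: "((\<lambda>z. jtheta j t (u z)) has_field_derivative - of_real (2 * pi * t) * jtheta (Suc j) t (u z)) (at z)" for j z
  proof -
    have "(u has_field_derivative - of_real (2 * pi * t)) (at z)"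
      unfolding u_def by (auto intro!: derivative_eq_intros)
    from DERIV_chain2[OF jtheta_has_derivative[OF t] this] show ?thesis by (simp add: mult.commute)
  qed
  have dK: "((\<lambda>z. jtheta j (1/t) (v z)) has_field_derivative \<i> * of_real (2 * pi) * jtheta (Suc j) (1/t) (v z)) (at z)" for j z
  proof -
    have "(v has_field_derivative \<i> * of_real (2 * pi)) (at z)"
      unfolding v_def by (auto intro!: derivative_eq_intros)
    from DERIV_chain2[OF jtheta_has_derivative[OF t'] this] show ?thesis by (simp add: mult.commute)
  qed
  have dE: "(E has_field_derivative - (2 * of_real (pi * t) * z) * E z) (at z)" for z
    unfolding E_def by (auto intro!: derivative_eq_intros simp: power2_eq_square)
  have eq0: "E z * jtheta 0 t (u z) = jtheta 0 (1/t) (v z) / of_real (sqrt t)" for z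
    unfolding E_def u_def v_def by (rule jtheta_modular[OF t])
  have d1: "((\<lambda>z. E z * jtheta 0 t (u z)) has_field_derivative - of_real (2 * pi * t) * (E z * (z * jtheta 0 t (u z) + jtheta 1 t (u z)))) (at z)" for z
    by (rule derivative_eq_intros dE dJ refl)+ (simp add: algebra_simps)
  have d2: "((\<lambda>z. E z * jtheta 0 t (u z)) has_field_derivative \<i> * of_real (2 * pi) * jtheta 1 (1/t) (v z) / of_real (sqrt t)) (at z)" for z
    unfolding eq0 by (rule derivative_eq_intros dK refl | use st in simp)+
  have eq1: "E z * (z * jtheta 0 t (u z) + jtheta 1 t (u z)) =
           - (\<i> / of_real t) * jtheta 1 (1/t) (v z) / of_real (sqrt t)" for z
  proof -
    define X where "X = E z * (z * jtheta 0 t (u z) + jtheta 1 t (u z))"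
    have "- of_real (2 * pi * t) * X = \<i> * of_real (2 * pi) * jtheta 1 (1/t) (v z) / of_real (sqrt t)"
      using DERIV_unique[OF d1[of z] d2[of z]] by (simp add: X_def)
    then have "X = (\<i> * of_real (2 * pi) * jtheta 1 (1/t) (v z) / of_real (sqrt t)) / (- of_real (2 * pi * t))"
      using t by (metis mult_eq_0_iff neg_equal_0_iff_equal nonzero_mult_div_cancel_left of_real_eq_0_iff order_less_irrefl pi_neq_zero zero_neq_numeral)
    then show ?thesis unfolding X_def[symmetric] using t st by simp
  qed
  then show "E z * (z * jtheta 0 t (u z) + jtheta 1 t (u z)) =
           - (\<i> / of_real t) * jtheta 1 (1/t) (v z) / of_real (sqrt t)" .
  have e1: "((\<lambda>z. E z * (z * jtheta 0 t (u z) + jtheta 1 t (u z))) has_field_derivative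
       (E z * jtheta 0 t (u z) - of_real (2 * pi * t) * (E z * (z\<^sup>2 * jtheta 0 t (u z) + 2 * z * jtheta 1 t (u z) + jtheta 2 t (u z))))) (at z)" for z
    by (rule derivative_eq_intros dE dJ refl)+ (simp add: algebra_simps power2_eq_square numeral_2_eq_2)
  have e2: "((\<lambda>z. E z * (z * jtheta 0 t (u z) + jtheta 1 t (u z))) has_field_derivative
       - (\<i> / of_real t) * (\<i> * of_real (2 * pi) * jtheta 2 (1/t) (v z)) / of_real (sqrt t)) (at z)" for z
    unfolding eq1 by (rule derivative_eq_intros dK refl | use st t in \<open>simp add: numeral_2_eq_2\<close>)+
  have "E z * jtheta 0 t (u z) - of_real (2 * pi * t) * (E z * (z\<^sup>2 * jtheta 0 t (u z) + 2 * z * jtheta 1 t (u z) + jtheta 2 t (u z)))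
     = of_real (2 * pi) / of_real t * jtheta 2 (1/t) (v z) / of_real (sqrt t)"
    using DERIV_unique[OF e1[of z] e2[of z]] by (simp add: mult.assoc)
  then have "of_real (2 * pi * t) * (E z * (z\<^sup>2 * jtheta 0 t (u z) + 2 * z * jtheta 1 t (u z) + jtheta 2 t (u z)))
     = jtheta 0 (1/t) (v z) / of_real (sqrt t) - of_real (2 * pi) / of_real t * jtheta 2 (1/t) (v z) / of_real (sqrt t)"
    unfolding eq0 by (simp add: algebra_simps)
  then show "E z * (z\<^sup>2 * jtheta 0 t (u z) + 2 * z * jtheta 1 t (u z) + jtheta 2 t (u z)) =
           (jtheta 0 (1/t) (v z) / of_real (2 * pi * t) - jtheta 2 (1/t) (v z) / of_real (t\<^sup>2)) / of_real (sqrt t)"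
    (is "?X = (?A / _ - ?B / _) / ?S")
  proof -
    have solve: "X = (A / (p * w) - B / w\<^sup>2) / S" if "p * w * X = A / S - p / w * B / S" "p \<noteq> 0" "w \<noteq> 0" "S \<noteq> 0"
      for X A B S p w :: complex
    proof -
      have "X = (p * w * X) / (p * w)" using that(2-4) by simp
      also have "\<dots> = (A / S - p / w * B / S) / (p * w)" unfolding that(1) ..
      also have "\<dots> = (A / (p * w) - B / w\<^sup>2) / S"
        using that(2-4) by (simp add: power2_eq_square diff_divide_distrib mult_ac)
      finally show ?thesis .
    qed
    from solve[of "of_real (2 * pi)" "of_real t" ?X ?A ?S ?B] show ?thesis
      using \<open>of_real (2 * pi * t) * ?X = _\<close> t st by simp
  qed
qed

section \<open>Poisson summation with periodic weights in several variables\<close>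

text \<open>Poisson summation seen modulo \<open>d\<close>: the sums of \<open>a\<close> over
  residue classes are the values at \<open>r / d\<close> of the Fourier series with coefficients
  \<open>b\<close>. In this form it combines with any weight that is periodic modulo
  \<open>d\<close>.\<close>

definition poisson_pair :: "int \<Rightarrow> (int \<Rightarrow> complex) \<Rightarrow> (int \<Rightarrow> complex) \<Rightarrow> bool" where
  "poisson_pair d a b \<longleftrightarrow> (\<lambda>k. norm (a k)) summable_on UNIV \<and> (\<lambda>k. norm (b k)) summable_on UNIV \<and>
     (\<forall>r. (\<Sum>\<^sub>\<infinity>k\<in>{k. k mod d = r mod d}. a k) = (\<Sum>\<^sub>\<infinity>l. b l * cis (2 * pi * of_int (l * r) / of_int d)))"

text \<open>Here \<open>k\<close> stands for the inner product of a point with a frame vector of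
  squared length \<open>d\<close>; the component of the point along that vector has squared length
  \<open>k\<^sup>2 / d\<close>.\<close>

definition gaussian :: "int \<Rightarrow> real \<Rightarrow> int \<Rightarrow> complex" where
  "gaussian d t k = of_real (exp (- (pi * t * (of_int k)\<^sup>2 / of_int d)))"

lemma gaussian_eq_jtheta_term: "of_int k ^ j * gaussian d t k = jtheta_term j (t / of_int d) 0 k"
  by (simp add: gaussian_def jtheta_term_def flip: exp_of_real)

lemma gaussian_moment_abs_summable:
  "d > 0 \<Longrightarrow> t > 0 \<Longrightarrow> (\<lambda>k. norm (of_int k ^ j * gaussian d t k)) summable_on UNIV"
  unfolding gaussian_eq_jtheta_term by (rule jtheta_term_abs_summable) simp

lemma gaussian_cis_eq_jtheta_term:
  "of_int l ^ j * gaussian d t l * cis (2 * pi * of_int (l * r) / of_int d) =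
     jtheta_term j (t / of_int d) (\<i> * of_real (2 * pi) * of_real (of_int r / of_int d)) l"
proof -
  have "gaussian d t l * cis (2 * pi * of_int (l * r) / of_int d) =
     exp (of_real (- (pi * (t / of_int d) * (of_int l)\<^sup>2)) + of_int l * (\<i> * of_real (2 * pi) * of_real (of_int r / of_int d)))"
    unfolding gaussian_def cis_conv_exp exp_of_real[symmetric] exp_add[symmetric]
    by (simp add: mult_ac)
  then show ?thesis by (simp only: jtheta_term_def mult.assoc)
qed

lemma infsum_residue_class:
  fixes d :: int
  assumes "d > 0"
  shows "(\<Sum>\<^sub>\<infinity>k\<in>{k. k mod d = r mod d}. a k) = (\<Sum>\<^sub>\<infinity>n. a (r + d * n))"
proof (rule infsum_reindex_bij_witness[of _ "\<lambda>n. r + d * n" "\<lambda>k. (k - r) div d"])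
  fix k assume "k \<in> {k. k mod d = r mod d}"
  then have "d dvd k - r" by (simp add: mod_eq_dvd_iff)
  then show "r + d * ((k - r) div d) = k" by simp
  then show "a (r + d * ((k - r) div d)) = a k" by simp
qed (use assms in auto)

text \<open>Writing \<open>k = d * (x + n)\<close> with \<open>x = r / d\<close> turns the exponent
  \<open>pi * t * k\<^sup>2 / d\<close> into \<open>pi * T * (x + n)\<^sup>2\<close>; hence
  \<open>T = t * d\<close>.\<close>

lemma gaussian_residue_sum:
  fixes d r :: int
  assumes d: "d > 0" and t: "t > 0"
  defines "x \<equiv> of_int r / complex_of_real (of_int d)" and "T \<equiv> t * of_int d"
  shows "(\<Sum>\<^sub>\<infinity>k\<in>{k. k mod d = r mod d}. of_int k ^ j * gaussian d t k) =
     of_int d ^ j * (\<Sum>\<^sub>\<infinity>n. exp (- (of_real (pi * T) * x\<^sup>2)) * ((x + of_int n) ^ j * jtheta_term 0 T (- (of_real (2 * pi * T) * x)) n))"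
proof -
  have "(\<Sum>\<^sub>\<infinity>k\<in>{k. k mod d = r mod d}. of_int k ^ j * gaussian d t k) = (\<Sum>\<^sub>\<infinity>n. of_int (r + d * n) ^ j * gaussian d t (r + d * n))"
    by (rule infsum_residue_class[OF d])
  also have "of_int (r + d * n) ^ j * gaussian d t (r + d * n) =
     of_int d ^ j * (exp (- (of_real (pi * T) * x\<^sup>2)) * ((x + of_int n) ^ j * jtheta_term 0 T (- (of_real (2 * pi * T) * x)) n))" for n
  proof -
    have e: "of_int (r + d * n) = of_int d * (x + of_int n)" using d by (simp add: x_def field_simps)
    have "gaussian d t (r + d * n) = exp (- (of_real (pi * t) * (of_int (r + d * n))\<^sup>2 / of_int d))"
      by (simp add: gaussian_def flip: exp_of_real)
    also have "\<dots> = exp (- (of_real (pi * T) * (x + of_int n)\<^sup>2))"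
      unfolding e T_def using d by (simp add: power2_eq_square mult_ac)
    finally show ?thesis
      unfolding gaussian_shift_term[symmetric] e power_mult_distrib by (simp only: mult_ac)
  qed
  then have "(\<Sum>\<^sub>\<infinity>n. of_int (r + d * n) ^ j * gaussian d t (r + d * n)) =
     (\<Sum>\<^sub>\<infinity>n. of_int d ^ j * (exp (- (of_real (pi * T) * x\<^sup>2)) * ((x + of_int n) ^ j * jtheta_term 0 T (- (of_real (2 * pi * T) * x)) n)))"
    by simp
  also have "\<dots> = of_int d ^ j * (\<Sum>\<^sub>\<infinity>n. exp (- (of_real (pi * T) * x\<^sup>2)) * ((x + of_int n) ^ j * jtheta_term 0 T (- (of_real (2 * pi * T) * x)) n))"
    by (rule infsum_cmult_right')
  finally show ?thesis .
qed

text \<open>The dual parameter \<open>1 / T\<close> equals \<open>(1 / t) / d\<close>, so the dual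
  Gaussian belongs to the same \<open>d\<close> and to \<open>1 / t\<close>. The weights 1,
  \<open>k\<close> and \<open>k\<^sup>2\<close> are all that a quadratic form needs in one
  coordinate.\<close>

lemma poisson_pair_gaussian:
  assumes d: "d > 0" and t: "t > 0"
  shows "poisson_pair d (gaussian d t) (\<lambda>l. gaussian d (1/t) l / of_real (sqrt (t * of_int d)))" (is ?P0)
    and "poisson_pair d (\<lambda>k. of_int k * gaussian d t k)
           (\<lambda>l. - (\<i> / of_real t) * of_int l * gaussian d (1/t) l / of_real (sqrt (t * of_int d)))" (is ?P1)
    and "poisson_pair d (\<lambda>k. (of_int k)\<^sup>2 * gaussian d t k)
           (\<lambda>l. (of_int d / of_real (2 * pi * t) - (of_int l)\<^sup>2 / of_real (t\<^sup>2)) * gaussian d (1/t) l / of_real (sqrt (t * of_int d)))" (is ?P2)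
proof -
  define T where "T = t * of_int d"
  have T: "T > 0" "1/T > 0" using d t by (auto simp: T_def)
  have T1: "1/t/of_int d = 1/T" by (simp add: T_def)
  have t1: "1/t > 0" using t by simp
  define S where "S = complex_of_real (sqrt T)"
  have g: "(\<lambda>k. norm (of_int k ^ j * gaussian d t k)) summable_on UNIV"
    "(\<lambda>k. norm (of_int k ^ j * gaussian d (1/t) k)) summable_on UNIV" for j
    using gaussian_moment_abs_summable[OF d t] gaussian_moment_abs_summable[OF d t1] by auto
  have gs: "(\<lambda>k. norm (c * (of_int k ^ j * gaussian d (1/t) k))) summable_on UNIV" for c j
    unfolding norm_mult[of c] by (rule summable_on_cmult_right[OF g(2)])
  define x where "x r = of_int r / complex_of_real (of_int d)" for r
  define u where "u z = - (of_real (2 * pi * T) * z)" for z :: complex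
  define E where "E z = exp (- (of_real (pi * T) * z\<^sup>2))" for z :: complex
  have s: "jtheta_term j T z summable_on UNIV" for j z by (rule jtheta_term_summable[OF T(1)])
  have s': "jtheta_term j (1/T) z summable_on UNIV" for j z by (rule jtheta_term_summable[OF T(2)])
  have hs: "(jtheta_term j T z has_sum jtheta j T z) UNIV" for j z
    unfolding jtheta_def using s by (rule has_sum_infsum)
  have hs': "(jtheta_term j (1/T) z has_sum jtheta j (1/T) z) UNIV" for j z
    unfolding jtheta_def using s' by (rule has_sum_infsum)
  have jt: "of_int n ^ j * jtheta_term 0 T z n = jtheta_term j T z n" for j z n
    by (simp add: jtheta_term_def)
  have R: "of_int l ^ j * gaussian d (1/t) l * cis (2 * pi * of_int (l * r) / of_int d) =
     jtheta_term j (1/T) (\<i> * of_real (2 * pi) * x r) l" for l r j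
    unfolding gaussian_cis_eq_jtheta_term T1 by (simp add: x_def)
  note md = jtheta_modular_derivs[OF T(1)]
  have L: "(\<Sum>\<^sub>\<infinity>k\<in>{k. k mod d = r mod d}. of_int k ^ j * gaussian d t k) =
     of_int d ^ j * (\<Sum>\<^sub>\<infinity>n. E (x r) * ((x r + of_int n) ^ j * jtheta_term 0 T (u (x r)) n))" for r j
    unfolding E_def u_def x_def T_def by (rule gaussian_residue_sum[OF d t])
  show ?P0
    unfolding poisson_pair_def
  proof (intro conjI allI)
    show "(\<lambda>k. norm (gaussian d t k)) summable_on UNIV" using g(1)[of 0] by simp
    show "(\<lambda>k. norm (gaussian d (1 / t) k / of_real (sqrt (t * of_int d)))) summable_on UNIV"
      using gs[of "1 / of_real (sqrt (t * of_int d))" 0] by simp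
    fix r
    have "(\<Sum>\<^sub>\<infinity>k\<in>{k. k mod d = r mod d}. gaussian d t k) = (\<Sum>\<^sub>\<infinity>n. E (x r) * jtheta_term 0 T (u (x r)) n)"
      using L[of 0 r] by simp
    also have "\<dots> = E (x r) * jtheta 0 T (u (x r))"
      unfolding jtheta_def by (rule infsum_cmult_right')
    also have "\<dots> = jtheta 0 (1/T) (\<i> * of_real (2 * pi) * x r) / S"
      unfolding E_def u_def S_def by (rule jtheta_modular[OF T(1)])
    also have "\<dots> = (\<Sum>\<^sub>\<infinity>l. jtheta_term 0 (1/T) (\<i> * of_real (2 * pi) * x r) l / S)"
      by (intro infsumI[symmetric] has_sum_divide_complex hs')
    also have "\<dots> = (\<Sum>\<^sub>\<infinity>l. gaussian d (1/t) l / of_real (sqrt (t * of_int d)) * cis (2 * pi * of_int (l * r) / of_int d))"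
      unfolding R[symmetric] by (simp add: S_def T_def)
    finally show "(\<Sum>\<^sub>\<infinity>k\<in>{k. k mod d = r mod d}. gaussian d t k) = \<dots>" .
  qed
  show ?P1
    unfolding poisson_pair_def
  proof (intro conjI allI)
    show "(\<lambda>k. norm (of_int k * gaussian d t k)) summable_on UNIV" using g(1)[of 1] by simp
    show "(\<lambda>l. norm (- (\<i> / of_real t) * of_int l * gaussian d (1/t) l / of_real (sqrt (t * of_int d)))) summable_on UNIV"
      using gs[of "- (\<i> / of_real t) / of_real (sqrt (t * of_int d))" 1] by (simp add: mult.assoc)
    fix r
    have "(\<Sum>\<^sub>\<infinity>k\<in>{k. k mod d = r mod d}. of_int k * gaussian d t k) =
      of_int d * (\<Sum>\<^sub>\<infinity>n. E (x r) * (x r * jtheta_term 0 T (u (x r)) n + jtheta_term 1 T (u (x r)) n))"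
      using L[of 1 r] jt[of _ 1] by (simp add: ring_distribs)
    also have "(\<Sum>\<^sub>\<infinity>n. E (x r) * (x r * jtheta_term 0 T (u (x r)) n + jtheta_term 1 T (u (x r)) n))
       = E (x r) * (x r * jtheta 0 T (u (x r)) + jtheta 1 T (u (x r)))"
      by (intro infsumI has_sum_cmult_right has_sum_add hs)
    also have "\<dots> = - (\<i> / of_real T) * jtheta 1 (1/T) (\<i> * of_real (2 * pi) * x r) / S"
      unfolding E_def u_def S_def by (rule md(1))
    also have "of_int d * \<dots> = - (\<i> / of_real t) * jtheta 1 (1/T) (\<i> * of_real (2 * pi) * x r) / S"
      using d by (simp add: T_def)
    also have "\<dots> = (\<Sum>\<^sub>\<infinity>l. - (\<i> / of_real t) * jtheta_term 1 (1/T) (\<i> * of_real (2 * pi) * x r) l / S)"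
      by (intro infsumI[symmetric] has_sum_divide_complex has_sum_cmult_right hs')
    also have "\<dots> = (\<Sum>\<^sub>\<infinity>l. - (\<i> / of_real t) * of_int l * gaussian d (1/t) l / of_real (sqrt (t * of_int d)) * cis (2 * pi * of_int (l * r) / of_int d))"
      unfolding R[symmetric] by (simp add: S_def T_def mult.assoc)
    finally show "(\<Sum>\<^sub>\<infinity>k\<in>{k. k mod d = r mod d}. of_int k * gaussian d t k) = \<dots>" .
  qed
  show ?P2
    unfolding poisson_pair_def
  proof (intro conjI allI)
    show "(\<lambda>k. norm ((of_int k)\<^sup>2 * gaussian d t k)) summable_on UNIV" using g(1)[of 2] by simp
    have "(\<lambda>l. norm (of_int d / of_real (2 * pi * t) / of_real (sqrt (t * of_int d)) * (of_int l ^ 0 * gaussian d (1/t) l)) +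
              norm (1 / of_real (t\<^sup>2) / of_real (sqrt (t * of_int d)) * (of_int l ^ 2 * gaussian d (1/t) l))) summable_on UNIV"
      by (intro summable_on_add gs)
    then show "(\<lambda>l. norm ((of_int d / of_real (2 * pi * t) - (of_int l)\<^sup>2 / of_real (t\<^sup>2)) * gaussian d (1/t) l / of_real (sqrt (t * of_int d)))) summable_on UNIV"
    proof (rule Infinite_Sum.abs_summable_on_comparison_test')
      fix l :: int
      have e: "(of_int d / of_real (2 * pi * t) - (of_int l)\<^sup>2 / of_real (t\<^sup>2)) * gaussian d (1/t) l / of_real (sqrt (t * of_int d)) =
          of_int d / of_real (2 * pi * t) / of_real (sqrt (t * of_int d)) * (of_int l ^ 0 * gaussian d (1/t) l) -
              1 / of_real (t\<^sup>2) / of_real (sqrt (t * of_int d)) * (of_int l ^ 2 * gaussian d (1/t) l)"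
        by (simp only: left_diff_distrib diff_divide_distrib power_0 mult_1_left times_divide_eq_left)
      show "norm ((of_int d / of_real (2 * pi * t) - (of_int l)\<^sup>2 / of_real (t\<^sup>2)) * gaussian d (1/t) l / of_real (sqrt (t * of_int d))) \<le>
         norm (of_int d / of_real (2 * pi * t) / of_real (sqrt (t * of_int d)) * (of_int l ^ 0 * gaussian d (1/t) l)) +
              norm (1 / of_real (t\<^sup>2) / of_real (sqrt (t * of_int d)) * (of_int l ^ 2 * gaussian d (1/t) l))"
        unfolding e by (rule norm_triangle_ineq4)
    qed
    fix r
    have "(\<Sum>\<^sub>\<infinity>k\<in>{k. k mod d = r mod d}. (of_int k)\<^sup>2 * gaussian d t k) =
      (of_int d)\<^sup>2 * (\<Sum>\<^sub>\<infinity>n. E (x r) * ((x r)\<^sup>2 * jtheta_term 0 T (u (x r)) n + 2 * x r * jtheta_term 1 T (u (x r)) n + jtheta_term 2 T (u (x r)) n))"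
      using L[of 2 r] jt[of _ 2, symmetric] jt[of _ 1, symmetric] by (simp add: ring_distribs power2_sum ac_simps)
    also have "(\<Sum>\<^sub>\<infinity>n. E (x r) * ((x r)\<^sup>2 * jtheta_term 0 T (u (x r)) n + 2 * x r * jtheta_term 1 T (u (x r)) n + jtheta_term 2 T (u (x r)) n))
       = E (x r) * ((x r)\<^sup>2 * jtheta 0 T (u (x r)) + 2 * x r * jtheta 1 T (u (x r)) + jtheta 2 T (u (x r)))"
      by (intro infsumI has_sum_cmult_right has_sum_add hs)
    also have "\<dots> = (jtheta 0 (1/T) (\<i> * of_real (2 * pi) * x r) / of_real (2 * pi * T) - jtheta 2 (1/T) (\<i> * of_real (2 * pi) * x r) / of_real (T\<^sup>2)) / S"
      unfolding E_def u_def S_def by (rule md(2))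
    also have "(of_int d)\<^sup>2 * \<dots> = (of_int d / of_real (2 * pi * t) * jtheta 0 (1/T) (\<i> * of_real (2 * pi) * x r) - 1 / of_real (t\<^sup>2) * jtheta 2 (1/T) (\<i> * of_real (2 * pi) * x r)) / S"
    proof -
      have "(w::complex)\<^sup>2 * ((A / (p * (s * w)) - B / (s * w)\<^sup>2) / S) = (w / (p * s) * A - 1 / s\<^sup>2 * B) / S"
        if "w \<noteq> 0" for w A B p s S
        using that by (simp add: power2_eq_square right_diff_distrib)
      from this[of "of_int d" _ "of_real (2 * pi)" "of_real t"] show ?thesis
        using d by (simp add: T_def mult.assoc)
    qed
    also have "\<dots> = (\<Sum>\<^sub>\<infinity>l. (of_int d / of_real (2 * pi * t) * jtheta_term 0 (1/T) (\<i> * of_real (2 * pi) * x r) l - 1 / of_real (t\<^sup>2) * jtheta_term 2 (1/T) (\<i> * of_real (2 * pi) * x r) l) / S)"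
      by (intro infsumI[symmetric] has_sum_divide_complex has_sum_diff_complex has_sum_cmult_right hs')
    also have "\<dots> = (\<Sum>\<^sub>\<infinity>l. (of_int d / of_real (2 * pi * t) - (of_int l)\<^sup>2 / of_real (t\<^sup>2)) * gaussian d (1/t) l / of_real (sqrt (t * of_int d)) * cis (2 * pi * of_int (l * r) / of_int d))"
      unfolding R[symmetric] S_def T_def[symmetric] by (intro infsum_cong) (simp add: diff_divide_distrib left_diff_distrib)
    finally show "(\<Sum>\<^sub>\<infinity>k\<in>{k. k mod d = r mod d}. (of_int k)\<^sup>2 * gaussian d t k) = \<dots>" .
  qed
qed

text \<open>Every finite set of index functions lies in a finite box, over which the sum of products
  is a product of sums, each bounded by a one-dimensional total.\<close>

lemma abs_summable_prod:
  fixes f :: "'n::finite \<Rightarrow> int \<Rightarrow> complex"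
  assumes "\<And>i. (\<lambda>k. norm (f i k)) summable_on UNIV"
  shows "(\<lambda>k. norm (\<Prod>i\<in>UNIV. f i (k i))) summable_on UNIV"
proof (rule nonneg_bdd_above_summable_on)
  show "bdd_above (sum (\<lambda>k. norm (\<Prod>i\<in>UNIV. f i (k i))) ` {F. F \<subseteq> UNIV \<and> finite F})"
  proof (rule bdd_aboveI2)
    fix F :: "('n \<Rightarrow> int) set" assume "F \<in> {F. F \<subseteq> UNIV \<and> finite F}"
    then have fin: "finite F" by simp
    define B where "B i = (\<lambda>k. k i) ` F" for i
    have fB: "finite (B i)" for i using fin by (simp add: B_def)
    have sub: "F \<subseteq> PiE UNIV B" by (auto simp: B_def)
    have fP: "finite (PiE UNIV B)" using fB by (intro finite_PiE) auto
    have "(\<Sum>k\<in>F. norm (\<Prod>i\<in>UNIV. f i (k i))) \<le> (\<Sum>k\<in>PiE UNIV B. norm (\<Prod>i\<in>UNIV. f i (k i)))"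
      by (rule sum_mono2[OF fP sub]) auto
    also have "\<dots> = (\<Sum>\<^sub>\<infinity>k\<in>PiE UNIV B. \<Prod>i\<in>UNIV. norm (f i (k i)))"
      using fP by (simp add: prod_norm)
    also have "\<dots> = (\<Prod>i\<in>UNIV. infsum (\<lambda>k. norm (f i k)) (B i))"
      by (rule infsum_prod_PiE_abs) (use fB in auto)
    also have "\<dots> = (\<Prod>i\<in>UNIV. (\<Sum>k\<in>B i. norm (f i k)))" using fB by simp
    also have "\<dots> \<le> (\<Prod>i\<in>UNIV. (\<Sum>\<^sub>\<infinity>k. norm (f i k)))"
      using fB assms by (intro prod_mono conjI sum_nonneg finite_sum_le_infsum) auto
    finally show "(\<Sum>k\<in>F. norm (\<Prod>i\<in>UNIV. f i (k i))) \<le> (\<Prod>i\<in>UNIV. (\<Sum>\<^sub>\<infinity>k. norm (f i k)))" .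
  qed
qed auto

lemma infsum_prod_UNIV:
  fixes f :: "'n::finite \<Rightarrow> int \<Rightarrow> complex"
  assumes "\<And>i. (\<lambda>k. norm (f i k)) summable_on UNIV"
  shows "(\<Sum>\<^sub>\<infinity>k. \<Prod>i\<in>UNIV. f i (k i)) = (\<Prod>i\<in>UNIV. \<Sum>\<^sub>\<infinity>k. f i k)"
  using infsum_prod_PiE_abs[of UNIV f "\<lambda>_. UNIV"] assms by (simp add: PiE_UNIV_domain)

lemma infsum_finite_sum:
  fixes f :: "'a \<Rightarrow> 'b \<Rightarrow> complex"
  assumes "finite R" "\<And>r. r \<in> R \<Longrightarrow> f r summable_on A"
  shows "infsum (\<lambda>k. \<Sum>r\<in>R. f r k) A = (\<Sum>r\<in>R. infsum (f r) A)"
proof -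
  have "(\<lambda>k. \<Sum>r\<in>R. f r k) summable_on A \<and> infsum (\<lambda>k. \<Sum>r\<in>R. f r k) A = (\<Sum>r\<in>R. infsum (f r) A)"
    using assms by (induction R) (auto simp: infsum_add summable_on_add)
  then show ?thesis by blast
qed

definition residue_box :: "('n::finite \<Rightarrow> int) \<Rightarrow> ('n \<Rightarrow> int) set" where
  "residue_box d = PiE UNIV (\<lambda>i. {0..<d i})"

definition frac_pairing :: "('n::finite \<Rightarrow> int) \<Rightarrow> ('n \<Rightarrow> int) \<Rightarrow> ('n \<Rightarrow> int) \<Rightarrow> real" where
  "frac_pairing d l k = (\<Sum>i\<in>UNIV. of_int (l i * k i) / of_int (d i))"

definition finite_fourier :: "('n::finite \<Rightarrow> int) \<Rightarrow> (('n \<Rightarrow> int) \<Rightarrow> complex) \<Rightarrow> ('n \<Rightarrow> int) \<Rightarrow> complex" where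
  "finite_fourier d c l = (\<Sum>r\<in>residue_box d. c r * cis (2 * pi * frac_pairing d l r))"

lemma finite_residue_box: "finite (residue_box d)"
  unfolding residue_box_def by (rule finite_PiE) auto

lemma residue_box_iff: "r \<in> residue_box d \<longleftrightarrow> (\<forall>i. 0 \<le> r i \<and> r i < d i)"
  by (auto simp: residue_box_def PiE_UNIV_domain)

lemma cis_frac_pairing:
  "cis (2 * pi * frac_pairing d l r) = (\<Prod>i\<in>UNIV. cis (2 * pi * of_int (l i * r i) / of_int (d i)))"
proof -
  have "(\<Prod>i\<in>A. cis (f i)) = cis (sum f A)" if "finite A" for A :: "'n set" and f
    using that by (induction A) (auto simp: cis_mult)
  from this[of UNIV "\<lambda>i. 2 * pi * of_int (l i * r i) / of_int (d i)"]
  show ?thesis by (simp add: frac_pairing_def sum_distrib_left)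
qed

text \<open>A periodic weight is a finite combination of indicators of residue classes of vectors.
  For each class the sum is a product of one-dimensional sums, to which the pairs apply, and the
  collected phases form \<open>finite_fourier\<close>.\<close>

theorem poisson_pair_multi:
  fixes d :: "'n::finite \<Rightarrow> int"
  assumes d: "\<And>i. d i > 0" and ab: "\<And>i. poisson_pair (d i) (a i) (b i)"
    and per: "\<And>k. c (\<lambda>i. k i mod d i) = c k"
  shows "(\<Sum>\<^sub>\<infinity>k. c k * (\<Prod>i\<in>UNIV. a i (k i))) = (\<Sum>\<^sub>\<infinity>l. finite_fourier d c l * (\<Prod>i\<in>UNIV. b i (l i)))"
proof -
  let ?R = "residue_box d"
  have fin: "finite ?R" by (rule finite_residue_box)
  have sa: "(\<lambda>k. norm (a i k)) summable_on UNIV" and sb: "(\<lambda>k. norm (b i k)) summable_on UNIV"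
    and eq: "\<And>r. (\<Sum>\<^sub>\<infinity>k\<in>{k. k mod d i = r mod d i}. a i k) = (\<Sum>\<^sub>\<infinity>l. b i l * cis (2 * pi * of_int (l * r) / of_int (d i)))" for i
    using ab[of i] by (auto simp: poisson_pair_def)
  \<comment> \<open>Cutting each \<open>a i\<close> down to one residue class lets exactly one
    \<open>r\<close> contribute for each \<open>k\<close> and keeps the summand a product over
    coordinates.\<close>
  define a' where "a' r i k = (if k mod d i = r i mod d i then a i k else 0)" for r i k
  define b' where "b' r i l = b i l * cis (2 * pi * of_int (l * r i) / of_int (d i))" for r i l
  have sa': "(\<lambda>k. norm (a' r i k)) summable_on UNIV" for r i
    by (rule Infinite_Sum.abs_summable_on_comparison_test'[OF sa[of i]]) (auto simp: a'_def)
  have sb': "(\<lambda>k. norm (b' r i k)) summable_on UNIV" for r i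
    using sb[of i] by (simp add: b'_def norm_mult)
  have dec: "c k * (\<Prod>i\<in>UNIV. a i (k i)) = (\<Sum>r\<in>?R. c r * (\<Prod>i\<in>UNIV. a' r i (k i)))" for k
  proof -
    let ?r = "\<lambda>i. k i mod d i"
    have r: "?r \<in> ?R" using d by (simp add: residue_box_iff)
    have "c r * (\<Prod>i\<in>UNIV. a' r i (k i)) = 0" if "r \<in> ?R - {?r}" for r
    proof -
      have "r \<noteq> ?r" using that by blast
      then obtain i where "r i \<noteq> k i mod d i" by (auto simp: fun_eq_iff)
      moreover have "r i mod d i = r i" using that by (simp add: residue_box_iff)
      ultimately have "a' r i (k i) = 0" by (simp add: a'_def)
      then have "(\<Prod>i\<in>UNIV. a' r i (k i)) = 0" by (intro prod_zero) auto
      then show ?thesis by simp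
    qed
    then have "(\<Sum>r\<in>?R. c r * (\<Prod>i\<in>UNIV. a' r i (k i))) = c ?r * (\<Prod>i\<in>UNIV. a' ?r i (k i))"
      using fin r by (subst sum.remove[OF fin r]) (simp add: sum.neutral)
    also have "\<dots> = c k * (\<Prod>i\<in>UNIV. a i (k i))" unfolding per by (simp add: a'_def)
    finally show ?thesis ..
  qed
  have dec': "finite_fourier d c l * (\<Prod>i\<in>UNIV. b i (l i)) = (\<Sum>r\<in>?R. c r * (\<Prod>i\<in>UNIV. b' r i (l i)))" for l
    unfolding finite_fourier_def sum_distrib_right
  proof (rule sum.cong[OF refl])
    fix r
    have "(\<Prod>i\<in>UNIV. b' r i (l i)) = (\<Prod>i\<in>UNIV. b i (l i)) * cis (2 * pi * frac_pairing d l r)"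
      unfolding b'_def prod.distrib cis_frac_pairing ..
    then show "c r * cis (2 * pi * frac_pairing d l r) * (\<Prod>i\<in>UNIV. b i (l i)) = c r * (\<Prod>i\<in>UNIV. b' r i (l i))"
      by (simp only: mult_ac)
  qed
  have "(\<Sum>\<^sub>\<infinity>k. c k * (\<Prod>i\<in>UNIV. a i (k i))) = (\<Sum>r\<in>?R. \<Sum>\<^sub>\<infinity>k. c r * (\<Prod>i\<in>UNIV. a' r i (k i)))"
    unfolding dec using fin
    by (rule infsum_finite_sum) (intro summable_on_cmult_right abs_summable_summable[OF abs_summable_prod[OF sa']])
  also have "\<dots> = (\<Sum>r\<in>?R. c r * (\<Prod>i\<in>UNIV. \<Sum>\<^sub>\<infinity>k. a' r i k))"
    by (simp only: infsum_cmult_right' infsum_prod_UNIV[OF sa'])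
  also have "\<dots> = (\<Sum>r\<in>?R. c r * (\<Prod>i\<in>UNIV. \<Sum>\<^sub>\<infinity>k. b' r i k))"
  proof -
    have "(\<Sum>\<^sub>\<infinity>k. a' r i k) = (\<Sum>\<^sub>\<infinity>k\<in>{k. k mod d i = r i mod d i}. a i k)" for r i
      unfolding a'_def by (rule infsum_cong_neutral) auto
    then show ?thesis by (simp add: eq b'_def)
  qed
  also have "\<dots> = (\<Sum>r\<in>?R. \<Sum>\<^sub>\<infinity>l. c r * (\<Prod>i\<in>UNIV. b' r i (l i)))"
    by (simp only: infsum_cmult_right' infsum_prod_UNIV[OF sb'])
  also have "\<dots> = (\<Sum>\<^sub>\<infinity>l. finite_fourier d c l * (\<Prod>i\<in>UNIV. b i (l i)))"
    unfolding dec' using fin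
    by (rule infsum_finite_sum[symmetric]) (intro summable_on_cmult_right abs_summable_summable[OF abs_summable_prod[OF sb']])
  finally show ?thesis .
qed

section \<open>Cusp forms of weight 14\<close>

definition uhp :: "complex set" where "uhp = {z. Im z > 0}"

definition qexp :: "complex \<Rightarrow> complex" where "qexp z = exp (2 * of_real pi * \<i> * z)"

definition qseries :: "(nat \<Rightarrow> complex) \<Rightarrow> complex \<Rightarrow> complex" where
  "qseries a z = (\<Sum>n. a n * qexp z ^ n)"

lemma open_uhp: "open uhp" and convex_uhp: "convex uhp"
  unfolding uhp_def by (rule open_halfspace_Im_gt, rule convex_halfspace_Im_gt)

lemma connected_uhp: "connected uhp"
  using convex_uhp by (rule convex_connected)

lemma uhp_nonzero: "z \<in> uhp \<Longrightarrow> z \<noteq> 0"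
  by (auto simp: uhp_def)

lemma Im_neg_inverse: "Im (- 1 / z) = Im z / (norm z)\<^sup>2"
  by (simp add: Im_divide norm_complex_def)

lemma uhp_S: "z \<in> uhp \<Longrightarrow> - 1 / z \<in> uhp"
  using uhp_nonzero[of z] unfolding uhp_def mem_Collect_eq Im_neg_inverse by simp

lemma uhp_shift: "Im c = 0 \<Longrightarrow> z \<in> uhp \<Longrightarrow> z + c \<in> uhp"
  by (simp add: uhp_def)

lemma norm_qexp: "norm (qexp z) = exp (- (2 * pi * Im z))"
  by (simp add: qexp_def)

lemma norm_qexp_less_1: "z \<in> uhp \<Longrightarrow> norm (qexp z) < 1"
  by (simp add: norm_qexp uhp_def)

lemma qexp_plus_1: "qexp (z + 1) = qexp z"
  by (simp add: qexp_def distrib_left exp_add)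

lemma qseries_plus_1: "qseries a (z + 1) = qseries a z"
  by (simp add: qseries_def qexp_plus_1)

lemma qseries_plus_int: "qseries a (z + of_int n) = qseries a z"
proof (induction n rule: int_induct[of _ 0])
  case (step1 i)
  then show ?case using qseries_plus_1[of a "z + of_int i"] by (simp add: add_ac)
next
  case (step2 i)
  then show ?case using qseries_plus_1[of a "z + of_int (i - 1)"] by (simp add: algebra_simps)
qed simp

lemma qexp_surj:
  assumes "w \<noteq> 0"
  obtains z where "qexp z = w" "Im z = - ln (norm w) / (2 * pi)"
proof -
  define z where "z = Ln w / (2 * of_real pi * \<i>)"
  have q: "qexp z = w" using assms by (simp add: qexp_def z_def)
  then have "norm w = exp (- (2 * pi * Im z))" by (metis norm_qexp)
  then have "ln (norm w) = - (2 * pi * Im z)" by simp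
  then have "Im z = - ln (norm w) / (2 * pi)" by (simp add: field_simps)
  with q that show ?thesis by blast
qed

lemma qseries_has_derivative:
  assumes sm: "\<And>w::complex. norm w < 1 \<Longrightarrow> summable (\<lambda>n. a n * w ^ n)" and z: "z \<in> uhp"
  shows "(qseries a has_field_derivative qseries (\<lambda>n. 2 * of_real pi * \<i> * of_nat n * a n) z) (at z)"
proof -
  let ?P = "\<lambda>w. \<Sum>n. a n * w ^ n" and ?w = "qexp z"
  have w: "norm ?w < 1" by (rule norm_qexp_less_1[OF z])
  have "(?P has_field_derivative (\<Sum>n. diffs a n * ?w ^ n)) (at ?w)"
    by (rule termdiffs_strong'[of 1]) (use sm w in auto)
  moreover have "(qexp has_field_derivative 2 * of_real pi * \<i> * ?w) (at z)"
    unfolding qexp_def by (auto intro!: derivative_eq_intros)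
  ultimately have d: "((\<lambda>z. ?P (qexp z)) has_field_derivative (\<Sum>n. diffs a n * ?w ^ n) * (2 * of_real pi * \<i> * ?w)) (at z)"
    by (rule DERIV_chain2)
  have "summable (\<lambda>n. diffs a n * ?w ^ n)"
    by (rule termdiff_converges[of _ 1]) (use sm w in auto)
  then have "(\<lambda>n. of_nat n * a n * ?w ^ (n - Suc 0)) sums (\<Sum>n. diffs a n * ?w ^ n)"
    by (rule diffs_equiv)
  then have "(\<lambda>n. of_nat n * a n * ?w ^ (n - Suc 0) * (2 * of_real pi * \<i> * ?w)) sums ((\<Sum>n. diffs a n * ?w ^ n) * (2 * of_real pi * \<i> * ?w))"
    by (rule sums_mult2)
  moreover have "of_nat n * a n * ?w ^ (n - Suc 0) * (2 * of_real pi * \<i> * ?w) = (2 * of_real pi * \<i> * of_nat n * a n) * ?w ^ n" for n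
    by (cases n) (auto simp: mult_ac)
  ultimately have "qseries (\<lambda>n. 2 * of_real pi * \<i> * of_nat n * a n) z = (\<Sum>n. diffs a n * ?w ^ n) * (2 * of_real pi * \<i> * ?w)"
    unfolding qseries_def by (simp add: sums_iff)
  with d show ?thesis unfolding qseries_def by simp
qed

section \<open>Bol's identity and period polynomials\<close>

lemma higher_deriv_mult_ident:
  assumes "u holomorphic_on S" "open S" "z \<in> S"
  shows "(deriv ^^ Suc n) (\<lambda>w. w * u w) z = z * (deriv ^^ Suc n) u z + of_nat (Suc n) * (deriv ^^ n) u z"
proof -
  have "(deriv ^^ Suc n) (\<lambda>w. w * u w) z =
      (\<Sum>i = 0..Suc n. of_nat (Suc n choose i) * (deriv ^^ i) (\<lambda>w. w) z * (deriv ^^ (Suc n - i)) u z)"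
    by (rule higher_deriv_mult[OF _ assms]) auto
  also have "\<dots> = (\<Sum>i \<in> {0, 1}. of_nat (Suc n choose i) * (deriv ^^ i) (\<lambda>w. w) z * (deriv ^^ (Suc n - i)) u z)"
    by (rule sum.mono_neutral_right) auto
  also have "\<dots> = z * (deriv ^^ Suc n) u z + of_nat (Suc n) * (deriv ^^ n) u z"
    by simp
  finally show ?thesis .
qed

text \<open>Bol's identity: \<open>n + 1\<close> derivatives carry weight \<open>- n\<close> to
  weight \<open>n + 2\<close>. In the induction the new factor \<open>z\<close> meets a Leibniz rule
  with only two terms, and the contributions of \<open>F (Suc n)\<close> cancel because both have
  the coefficient \<open>n + 2\<close>.\<close>

lemma bol_identity:
  assumes F: "\<And>j z. z \<in> uhp \<Longrightarrow> (F j has_field_derivative F (Suc j) z) (at z)"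
  shows "z \<in> uhp \<Longrightarrow> (deriv ^^ Suc n) (\<lambda>z. z ^ n * F 0 (- 1 / z)) z = F (Suc n) (- 1 / z) / z ^ (n + 2)"
proof (induction n arbitrary: z)
  have dF: "((\<lambda>z. F j (- 1 / z)) has_field_derivative F (Suc j) (- 1 / z) / z ^ 2) (at z)" if z: "z \<in> uhp" for j z
  proof -
    have "((\<lambda>z. - 1 / z) has_field_derivative 1 / z ^ 2) (at z)"
      using uhp_nonzero[OF z] by (auto intro!: derivative_eq_intros simp: power2_eq_square)
    from DERIV_chain2[OF F[OF uhp_S[OF z]] this] show ?thesis by simp
  qed
  note hol = holomorphic_on_open[OF open_uhp]
  have holF: "(\<lambda>z. F 0 (- 1 / z)) holomorphic_on uhp"
    unfolding hol using dF by blast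
  {
    case 0
    then show ?case using DERIV_imp_deriv[OF dF[of z 0]] by (simp add: power2_eq_square)
  next
    case (Suc n)
    note z = uhp_nonzero[OF Suc.prems]
    let ?u = "\<lambda>z. z ^ n * F 0 (- 1 / z)"
    have holu: "?u holomorphic_on uhp" by (intro holomorphic_intros holF)
    have d: "((\<lambda>z. F (Suc n) (- 1 / z) / z ^ (n + 2)) has_field_derivative
        (F (Suc (Suc n)) (- 1 / z) / z ^ (n + 4) - of_nat (n + 2) * F (Suc n) (- 1 / z) / z ^ (n + 3))) (at z)"
    proof -
      have pw: "((\<lambda>z. z ^ (n + 2)) has_field_derivative of_nat (n + 2) * z ^ (n + 1)) (at z)"
        using DERIV_power[OF DERIV_ident, of "n + 2" z UNIV] by simp
      have nz: "z ^ (n + 2) \<noteq> 0" using z by simp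
      have alg: "(A / z\<^sup>2 * z ^ (n + 2) - B * (k * z ^ (n + 1))) / (z ^ (n + 2) * z ^ (n + 2)) = A / z ^ (n + 4) - k * B / z ^ (n + 3)" for A B k
        using z by (simp add: power_add power2_eq_square power3_eq_cube power4_eq_xxxx divide_simps) (simp add: algebra_simps)
      show ?thesis using DERIV_divide[OF dF[OF Suc.prems, of "Suc n"] pw nz] unfolding alg by simp
    qed
    have "(deriv ^^ Suc (Suc n)) ?u z = deriv ((deriv ^^ Suc n) ?u) z" by simp
    also have "\<dots> = deriv (\<lambda>z. F (Suc n) (- 1 / z) / z ^ (n + 2)) z"
      by (rule deriv_cong_ev) (use Suc.IH eventually_nhds_in_open[OF open_uhp Suc.prems] in \<open>auto elim!: eventually_mono\<close>)
    also have "\<dots> = F (Suc (Suc n)) (- 1 / z) / z ^ (n + 4) - of_nat (n + 2) * F (Suc n) (- 1 / z) / z ^ (n + 3)"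
      using d by (rule DERIV_imp_deriv)
    finally have D2: "(deriv ^^ Suc (Suc n)) ?u z = F (Suc (Suc n)) (- 1 / z) / z ^ (n + 4) - of_nat (n + 2) * F (Suc n) (- 1 / z) / z ^ (n + 3)" .
    have "(deriv ^^ Suc (Suc n)) (\<lambda>z. z ^ Suc n * F 0 (- 1 / z)) z = (deriv ^^ Suc (Suc n)) (\<lambda>z. z * ?u z) z"
      by (simp add: mult.assoc)
    also have "\<dots> = z * (deriv ^^ Suc (Suc n)) ?u z + of_nat (Suc (Suc n)) * (deriv ^^ Suc n) ?u z"
      by (rule higher_deriv_mult_ident[OF holu open_uhp Suc.prems])
    also have "\<dots> = z * (F (Suc (Suc n)) (- 1 / z) / z ^ (n + 4) - of_nat (n + 2) * F (Suc n) (- 1 / z) / z ^ (n + 3))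
        + of_nat (Suc (Suc n)) * (F (Suc n) (- 1 / z) / z ^ (n + 2))"
      unfolding D2 Suc.IH[OF Suc.prems] ..
    also have "\<dots> = F (Suc (Suc n)) (- 1 / z) / z ^ (Suc n + 2)"
    proof -
      have "z * (A / z ^ (n + 4) - k * B / z ^ (n + 3)) + k * (B / z ^ (n + 2)) = A / z ^ (n + 3)" for A B k
        using z by (simp add: power_add power2_eq_square power3_eq_cube power4_eq_xxxx divide_simps)
      from this[of _ "of_nat (n + 2)"] show ?thesis by (simp add: numeral_3_eq_3)
    qed
    finally show ?case .
  }
qed

text \<open>The Taylor series at \<open>\<i>\<close> stops at degree \<open>n\<close>. The disc of
  radius 1 just fits into the half-plane, and the identity theorem extends the polynomial from
  there.\<close>

lemma polynomial_if_higher_deriv_0: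
  assumes g: "g holomorphic_on uhp" and 0: "\<And>z. z \<in> uhp \<Longrightarrow> (deriv ^^ Suc n) g z = 0"
  obtains p where "degree p \<le> n" "\<And>z. z \<in> uhp \<Longrightarrow> g z = poly p z"
proof -
  define c where "c k = (deriv ^^ k) g \<i> / fact k" for k
  define p where "p = (\<Sum>k\<le>n. smult (c k) ([:- \<i>, 1:] ^ k))"
  have "degree p \<le> n" unfolding p_def
    by (rule degree_sum_le) (auto intro!: order.trans[OF degree_smult_le] simp: degree_linear_power)
  have hi: "(deriv ^^ (Suc n + m)) g z = 0" if "z \<in> uhp" for m z
    using that
  proof (induction m arbitrary: z)
    case (Suc m)
    have "(deriv ^^ (Suc n + Suc m)) g z = deriv ((deriv ^^ (Suc n + m)) g) z" by simp
    also have "\<dots> = deriv (\<lambda>_. 0) z"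
      by (rule deriv_cong_ev) (use Suc.IH eventually_nhds_in_open[OF open_uhp Suc.prems] in \<open>auto elim!: eventually_mono\<close>)
    finally show ?case by simp
  qed (use 0 in simp)
  have i: "\<i> \<in> uhp" by (simp add: uhp_def)
  have ball: "ball \<i> 1 \<subseteq> uhp"
  proof
    fix w assume "w \<in> ball \<i> 1"
    then have "norm (\<i> - w) < 1" by (simp add: dist_norm)
    moreover have "\<bar>Im (\<i> - w)\<bar> \<le> norm (\<i> - w)" by (rule abs_Im_le_cmod)
    ultimately show "w \<in> uhp" by (simp add: uhp_def)
  qed
  have eq: "g w = poly p w" if w: "w \<in> ball \<i> 1" for w
  proof -
    have "(\<lambda>k. (deriv ^^ k) g \<i> / fact k * (w - \<i>) ^ k) sums g w"
      by (rule holomorphic_power_series[OF holomorphic_on_subset[OF g ball] w])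
    moreover have "(\<lambda>k. (deriv ^^ k) g \<i> / fact k * (w - \<i>) ^ k) sums (\<Sum>k\<le>n. (deriv ^^ k) g \<i> / fact k * (w - \<i>) ^ k)"
    proof (rule sums_finite)
      fix k assume "k \<notin> {..n}"
      then have "k = Suc n + (k - Suc n)" by simp
      then have "(deriv ^^ k) g \<i> = 0" using hi[OF i, of "k - Suc n"] by metis
      then show "(deriv ^^ k) g \<i> / fact k * (w - \<i>) ^ k = 0" by simp
    qed simp
    ultimately have "g w = (\<Sum>k\<le>n. (deriv ^^ k) g \<i> / fact k * (w - \<i>) ^ k)" by (rule sums_unique2)
    also have "\<dots> = poly p w" by (simp add: p_def c_def poly_sum)
    finally show ?thesis .
  qed
  have "g z = poly p z" if "z \<in> uhp" for z
    by (rule analytic_continuation_open[of "ball \<i> 1" uhp g "poly p"])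
       (use g ball connected_uhp open_uhp eq that in \<open>auto intro!: holomorphic_intros\<close>)
  with \<open>degree p \<le> n\<close> that show ?thesis by blast
qed

text \<open>The first relation ties \<open>r j\<close> to \<open>r (12 - j)\<close> and leaves
  \<open>r 0\<close> to \<open>r 5\<close>. As \<open>1 - x ^ 12\<close> satisfies both relations,
  \<open>r 0\<close> drops out of the second, whose values at 0, 1, 2, 3, 4 give five independent
  linear equations for \<open>r 1\<close> to \<open>r 5\<close>. Over the reals linear arithmetic
  solves them.\<close>

lemma period_polynomial_real:
  fixes r :: "nat \<Rightarrow> real"
  assumes S: "\<And>x. (\<Sum>j\<le>12. r j * x ^ j) + (\<Sum>j\<le>12. r j * (- 1) ^ j * x ^ (12 - j)) = 0"
    and U: "\<And>x. (\<Sum>j\<le>12. r j * ((x + 1) ^ j - x ^ j + x ^ j * (x + 1) ^ (12 - j))) = 0"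
  shows "r 12 = - r 0 \<and> (\<forall>j\<in>{1..11}. r j = 0)"
proof -
  have "(\<Sum>j\<le>12. r j * (- 1) ^ j * x ^ (12 - j)) = (\<Sum>j\<le>12. r (12 - j) * (- 1) ^ j * x ^ j)" for x
    by (rule sum.reindex_bij_witness[of _ "\<lambda>j. 12 - j" "\<lambda>j. 12 - j"]) (auto simp: uminus_power_if)
  then have "\<forall>x. (\<Sum>j\<le>12. (r j + r (12 - j) * (- 1) ^ j) * x ^ j) = 0"
    using S by (simp add: sum.distrib distrib_right)
  then have "\<forall>j\<le>12. r j + r (12 - j) * (- 1) ^ j = 0"
    unfolding polyfun_eq_0 .
  note S' = this[rule_format]
  have s: "r 12 = - r 0" "r 11 = r 1" "r 10 = - r 2" "r 9 = r 3" "r 8 = - r 4" "r 7 = r 5" "r 6 = 0"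
    using S'[of 12] S'[of 11] S'[of 10] S'[of 9] S'[of 8] S'[of 7] S'[of 6] by simp_all
  have e: "(\<Sum>j\<le>12. f j) = f 0 + f 1 + f 2 + f 3 + f 4 + f 5 + f 6 + f 7 + f 8 + f 9 + f 10 + f 11 + f 12" for f :: "nat \<Rightarrow> real"
    by (simp add: eval_nat_numeral)
  have "2 * r 1 + 2 * r 3 + 2 * r 5 = 0"
    using U[of 0] by (simp add: e s)
  moreover have "4098 * r 1 + 1038 * r 3 + 318 * r 5 = 0"
    using U[of 1] by (simp add: e s)
  moreover have "535538 * r 1 + 168960 * r 2 + 190478 * r 3 + 78000 * r 4 + 103358 * r 5 = 0"
    using U[of 2] by (simp add: e s)
  moreover have "17308658 * r 1 + 7502880 * r 2 + 8580098 * r 3 + 3570000 * r 4 + 6235778 * r 5 = 0"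
    using U[of 3] by (simp add: e s)
  moreover have "260917842 * r 1 + 121318560 * r 2 + 159459042 * r 3 + 58715280 * r 4 + 131263842 * r 5 = 0"
    using U[of 4] by (simp add: e s)
  ultimately have z: "r 1 = 0" "r 2 = 0" "r 3 = 0" "r 4 = 0" "r 5 = 0" by linarith+
  have "r j = 0" if "j \<in> {1..11}" for j
  proof -
    have "j = 1 \<or> j = 2 \<or> j = 3 \<or> j = 4 \<or> j = 5 \<or> j = 6 \<or> j = 7 \<or> j = 8 \<or> j = 9 \<or> j = 10 \<or> j = 11"
      using that unfolding atLeastAtMost_iff by presburger
    then show ?thesis using z s by (elim disjE) simp_all
  qed
  then show ?thesis using s by blast
qed

text \<open>At real \<open>x\<close> both relations have real coefficients, so the real and
  imaginary parts of \<open>r\<close> satisfy them separately.\<close>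

lemma period_polynomial:
  fixes r :: "nat \<Rightarrow> complex"
  assumes S: "\<And>x. (\<Sum>j\<le>12. r j * x ^ j) + (\<Sum>j\<le>12. r j * (- 1) ^ j * x ^ (12 - j)) = 0"
    and U: "\<And>x. (\<Sum>j\<le>12. r j * ((x + 1) ^ j - x ^ j + x ^ j * (x + 1) ^ (12 - j))) = 0"
  shows "r 12 = - r 0 \<and> (\<forall>j\<in>{1..11}. r j = 0)"
proof -
  have c: "complex_of_real x ^ j = of_real (x ^ j)" "(complex_of_real x + 1) ^ j = of_real ((x + 1) ^ j)"
    "(- 1 :: complex) ^ j = of_real ((- 1) ^ j)" for x j by simp_all
  have Re: "Re (a * of_real b) = Re a * b" "Im (a * of_real b) = Im a * b" for a b by simp_all
  have "Re (r 12) = - Re (r 0) \<and> (\<forall>j\<in>{1..11}. Re (r j) = 0)"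
  proof (rule period_polynomial_real)
    fix x :: real
    show "(\<Sum>j\<le>12. Re (r j) * x ^ j) + (\<Sum>j\<le>12. Re (r j) * (- 1) ^ j * x ^ (12 - j)) = 0"
      using arg_cong[OF S[of "of_real x"], of Re] unfolding c by (simp only: plus_complex.sel Re_sum Re zero_complex.sel)
    show "(\<Sum>j\<le>12. Re (r j) * ((x + 1) ^ j - x ^ j + x ^ j * (x + 1) ^ (12 - j))) = 0"
      using arg_cong[OF U[of "of_real x"], of Re] unfolding c of_real_mult[symmetric] of_real_diff[symmetric] of_real_add[symmetric]
      by (simp only: Re_sum Re zero_complex.sel)
  qed
  moreover have "Im (r 12) = - Im (r 0) \<and> (\<forall>j\<in>{1..11}. Im (r j) = 0)"
  proof (rule period_polynomial_real)
    fix x :: real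
    show "(\<Sum>j\<le>12. Im (r j) * x ^ j) + (\<Sum>j\<le>12. Im (r j) * (- 1) ^ j * x ^ (12 - j)) = 0"
      using arg_cong[OF S[of "of_real x"], of Im] unfolding c by (simp only: plus_complex.sel Im_sum Re zero_complex.sel)
    show "(\<Sum>j\<le>12. Im (r j) * ((x + 1) ^ j - x ^ j + x ^ j * (x + 1) ^ (12 - j))) = 0"
      using arg_cong[OF U[of "of_real x"], of Im] unfolding c of_real_mult[symmetric] of_real_diff[symmetric] of_real_add[symmetric]
      by (simp only: Im_sum Re zero_complex.sel)
  qed
  ultimately show ?thesis by (auto simp: complex_eq_iff)
qed

section \<open>Vanishing in weight -12 and in weight 14\<close>

text \<open>Maximum modulus principle in the variable \<open>qexp z\<close>. The disc of radius
  \<open>R = exp (- pi)\<close> corresponds to Im z \<ge> 1/2. On its boundary the law leads to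
  another point of the disc at the price of a factor at most \<open>(1/2) ^ 6\<close>, so the
  maximum is at most a 64th of itself.\<close>

lemma negative_weight_vanishes:
  assumes sm: "\<And>w::complex. norm w < 1 \<Longrightarrow> summable (\<lambda>n. a n * w ^ n)"
    and mod: "\<And>z. z \<in> uhp \<Longrightarrow> qseries a z = z ^ 12 * qseries a (- 1 / z)"
  shows "a n = 0"
proof -
  define P where "P w = (\<Sum>n. a n * w ^ n)" for w
  define R where "R = exp (- pi)"
  have R: "0 < R" "R < 1" by (auto simp: R_def)
  have Pq: "qseries a z = P (qexp z)" for z by (simp add: P_def qseries_def)
  have dP: "\<exists>D. (P has_field_derivative D) (at w)" if "norm w < 1" for w
    using termdiffs_strong'[of 1 a w] sm that unfolding P_def by blast
  have contP: "continuous_on (cball 0 R) P"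
  proof (intro continuous_at_imp_continuous_on ballI)
    fix w :: complex assume "w \<in> cball 0 R"
    then show "isCont P w" using dP[of w] R DERIV_isCont by force
  qed
  have holP: "P holomorphic_on ball 0 R"
    unfolding holomorphic_on_open[OF open_ball] using dP R by auto
  obtain w0 where w0: "w0 \<in> cball 0 R" "\<And>w. w \<in> cball 0 R \<Longrightarrow> norm (P w) \<le> norm (P w0)"
    using continuous_attains_sup[OF compact_cball _ continuous_on_norm[OF contP]] R by (metis cball_eq_empty not_less_iff_gr_or_eq)
  define M where "M = norm (P w0)"
  have bd: "norm (P w) \<le> M / 64" if w: "w \<in> frontier (cball 0 R)" for w
  proof -
    have nw: "norm w = R" using w by (simp add: sphere_def)
    then have "w \<noteq> 0" using R by auto
    then obtain z where z: "qexp z = w" "Im z = - ln (norm w) / (2 * pi)" by (rule qexp_surj)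
    have Imz: "Im z = 1/2" using z(2) by (simp add: nw R_def)
    \<comment> \<open>Subtracting the nearest integer does not change \<open>qexp\<close> and brings
      the real part into [-1/2, 1/2], so that the squared modulus is at most 1/4 + 1/4.\<close>
    define z' where "z' = z + of_int (- round (Re z))"
    have Im': "Im z' = 1/2" by (simp add: z'_def Imz)
    have "\<bar>Re z'\<bar> \<le> 1/2" using of_int_round_abs_le[of "Re z"] by (simp add: z'_def abs_minus_commute)
    then have "(Re z')\<^sup>2 \<le> (1/2)\<^sup>2" by (metis abs_ge_zero power2_abs power_mono)
    then have nz2: "(norm z')\<^sup>2 \<le> 1/2" unfolding cmod_power2 Im' by (simp add: power_divide)
    have u: "z' \<in> uhp" by (simp add: uhp_def Im')
    have nz0: "(norm z')\<^sup>2 > 0" using uhp_nonzero[OF u] by simp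
    have "Im (- 1 / z') \<ge> 1" unfolding Im_neg_inverse Im' using nz2 nz0 by (simp add: field_simps)
    then have "pi * 1 \<le> 2 * pi * Im (- 1 / z')" by (intro mult_mono) auto
    then have "norm (qexp (- 1 / z')) \<le> R" unfolding norm_qexp R_def by simp
    then have b: "norm (P (qexp (- 1 / z'))) \<le> M" unfolding M_def by (intro w0(2)) simp
    have "norm (P w) = norm (qseries a z')" unfolding z'_def qseries_plus_int Pq z(1) ..
    also have "\<dots> = norm (z' ^ 12 * P (qexp (- 1 / z')))" using mod[OF u] unfolding Pq by simp
    also have "\<dots> = ((norm z')\<^sup>2) ^ 6 * norm (P (qexp (- 1 / z')))"
      by (simp add: norm_mult norm_power flip: power_mult)
    also have "\<dots> \<le> (1/2) ^ 6 * M"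
      using nz2 b by (intro mult_mono power_mono) auto
    finally show ?thesis by (simp add: power_divide)
  qed
  have "norm (P w0) \<le> M / 64"
    by (rule maximum_modulus_frontier[of P "cball 0 R"]) (use contP holP bd w0 in auto)
  then have "M \<le> 0" unfolding M_def by simp
  then have P0: "P w = 0" if "w \<in> cball 0 R" for w using w0(2)[OF that] by (simp add: M_def)
  have sums: "(\<lambda>n. a n * (w - 0) ^ n) sums P w" if "norm (w - 0) < R" for w
    using sm[of w] that R by (simp add: P_def summable_sums)
  show ?thesis
  proof (cases "n = 0")
    case True
    have "P 0 = a 0" by (simp add: P_def)
    then show ?thesis using True P0[of 0] R by simp
  next
    case False
    show ?thesis
    proof (rule ccontr)
      assume "a n \<noteq> 0"
      \<comment> \<open>A nonzero coefficient would make 0 an isolated zero of \<open>P\<close>,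
        which vanishes on a whole disc.\<close>
      then obtain s where s: "s > 0" "\<And>z. z \<in> cball 0 s - {0} \<Longrightarrow> P z \<noteq> 0"
        using powser_0_nonzero[where m = n, OF R(1) sums] False P0[of 0] R by (metis centre_in_cball less_imp_le neq0_conv)
      define w where "w = complex_of_real (min s R)"
      have "w \<in> cball 0 s - {0}" "w \<in> cball 0 R" using s(1) R by (auto simp: w_def)
      then show False using s(2) P0 by blast
    qed
  qed
qed

theorem cusp_form_weight_14_vanishes:
  assumes sm: "\<And>w::complex. norm w < 1 \<Longrightarrow> summable (\<lambda>n. a n * w ^ n)" and a0: "a 0 = 0"
    and mod: "\<And>z. z \<in> uhp \<Longrightarrow> qseries a (- 1 / z) = z ^ 14 * qseries a z"
  shows "a n = 0"
proof -
  \<comment> \<open>Coefficients of the \<open>k\<close>-fold antiderivative. A constant term would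
    have no periodic antiderivative; since \<open>a 0 = 0\<close>, the entry at \<open>n = 0\<close>
    is 0 for every \<open>k\<close>.\<close>
  define b where "b k n = a n / (2 * of_real pi * \<i> * of_nat n) ^ k" for k n
  have b0: "b k 0 = 0" for k using a0 by (simp add: b_def)
  have bsm: "summable (\<lambda>n. b k n * w ^ n)" if w: "norm w < 1" for k and w :: complex
  proof -
    have "norm (of_real ((1 + norm w) / 2) :: complex) < 1" using w by (simp del: of_real_divide of_real_add)
    from sm[OF this] have "summable (\<lambda>n. norm (a n * w ^ n))"
      by (rule powser_insidea) (use w in \<open>simp del: of_real_divide of_real_add\<close>)
    then show ?thesis
    proof (rule summable_comparison_test'[where N = 0])
      fix n :: nat
      have "norm (b k n) \<le> norm (a n)"
      proof (cases "n = 0")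
        case False
        have "2 * pi * real n \<ge> 1 * 1" using pi_gt3 False by (intro mult_mono) auto
        then have "(2 * pi * real n) ^ k \<ge> 1" by simp
        then show ?thesis by (simp add: b_def norm_divide norm_mult norm_power divide_le_eq mult_le_cancel_left1 split: if_splits)
      qed (simp add: a0 b0)
      then show "norm (b k n * w ^ n) \<le> norm (a n * w ^ n)" by (simp add: norm_mult mult_right_mono)
    qed
  qed
  \<comment> \<open>One unbroken chain of derivatives, as \<open>bol_identity\<close> requires:
    \<open>F 0\<close> is the 13-fold antiderivative, \<open>F 13\<close> the given form, and
    ordinary derivatives follow.\<close>
  define F where "F j = (if j \<le> 13 then qseries (b (13 - j)) else (deriv ^^ (j - 13)) (qseries a))" for j
  have ba: "b 0 = a" by (auto simp: b_def)
  have dq: "(qseries (b (Suc k)) has_field_derivative qseries (b k) z) (at z)" if z: "z \<in> uhp" for k z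
  proof -
    have "(\<lambda>n. 2 * of_real pi * \<i> * of_nat n * b (Suc k) n) = b k"
    proof
      fix n show "2 * of_real pi * \<i> * of_nat n * b (Suc k) n = b k n"
        by (cases "n = 0") (auto simp: b_def a0)
    qed
    then show ?thesis using qseries_has_derivative[OF bsm z, of "Suc k"] by simp
  qed
  have hola: "qseries a holomorphic_on uhp"
    unfolding holomorphic_on_open[OF open_uhp] using qseries_has_derivative[OF sm] by blast
  have dF: "(F j has_field_derivative F (Suc j) z) (at z)" if z: "z \<in> uhp" for j z
  proof (cases "j < 13")
    case True
    then have "13 - j = Suc (13 - Suc j)" by simp
    then show ?thesis using dq[OF z, of "13 - Suc j"] True by (simp add: F_def)
  next
    case False
    then have Fj: "F j = (deriv ^^ (j - 13)) (qseries a)" by (cases "j = 13") (auto simp: F_def ba)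
    have "F (Suc j) = (deriv ^^ Suc (j - 13)) (qseries a)" 
    proof -
      have "Suc j - 13 = Suc (j - 13)" using False by simp
      then show ?thesis using False by (simp add: F_def del: diff_Suc_Suc funpow.simps)
    qed
    then show ?thesis unfolding Fj using has_field_derivative_higher_deriv[OF hola open_uhp z] by simp
  qed
  have F13: "F 13 = qseries a" by (simp add: F_def ba)
  let ?f = "F 0"
  have holf: "?f holomorphic_on uhp"
    unfolding holomorphic_on_open[OF open_uhp] using dF by blast
  have holfS: "(\<lambda>z. z ^ 12 * ?f (- 1 / z)) holomorphic_on uhp"
  proof (intro holomorphic_intros)
    have "(\<lambda>z. - 1 / z) holomorphic_on uhp" using uhp_nonzero by (auto intro!: holomorphic_intros)
    from holomorphic_on_compose_gen[OF this holf] show "(\<lambda>z. ?f (- 1 / z)) holomorphic_on uhp"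
      using uhp_S by (auto simp: o_def)
  qed
  have df: "(deriv ^^ j) ?f z = F j z" if "z \<in> uhp" for j z
    using that
  proof (induction j arbitrary: z)
    case (Suc j)
    have "(deriv ^^ Suc j) ?f z = deriv ((deriv ^^ j) ?f) z" by simp
    also have "\<dots> = deriv (F j) z"
      by (rule deriv_cong_ev) (use Suc.IH eventually_nhds_in_open[OF open_uhp Suc.prems] in \<open>auto elim!: eventually_mono\<close>)
    also have "\<dots> = F (Suc j) z" using dF[OF Suc.prems] by (rule DERIV_imp_deriv)
    finally show ?case .
  qed simp
  let ?r = "\<lambda>z. ?f z - z ^ 12 * ?f (- 1 / z)"
  \<comment> \<open>By Bol's identity for \<open>n = 12\<close> the 13th derivative is
    \<open>qseries a\<close> minus its own weight 14 transform.\<close>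
  have r0: "(deriv ^^ Suc 12) ?r z = 0" if z: "z \<in> uhp" for z
  proof -
    have "(deriv ^^ Suc 12) ?r z = (deriv ^^ Suc 12) ?f z - (deriv ^^ Suc 12) (\<lambda>z. z ^ 12 * ?f (- 1 / z)) z"
      by (rule higher_deriv_diff[OF holf holfS open_uhp z])
    also have "(deriv ^^ Suc 12) ?f z = qseries a z" using df[OF z, of 13] F13 by simp
    also have "(deriv ^^ Suc 12) (\<lambda>z. z ^ 12 * ?f (- 1 / z)) z = F (Suc 12) (- 1 / z) / z ^ (12 + 2)"
      by (rule bol_identity[of F, OF dF z])
    also have "\<dots> = qseries a z" using F13 mod[OF z] uhp_nonzero[OF z] by simp
    finally show ?thesis by simp
  qed
  obtain p where p: "degree p \<le> 12" "\<And>z. z \<in> uhp \<Longrightarrow> ?r z = poly p z"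
    using polynomial_if_higher_deriv_0[of ?r 12] holomorphic_on_diff[OF holf holfS] r0 by blast
  define r where "r = coeff p"
  have pr: "poly p z = (\<Sum>j\<le>12. r j * z ^ j)" for z
    unfolding poly_altdef r_def using p(1)
    by (intro sum.mono_neutral_left) (auto simp: coeff_eq_0)
  have per: "?f (z + 1) = ?f z" for z by (simp add: F_def qseries_plus_1)
  have zero: "poly s x = 0" if "\<And>z. z \<in> uhp \<Longrightarrow> poly s z = 0" for s :: "complex poly" and x
  proof -
    have "infinite uhp"
    proof (rule infinite_super)
      show "range (\<lambda>n::nat. of_nat n + \<i>) \<subseteq> uhp" by (auto simp: uhp_def)
      show "infinite (range (\<lambda>n::nat. of_nat n + \<i>))" by (rule range_inj_infinite) (auto simp: inj_def)
    qed
    then have "infinite {z. poly s z = 0}" using that by (metis (mono_tags, lifting) infinite_super mem_Collect_eq subsetI)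
    then have "s = 0" using poly_roots_finite[of s] by blast
    then show ?thesis by simp
  qed
  have S: "(\<Sum>j\<le>12. r j * x ^ j) + (\<Sum>j\<le>12. r j * (- 1) ^ j * x ^ (12 - j)) = 0" for x
  proof -
    let ?s = "(\<Sum>j\<le>12. smult (r j) ([:0, 1:] ^ j)) + (\<Sum>j\<le>12. smult (r j * (- 1) ^ j) ([:0, 1:] ^ (12 - j)))"
    have "poly ?s z = 0" if z: "z \<in> uhp" for z
    proof -
      note nz = uhp_nonzero[OF z]
      have "z ^ 12 * poly p (- 1 / z) = (\<Sum>j\<le>12. r j * (- 1) ^ j * z ^ (12 - j))"
        unfolding pr sum_distrib_left
      proof (rule sum.cong[OF refl])
        fix j :: nat assume "j \<in> {..12}"
        then have "z ^ 12 = z ^ (12 - j) * z ^ j" by (simp flip: power_add)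
        then show "z ^ 12 * (r j * (- 1 / z) ^ j) = r j * (- 1) ^ j * z ^ (12 - j)"
          using nz by (simp add: power_divide flip: power_mult_distrib)
      qed
      moreover have "poly p z + z ^ 12 * poly p (- 1 / z) = 0"
      proof -
        have "poly p (- 1 / z) = ?f (- 1 / z) - ?f z / z ^ 12"
          using p(2)[OF uhp_S[OF z]] nz by (simp add: power_divide)
        then have "z ^ 12 * poly p (- 1 / z) = z ^ 12 * ?f (- 1 / z) - ?f z"
          using nz by (simp add: right_diff_distrib)
        then show ?thesis unfolding p(2)[OF z, symmetric] by simp
      qed
      ultimately show ?thesis by (simp add: poly_sum pr)
    qed
    from zero[OF this, of x] show ?thesis by (simp add: poly_sum)
  qed
  \<comment> \<open>The three-term relation: the periods at \<open>z + 1\<close>, \<open>z\<close>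
    and \<open>z / (z + 1)\<close> combine so that all values of \<open>F 0\<close> cancel, because
    \<open>z / (z + 1)\<close> is \<open>- 1 / (z + 1)\<close> shifted by 1 and \<open>F 0\<close>
    is periodic.\<close>
  have U: "(\<Sum>j\<le>12. r j * ((x + 1) ^ j - x ^ j + x ^ j * (x + 1) ^ (12 - j))) = 0" for x
  proof -
    let ?s = "\<Sum>j\<le>12. smult (r j) ([:1, 1:] ^ j - [:0, 1:] ^ j + [:0, 1:] ^ j * [:1, 1:] ^ (12 - j))"
    have "poly ?s z = 0" if z: "z \<in> uhp" for z
    proof -
      have z1: "z + 1 \<in> uhp" using z by (simp add: uhp_def)
      note nz = uhp_nonzero[OF z] uhp_nonzero[OF z1]
      have e: "z / (z + 1) = - 1 / (z + 1) + 1" using nz by (simp add: field_simps)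
      have z2: "z / (z + 1) \<in> uhp" unfolding e using uhp_S[OF z1] by (rule uhp_shift[rotated]) simp
      have e2: "- 1 / (z / (z + 1)) + 1 = - 1 / z" using nz by (simp add: field_simps)
      have f1: "?f (z / (z + 1)) = ?f (- 1 / (z + 1))" unfolding e by (rule per)
      have f2: "?f (- 1 / (z / (z + 1))) = ?f (- 1 / z)" using per[of "- 1 / (z / (z + 1))"] unfolding e2 by simp
      have "(z + 1) ^ 12 * poly p (z / (z + 1)) = (\<Sum>j\<le>12. r j * (z ^ j * (z + 1) ^ (12 - j)))"
        unfolding pr sum_distrib_left
      proof (rule sum.cong[OF refl])
        fix j :: nat assume "j \<in> {..12}"
        then have "(z + 1) ^ 12 = (z + 1) ^ (12 - j) * (z + 1) ^ j" by (simp flip: power_add)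
        then show "(z + 1) ^ 12 * (r j * (z / (z + 1)) ^ j) = r j * (z ^ j * (z + 1) ^ (12 - j))"
          using nz by (simp add: power_divide)
      qed
      moreover have "poly p (z + 1) - poly p z + (z + 1) ^ 12 * poly p (z / (z + 1)) = 0"
      proof -
        have a1: "poly p (z + 1) = ?f z - (z + 1) ^ 12 * ?f (- 1 / (z + 1))" using p(2)[OF z1] per by simp
        have a2: "poly p z = ?f z - z ^ 12 * ?f (- 1 / z)" using p(2)[OF z] by simp
        have "poly p (z / (z + 1)) = ?f (- 1 / (z + 1)) - (z / (z + 1)) ^ 12 * ?f (- 1 / z)"
          using p(2)[OF z2] unfolding f1 f2 by simp
        then have "(z + 1) ^ 12 * poly p (z / (z + 1)) = (z + 1) ^ 12 * ?f (- 1 / (z + 1)) - z ^ 12 * ?f (- 1 / z)"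
          using nz by (simp add: right_diff_distrib power_divide)
        with a1 a2 show ?thesis by simp
      qed
      ultimately show ?thesis
        by (simp add: poly_sum pr ring_distribs sum.distrib sum_subtractf add.commute[of 1])
    qed
    from zero[OF this, of x] show ?thesis by (simp add: poly_sum add.commute[of 1])
  qed
  have rr: "r 12 = - r 0" "\<And>j. j \<in> {1..11} \<Longrightarrow> r j = 0" using period_polynomial[of r] S U by blast+
  have pz: "poly p z = r 0 * (1 - z ^ 12)" for z
  proof -
    have "(\<Sum>j\<le>12. r j * z ^ j) = (\<Sum>j\<in>{0,12}. r j * z ^ j)"
      by (rule sum.mono_neutral_right) (use rr in auto)
    then show ?thesis using rr(1) by (simp add: pr algebra_simps)
  qed
  \<comment> \<open>Subtracting the constant \<open>r 0\<close> from \<open>F 0\<close> removes its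
    period \<open>r 0 * (1 - z ^ 12)\<close> and leaves a form of weight -12.\<close>
  define c where "c n = (if n = 0 then - r 0 else b 13 n)" for n
  have csplit: "c n * w ^ n = b 13 n * w ^ n + (if n = 0 then - r 0 else 0)" for n w
    by (auto simp: c_def b0)
  have csm: "summable (\<lambda>n. c n * w ^ n)" if "norm w < 1" for w :: complex
    unfolding csplit by (intro summable_add bsm[OF that] summable_single)
  have cq: "qseries c z = ?f z - r 0" if "z \<in> uhp" for z
  proof -
    have "(\<lambda>n. b 13 n * qexp z ^ n) sums ?f z"
      using bsm[OF norm_qexp_less_1[OF that]] by (auto simp: F_def qseries_def intro: summable_sums)
    from sums_add[OF this sums_single[of 0 "\<lambda>_. - r 0"]]
    have "(\<lambda>n. c n * qexp z ^ n) sums (?f z + - r 0)"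
      unfolding csplit by (simp add: eq_commute[of 0])
    then show ?thesis by (simp add: qseries_def sums_iff)
  qed
  have cz: "c n = 0" for n
  proof (rule negative_weight_vanishes[OF csm])
    fix z assume z: "z \<in> uhp"
    show "qseries c z = z ^ 12 * qseries c (- 1 / z)"
      using p(2)[OF z] pz[of z] unfolding cq[OF z] cq[OF uhp_S[OF z]] by (simp add: algebra_simps)
  qed auto
  have "b 13 n = 0" using b0 cz[of n] by (cases "n = 0") (auto simp: c_def)
  then show ?thesis using a0 by (cases "n = 0") (auto simp: b_def)
qed

section \<open>Even parts of q-series and two traces from level 2\<close>

lemma powser_even_part:
  fixes b :: "nat \<Rightarrow> complex"
  assumes sm: "\<And>w. norm w < 1 \<Longrightarrow> summable (\<lambda>n. b n * w ^ n)" and w: "norm w < 1"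
  shows "(\<lambda>n. 2 * b (2 * n) * (w ^ 2) ^ n) sums ((\<Sum>n. b n * w ^ n) + (\<Sum>n. b n * (- w) ^ n))"
proof -
  let ?f = "\<lambda>m. b m * w ^ m + b m * (- w) ^ m"
  have "?f sums ((\<Sum>n. b n * w ^ n) + (\<Sum>n. b n * (- w) ^ n))"
    using sm[OF w] sm[of "- w"] w by (intro sums_add summable_sums) auto
  then have "(\<lambda>n. ?f (2 * n)) sums ((\<Sum>n. b n * w ^ n) + (\<Sum>n. b n * (- w) ^ n))"
  proof (subst sums_mono_reindex)
    fix n assume "n \<notin> range (\<lambda>n::nat. 2 * n)"
    then have "odd n" by (auto elim!: evenE)
    then show "b n * w ^ n + b n * (- w) ^ n = 0" by simp
  qed (auto simp: strict_mono_def)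
  moreover have "?f (2 * n) = 2 * b (2 * n) * (w ^ 2) ^ n" for n
    by (simp add: power_mult)
  ultimately show ?thesis by (simp only:)
qed

lemma summable_even_part:
  fixes b :: "nat \<Rightarrow> complex"
  assumes sm: "\<And>w. norm w < 1 \<Longrightarrow> summable (\<lambda>n. b n * w ^ n)" and w: "norm w < 1"
  shows "summable (\<lambda>n. 2 * b (2 * n) * w ^ n)"
proof -
  have "norm (csqrt w) < 1" using w by (metis norm_power power2_csqrt norm_ge_zero power_one real_sqrt_lt_1_iff real_sqrt_abs abs_norm_cancel)
  from powser_even_part[OF sm this] show ?thesis by (simp add: sums_iff)
qed

lemma qexp_half: "qexp (z / 2) ^ 2 = qexp z" "qexp ((z + 1) / 2) = - qexp (z / 2)"
proof -
  show "qexp (z / 2) ^ 2 = qexp z"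
    by (simp add: qexp_def power2_eq_square mult_ac flip: exp_add)
  have "2 * of_real pi * \<i> * ((z + 1) / 2) = 2 * of_real pi * \<i> * (z / 2) + of_real pi * \<i>"
    by (simp add: field_simps)
  then show "qexp ((z + 1) / 2) = - qexp (z / 2)"
    unfolding qexp_def by (simp add: exp_add mult.commute[of _ \<i>])
qed

lemma uhp_half: "z \<in> uhp \<Longrightarrow> z / 2 \<in> uhp" "z \<in> uhp \<Longrightarrow> (z + 1) / 2 \<in> uhp" "z \<in> uhp \<Longrightarrow> 2 * z \<in> uhp"
  by (simp_all add: uhp_def)

lemma qseries_halves:
  assumes sm: "\<And>w. norm w < 1 \<Longrightarrow> summable (\<lambda>n. b n * w ^ n)" and z: "z \<in> uhp"
  shows "qseries b (z / 2) + qseries b ((z + 1) / 2) = qseries (\<lambda>n. 2 * b (2 * n)) z"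
  using powser_even_part[OF sm norm_qexp_less_1[OF uhp_half(1)[OF z]]]
  unfolding qseries_def qexp_half by (simp add: sums_iff)

lemma qseries_add:
  assumes "\<And>w. norm w < 1 \<Longrightarrow> summable (\<lambda>n. a n * w ^ n)" "\<And>w. norm w < 1 \<Longrightarrow> summable (\<lambda>n. b n * w ^ n)" "z \<in> uhp"
  shows "qseries (\<lambda>n. a n + b n) z = qseries a z + qseries b z"
  unfolding qseries_def distrib_right
  by (rule suminf_add[symmetric]) (use assms norm_qexp_less_1 in auto)

context
  fixes b g :: "nat \<Rightarrow> complex"
  assumes smb: "\<And>w::complex. norm w < 1 \<Longrightarrow> summable (\<lambda>n. b n * w ^ n)"
    and smg: "\<And>w::complex. norm w < 1 \<Longrightarrow> summable (\<lambda>n. g n * w ^ n)"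
    and b0: "b 0 = 0" and g0: "g 0 = 0"
    and f_law: "\<And>z. z \<in> uhp \<Longrightarrow> qseries b ((- 1 / z) / 2) = z ^ 14 * qseries b (z / 2)"
    and g_law: "\<And>z. z \<in> uhp \<Longrightarrow> qseries g (- 1 / z) = z ^ 14 * qseries b ((z + 1) / 2)"
begin

text \<open>\<open>b\<close> is indexed by the norm and \<open>g\<close> by half the norm, so the
  theta series of the lattice is \<open>qseries b (z / 2)\<close>. Translating \<open>z\<close> by 1
  there multiplies the coefficient at \<open>n\<close> by \<open>(- 1) ^ n\<close>, which is the
  twist by the character.\<close>

abbreviation (input) "f1 z \<equiv> qseries b ((z + 1) / 2)"

lemma f1_law: "z \<in> uhp \<Longrightarrow> f1 (- 1 / z) = z ^ 14 * qseries g z"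
proof -
  assume z: "z \<in> uhp"
  note nz = uhp_nonzero[OF z]
  have e: "- 1 / (- 1 / z) = z" by simp
  have "qseries g z = (- 1 / z) ^ 14 * f1 (- 1 / z)"
    using g_law[OF uhp_S[OF z]] unfolding e .
  then show ?thesis using nz by (simp add: power_divide)
qed

lemma f1_plus_2: "f1 (z + 2) = f1 z"
proof -
  have "(z + 2 + 1) / 2 = (z + 1) / 2 + 1" by (simp add: field_simps)
  then show ?thesis by (simp only: qseries_plus_1)
qed

text \<open>Translation by 1 exchanges the plain and the twisted series and fixes
  \<open>qseries g\<close>; inversion fixes the plain one and exchanges the other two, so the sum of
  all three has level one. Plain and twisted series together double the even coefficients of
  \<open>b\<close> and cancel the odd ones.\<close>

lemma shadow_coeff: "g n = - 2 * b (2 * n)"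
proof -
  let ?a = "\<lambda>n. 2 * b (2 * n) + g n"
  have sm: "\<And>w. norm w < 1 \<Longrightarrow> summable (\<lambda>n. 2 * b (2 * n) * w ^ n)"
    by (rule summable_even_part[OF smb])
  have h: "qseries ?a z = (qseries b (z / 2) + f1 z) + qseries g z" if "z \<in> uhp" for z
    using qseries_add[OF sm smg that] qseries_halves[OF smb that] by simp
  have "?a n = 0"
  proof (rule cusp_form_weight_14_vanishes)
    show "summable (\<lambda>n. ?a n * w ^ n)" if "norm w < 1" for w :: complex
      unfolding distrib_right by (intro summable_add sm smg that)
    show "?a 0 = 0" using b0 g0 by simp
    fix z assume z: "z \<in> uhp"
    show "qseries ?a (- 1 / z) = z ^ 14 * qseries ?a z"
      unfolding h[OF z] h[OF uhp_S[OF z]] f_law[OF z] f1_law[OF z] g_law[OF z] by (simp add: algebra_simps)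
  qed
  then show ?thesis by (simp add: eq_neg_iff_add_eq_0 add.commute)
qed

text \<open>The matrix with rows (1, -1) and (2, -1) generates the level 2 group together with
  translation and sign. It is the translation by -1, an inversion, the translation by -2 and another
  inversion, and the effect of each is known on \<open>g\<close> or \<open>f1\<close>.\<close>

lemma gamma0_2_law:
  assumes u: "u \<in> uhp"
  shows "qseries g ((u - 1) / (2 * u - 1)) = (2 * u - 1) ^ 14 * qseries g u"
proof -
  have u1: "u - 1 \<in> uhp" and u2: "2 * u - 1 \<in> uhp" using u by (auto simp: uhp_def)
  note nz = uhp_nonzero[OF u1] uhp_nonzero[OF u2]
  define v where "v = - (2 * u - 1) / (u - 1)"
  have v: "v = - 1 / (u - 1) - 2" using nz by (simp add: v_def field_simps)
  have vu: "v \<in> uhp"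
  proof -
    have "- 1 / (u - 1) \<in> uhp" by (rule uhp_S[OF u1])
    then show ?thesis unfolding v by (simp add: uhp_def)
  qed
  have "(u - 1) / (2 * u - 1) = - 1 / v" using nz by (simp add: v_def minus_divide_left[symmetric] minus_divide_right[symmetric] del: minus_diff_eq)
  then have "qseries g ((u - 1) / (2 * u - 1)) = v ^ 14 * f1 v" using g_law[OF vu] by simp
  also have "f1 v = f1 (- 1 / (u - 1))" using f1_plus_2[of v] by (simp add: v)
  also have "\<dots> = (u - 1) ^ 14 * qseries g (u - 1)" by (rule f1_law[OF u1])
  also have "qseries g (u - 1) = qseries g u" using qseries_plus_1[of g "u - 1"] by simp
  finally have "qseries g ((u - 1) / (2 * u - 1)) = (v * (u - 1)) ^ 14 * qseries g u"
    by (simp add: power_mult_distrib)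
  also have "v * (u - 1) = - (2 * u - 1)" using nz by (simp add: v_def)
  also have "(- (2 * u - 1)) ^ 14 = (2 * u - 1) ^ 14" by (rule power_minus_even) simp
  finally show ?thesis .
qed

text \<open>Inversion exchanges \<open>f1 (2 * z)\<close> with
  \<open>qseries g (z / 2) / 2 ^ 14\<close> and preserves \<open>qseries g ((z + 1) / 2)\<close>;
  the latter is \<open>gamma0_2_law\<close> at \<open>u = (z + 1) / 2\<close>, where
  \<open>2 * u - 1 = z\<close>. The two half arguments together double the even coefficients of
  \<open>g\<close>, which turns \<open>2 ^ 14\<close> into \<open>2 ^ 13\<close>.\<close>

lemma hecke_coeff: "(- 1) ^ n * b n = - g (2 * n) / 2 ^ 13"
proof -
  define a where "a n = (- 1) ^ n * b n + 2 * g (2 * n) / 2 ^ 14" for n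
  have sg: "\<And>w. norm w < 1 \<Longrightarrow> summable (\<lambda>n. 2 * g (2 * n) * w ^ n)"
    by (rule summable_even_part[OF smg])
  then have sm2: "\<And>w. norm w < 1 \<Longrightarrow> summable (\<lambda>n. 2 * g (2 * n) / 2 ^ 14 * w ^ n)"
    using summable_divide[of "\<lambda>n. 2 * g (2 * n) * w ^ n" "2 ^ 14" for w] by (simp add: mult_ac)
  have sm1: "\<And>w. norm w < 1 \<Longrightarrow> summable (\<lambda>n. (- 1) ^ n * b n * w ^ n)"
  proof -
    fix w :: complex assume "norm w < 1"
    then have "summable (\<lambda>n. b n * (- w) ^ n)" by (intro smb) simp
    then show "summable (\<lambda>n. (- 1) ^ n * b n * w ^ n)" by (simp add: power_minus[of w] mult_ac)
  qed
  have h: "qseries a z = f1 (2 * z) + (qseries g (z / 2) + qseries g ((z + 1) / 2)) / 2 ^ 14" if z: "z \<in> uhp" for z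
  proof -
    have "qseries a z = qseries (\<lambda>n. (- 1) ^ n * b n) z + qseries (\<lambda>n. 2 * g (2 * n) / 2 ^ 14) z"
      unfolding a_def by (rule qseries_add[OF sm1 sm2 z])
    moreover have "qseries (\<lambda>n. 2 * g (2 * n) / 2 ^ 14) z = qseries (\<lambda>n. 2 * g (2 * n)) z / 2 ^ 14"
      unfolding qseries_def using suminf_divide[OF sg[OF norm_qexp_less_1[OF z]], of "2 ^ 14"] by (simp add: mult_ac)
    moreover have "qseries (\<lambda>n. (- 1) ^ n * b n) z = f1 (2 * z)"
    proof -
      have "qexp ((2 * z + 1) / 2) = - qexp z" using qexp_half(2)[of "2 * z"] by simp
      then show ?thesis unfolding qseries_def by (simp add: power_minus[of "qexp z"] mult_ac)
    qed
    ultimately show ?thesis using qseries_halves[OF smg z] by simp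
  qed
  have "a n = 0"
  proof (rule cusp_form_weight_14_vanishes)
    show "summable (\<lambda>n. a n * w ^ n)" if "norm w < 1" for w :: complex
      unfolding a_def distrib_right by (intro summable_add sm1 sm2 that)
    show "a 0 = 0" using b0 g0 by (simp add: a_def)
    fix z assume z: "z \<in> uhp"
    note nz = uhp_nonzero[OF z]
    have 1: "f1 (2 * (- 1 / z)) = z ^ 14 * (qseries g (z / 2) / 2 ^ 14)"
    proof -
      have "2 * (- 1 / z) = - 1 / (z / 2)" by simp
      then have "f1 (2 * (- 1 / z)) = (z / 2) ^ 14 * qseries g (z / 2)" using f1_law[OF uhp_half(1)[OF z]] by simp
      then show ?thesis by (simp add: power_divide)
    qed
    have 2: "qseries g ((- 1 / z) / 2) = (2 * z) ^ 14 * f1 (2 * z)"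
    proof -
      have "(- 1 / z) / 2 = - 1 / (2 * z)" by (simp add: mult.commute)
      then show ?thesis using g_law[OF uhp_half(3)[OF z]] by (simp only:)
    qed
    have 3: "qseries g ((- 1 / z + 1) / 2) = z ^ 14 * qseries g ((z + 1) / 2)"
    proof -
      have "(- 1 / z + 1) / 2 = ((z + 1) / 2 - 1) / (2 * ((z + 1) / 2) - 1)"
        using nz by (simp add: field_simps)
      moreover have "2 * ((z + 1) / 2) - 1 = z" by (simp add: add_divide_distrib)
      ultimately show ?thesis using gamma0_2_law[OF uhp_half(2)[OF z]] by (simp only:)
    qed
    show "qseries a (- 1 / z) = z ^ 14 * qseries a z"
      unfolding h[OF z] h[OF uhp_S[OF z]] 1 2 3 by (simp add: power_mult_distrib field_simps)
  qed
  then show ?thesis by (simp add: a_def eq_neg_iff_add_eq_0 add_divide_distrib)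
qed

lemma coeffs_vanish:
  assumes "g 1 = 0"
  shows "g (4 ^ a) = 0 \<and> b (2 * 4 ^ a) = 0"
proof -
  \<comment> \<open>The even index \<open>2 * k\<close> removes the sign; eliminating
    \<open>b (2 * k)\<close> from the two relations leaves the factor
    \<open>2 ^ 13 / 2\<close>.\<close>
  have r: "g (4 * k) = 2 ^ 12 * g k" for k
    using hecke_coeff[of "2 * k"] shadow_coeff[of k] by (simp add: mult.commute)
  have "g (4 ^ a) = 0" by (induction a) (use assms r in auto)
  then show ?thesis using shadow_coeff[of "4 ^ a"] by simp
qed

end

section \<open>Lagrange's four-square theorem\<close>

text \<open>Sums of four squares will supply integer vectors of prescribed even norm in
  \<open>W8\<close>, hence points on the shells of part (ii).\<close>

definition four_squares :: "int set" where
  "four_squares = {n. \<exists>a b c d. n = a\<^sup>2 + b\<^sup>2 + c\<^sup>2 + d\<^sup>2}"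

lemma four_squaresI: "n = a\<^sup>2 + b\<^sup>2 + c\<^sup>2 + d\<^sup>2 \<Longrightarrow> n \<in> four_squares"
  by (auto simp: four_squares_def)

text \<open>Multiplicativity of the quaternion norm.\<close>

lemma euler_four_square:
  fixes a b c d e f g h :: int
  shows "(a\<^sup>2 + b\<^sup>2 + c\<^sup>2 + d\<^sup>2) * (e\<^sup>2 + f\<^sup>2 + g\<^sup>2 + h\<^sup>2) =
    (a * e + b * f + c * g + d * h)\<^sup>2 + (a * f - b * e + c * h - d * g)\<^sup>2 +
    (a * g - b * h - c * e + d * f)\<^sup>2 + (a * h + b * g - c * f - d * e)\<^sup>2"
  by (simp add: power2_eq_square algebra_simps)

lemma four_squares_mult: "m \<in> four_squares \<Longrightarrow> n \<in> four_squares \<Longrightarrow> m * n \<in> four_squares"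
  unfolding four_squares_def using euler_four_square by (auto, metis)

text \<open>Four integers with even sum split into two pairs of equal parity; the half-sums and
  half-differences of the pairs are integers whose squares add up to half the total.\<close>

lemma four_squares_half:
  assumes "2 * k \<in> four_squares"
  shows "k \<in> four_squares"
proof -
  have pair: "k \<in> four_squares" if eq: "2 * k = a\<^sup>2 + b\<^sup>2 + c\<^sup>2 + d\<^sup>2" and "even (a + b)" "even (c + d)" for a b c d :: int
  proof -
    have "even (a - b)" "even (c - d)" using that by auto
    with that obtain p q r s where *: "a + b = 2 * p" "c + d = 2 * r" "a - b = 2 * q" "c - d = 2 * s"
      unfolding dvd_def by blast
    have "4 * k = (a + b)\<^sup>2 + (a - b)\<^sup>2 + (c + d)\<^sup>2 + (c - d)\<^sup>2"
      using eq by (simp add: power2_eq_square algebra_simps)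
    then have "k = p\<^sup>2 + q\<^sup>2 + r\<^sup>2 + s\<^sup>2" unfolding * by (simp add: power_mult_distrib)
    then show ?thesis by (rule four_squaresI)
  qed
  obtain a b c d where eq: "2 * k = a\<^sup>2 + b\<^sup>2 + c\<^sup>2 + d\<^sup>2" using assms by (auto simp: four_squares_def)
  have "even (a\<^sup>2 + b\<^sup>2 + c\<^sup>2 + d\<^sup>2)" unfolding eq[symmetric] by simp
  then have "even (a + b + c + d)" by simp
  then consider "even (a + b)" "even (c + d)" | "even (a + c)" "even (b + d)" | "even (a + d)" "even (b + c)"
    by fastforce
  then show ?thesis
  proof cases
    case 1 then show ?thesis using pair[OF eq] by blast
  next
    case 2 then show ?thesis using pair[of a c b d] eq by (simp add: add_ac)
  next
    case 3 then show ?thesis using pair[of a d b c] eq by (simp add: add_ac)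
  qed
qed

text \<open>Oddness makes the bound strict, and strictness is what makes the multiplier drop in the
  descent.\<close>

lemma symmetric_residue:
  fixes x m :: int
  assumes "m > 0" "odd m"
  obtains z where "2 * \<bar>x - m * z\<bar> < m"
proof -
  obtain t where t: "m = 2 * t + 1" using assms(2) by (rule oddE)
  define z where "z = (x + t) div m"
  have "x + t = m * z + (x + t) mod m" by (simp add: z_def)
  moreover have "0 \<le> (x + t) mod m" "(x + t) mod m < m" using assms by auto
  ultimately have "- t \<le> x - m * z \<and> x - m * z \<le> t" using t by linarith
  moreover have "2 * \<bar>w\<bar> < m" if "- t \<le> w \<and> w \<le> t" for w using that t by linarith
  ultimately have "2 * \<bar>x - m * z\<bar> < m" by blast
  then show ?thesis by (rule that)
qed

text \<open>Descent on the multiplier. An even one is halved. For an odd one the four numbers are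
  replaced by their least residues, whose squares sum to \<open>M * r\<close> with
  \<open>r < M\<close>; in Euler's product identity all four entries are then divisible by
  \<open>M\<close>, and dividing by \<open>M\<^sup>2\<close> represents
  \<open>r * p\<close>.\<close>

lemma four_squares_descent:
  fixes p :: int
  assumes p: "prime p"
  shows "0 < m \<Longrightarrow> int m < p \<Longrightarrow> int m * p \<in> four_squares \<Longrightarrow> p \<in> four_squares"
proof (induction m rule: less_induct)
  case (less m)
  show ?case
  proof (cases "m = 1 \<or> even m")
    case True
    then consider "m = 1" | "even m" by blast
    then show ?thesis
    proof cases
      case 1 then show ?thesis using less.prems by simp
    next
      case 2
      then obtain k where k: "m = 2 * k" by (rule evenE)
      have "2 * (int k * p) \<in> four_squares" using less.prems(3) by (simp add: k mult.assoc)
      then have "int k * p \<in> four_squares" by (rule four_squares_half)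
      then show ?thesis using less.IH[of k] less.prems k by auto
    qed
  next
    case False
    define M where "M = int m"
    have M: "M > 1" "odd M" "M < p" using False less.prems by (auto simp: M_def)
    obtain a b c d where eq: "M * p = a\<^sup>2 + b\<^sup>2 + c\<^sup>2 + d\<^sup>2"
      using less.prems(3) by (auto simp: four_squares_def M_def)
    obtain za zb zc zd where z: "2 * \<bar>a - M * za\<bar> < M" "2 * \<bar>b - M * zb\<bar> < M" "2 * \<bar>c - M * zc\<bar> < M" "2 * \<bar>d - M * zd\<bar> < M"
    proof -
      have "\<exists>z. 2 * \<bar>x - M * z\<bar> < M" for x
        by (rule symmetric_residue[of M x]) (use M in auto)
      then show ?thesis using that by blast
    qed
    define e f g h where "e = a - M * za" and "f = b - M * zb" and "g = c - M * zc" and "h = d - M * zd"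
    define r where "r = p - 2 * (a * za + b * zb + c * zc + d * zd) + M * (za\<^sup>2 + zb\<^sup>2 + zc\<^sup>2 + zd\<^sup>2)"
    have sq: "e\<^sup>2 + f\<^sup>2 + g\<^sup>2 + h\<^sup>2 = M * r"
    proof -
      have "e\<^sup>2 + f\<^sup>2 + g\<^sup>2 + h\<^sup>2 = (a\<^sup>2 + b\<^sup>2 + c\<^sup>2 + d\<^sup>2) - M * (2 * (a * za + b * zb + c * zc + d * zd)) + M * (M * (za\<^sup>2 + zb\<^sup>2 + zc\<^sup>2 + zd\<^sup>2))"
        unfolding e_def f_def g_def h_def by (simp add: power2_eq_square algebra_simps)
      then show ?thesis unfolding eq[symmetric] r_def by (simp add: algebra_simps)
    qed
    have lt: "4 * x\<^sup>2 < M\<^sup>2" if "2 * \<bar>x\<bar> < M" for x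
    proof -
      have "(2 * \<bar>x\<bar>)\<^sup>2 < M\<^sup>2" using that by (intro power_strict_mono) auto
      then show ?thesis by (simp add: power_mult_distrib)
    qed
    have "4 * (M * r) < 4 * M\<^sup>2"
    proof -
      have "4 * e\<^sup>2 + 4 * f\<^sup>2 + 4 * g\<^sup>2 + 4 * h\<^sup>2 < M\<^sup>2 + M\<^sup>2 + M\<^sup>2 + M\<^sup>2"
        by (intro add_strict_mono lt z[folded e_def f_def g_def h_def])
      then show ?thesis unfolding sq[symmetric] by simp
    qed
    then have "r < M" using M by (simp add: power2_eq_square)
    have "M * r \<ge> 0" unfolding sq[symmetric] by simp
    then have "r \<ge> 0" using M by (simp add: zero_le_mult_iff)
    \<comment> \<open>If all residues vanished, \<open>M\<^sup>2\<close> would divide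
      \<open>M * p\<close>, although \<open>M\<close> lies strictly between 1 and the prime
      \<open>p\<close>.\<close>
    have "r \<noteq> 0"
    proof
      assume "r = 0"
      then have "e\<^sup>2 + f\<^sup>2 + g\<^sup>2 + h\<^sup>2 = 0" using sq by simp
      moreover have "e\<^sup>2 \<ge> 0" "f\<^sup>2 \<ge> 0" "g\<^sup>2 \<ge> 0" "h\<^sup>2 \<ge> 0" by simp_all
      ultimately have "e\<^sup>2 = 0" "f\<^sup>2 = 0" "g\<^sup>2 = 0" "h\<^sup>2 = 0" by linarith+
      then have "e = 0" "f = 0" "g = 0" "h = 0" by simp_all
      then have "M * p = M * (M * (za\<^sup>2 + zb\<^sup>2 + zc\<^sup>2 + zd\<^sup>2))"
        unfolding eq e_def f_def g_def h_def by (simp add: power_mult_distrib power2_eq_square algebra_simps)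
      then have "M dvd p" using M by auto
      then have "M = 1 \<or> M = p" using p M(1) unfolding prime_int_iff by (meson less_imp_le order_less_trans zero_less_one)
      then show False using M by simp
    qed
    \<comment> \<open>\<open>v1\<close> to \<open>v4\<close> are the entries of Euler's identity
      divided by \<open>M\<close>; in the first one the sum of squares has been replaced by
      \<open>M * p\<close>.\<close>
    define v1 where "v1 = p - (a * za + b * zb + c * zc + d * zd)"
    define v2 where "v2 = - a * zb + b * za - c * zd + d * zc"
    define v3 where "v3 = - a * zc + b * zd + c * za - d * zb"
    define v4 where "v4 = - a * zd - b * zc + c * zb + d * za"
    have w1: "a * e + b * f + c * g + d * h = M * v1"
    proof -
      have "a * e + b * f + c * g + d * h = (a\<^sup>2 + b\<^sup>2 + c\<^sup>2 + d\<^sup>2) - M * (a * za + b * zb + c * zc + d * zd)"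
        unfolding e_def f_def g_def h_def by (simp add: power2_eq_square algebra_simps)
      then show ?thesis unfolding eq[symmetric] v1_def by (simp add: algebra_simps)
    qed
    have w2: "a * f - b * e + c * h - d * g = M * v2" and w3: "a * g - b * h - c * e + d * f = M * v3"
      and w4: "a * h + b * g - c * f - d * e = M * v4"
      unfolding e_def f_def g_def h_def v2_def v3_def v4_def by (simp_all add: algebra_simps)
    have "(M * p) * (M * r) = (M * v1)\<^sup>2 + (M * v2)\<^sup>2 + (M * v3)\<^sup>2 + (M * v4)\<^sup>2"
      unfolding eq sq[symmetric] w1[symmetric] w2[symmetric] w3[symmetric] w4[symmetric] by (rule euler_four_square)
    then have "M\<^sup>2 * (r * p) = M\<^sup>2 * (v1\<^sup>2 + v2\<^sup>2 + v3\<^sup>2 + v4\<^sup>2)"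
      by (simp add: power2_eq_square algebra_simps)
    then have "r * p = v1\<^sup>2 + v2\<^sup>2 + v3\<^sup>2 + v4\<^sup>2" using M by simp
    then have "r * p \<in> four_squares" by (rule four_squaresI)
    moreover have "int (nat r) = r" using \<open>r \<ge> 0\<close> by simp
    moreover have "nat r < m" "0 < nat r" using \<open>r < M\<close> \<open>r \<ge> 0\<close> \<open>r \<noteq> 0\<close> by (auto simp: M_def)
    ultimately show ?thesis using less.IH[of "nat r"] \<open>r < M\<close> M by simp
  qed
qed

text \<open>Pigeonhole: on 0, ..., (p - 1)/2 the squares are distinct modulo \<open>p\<close>, and
  so are the values \<open>- y\<^sup>2 - 1\<close>. These are p + 1 residues in all, so the two
  families meet.\<close>

lemma prime_dvd_sum_two_squares_plus_1:
  fixes p :: int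
  assumes p: "prime p" and odd: "odd p"
  obtains x y where "p dvd x\<^sup>2 + y\<^sup>2 + 1" "2 * \<bar>x\<bar> < p" "2 * \<bar>y\<bar> < p"
proof -
  have p0: "p > 0" using p by (rule prime_gt_0_int)
  obtain t where t: "p = 2 * t + 1" using odd by (rule oddE)
  have t0: "t \<ge> 0" using t p0 by linarith
  let ?F = "\<lambda>x. x\<^sup>2 mod p" and ?G = "\<lambda>y. (- y\<^sup>2 - 1) mod p"
  have sq: "x = y" if "x \<in> {0..t}" "y \<in> {0..t}" "p dvd x\<^sup>2 - y\<^sup>2" for x y
  proof -
    have "x\<^sup>2 - y\<^sup>2 = (x - y) * (x + y)" by (simp add: power2_eq_square algebra_simps)
    then have "p dvd x - y \<or> p dvd x + y" using that(3) p by (simp add: prime_dvd_mult_iff)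
    then show ?thesis
    proof
      assume d: "p dvd x - y"
      show ?thesis
      proof (rule ccontr)
        assume "x \<noteq> y"
        then have "p \<le> \<bar>x - y\<bar>" using d p0 by (intro zdvd_imp_le) auto
        then show False using that t by auto
      qed
    next
      assume d: "p dvd x + y"
      show ?thesis
      proof (rule ccontr)
        assume "x \<noteq> y"
        then have "p \<le> x + y" using d that by (intro zdvd_imp_le) auto
        then show False using that t by auto
      qed
    qed
  qed
  have injF: "inj_on ?F {0..t}"
    by (rule inj_onI) (use sq in \<open>auto simp: mod_eq_dvd_iff\<close>)
  have injG: "inj_on ?G {0..t}"
  proof (rule inj_onI)
    fix x y assume "x \<in> {0..t}" "y \<in> {0..t}" "?G x = ?G y"
    then show "x = y" using sq[of y x] by (simp add: mod_eq_dvd_iff)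
  qed
  have "?F ` {0..t} \<inter> ?G ` {0..t} \<noteq> {}"
  proof
    assume e: "?F ` {0..t} \<inter> ?G ` {0..t} = {}"
    have "card (?F ` {0..t} \<union> ?G ` {0..t}) = card {0..t} + card {0..t}"
      using e injF injG by (simp add: card_Un_disjoint card_image)
    moreover have "?F ` {0..t} \<union> ?G ` {0..t} \<subseteq> {0..<p}" using p0 by auto
    then have "card (?F ` {0..t} \<union> ?G ` {0..t}) \<le> card {0..<p}" by (intro card_mono) auto
    ultimately show False using t t0 by simp
  qed
  then obtain x y where xy: "x \<in> {0..t}" "y \<in> {0..t}" "?F x = ?G y" by (auto simp only: disjoint_iff image_iff)
  then have "p dvd x\<^sup>2 - (- y\<^sup>2 - 1)" by (simp only: mod_eq_dvd_iff)
  then have "p dvd x\<^sup>2 + y\<^sup>2 + 1" by (simp add: algebra_simps)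
  moreover have "2 * \<bar>x\<bar> < p" "2 * \<bar>y\<bar> < p" using xy t by auto
  ultimately show ?thesis by (rule that)
qed

lemma four_squares_prime:
  fixes p :: int
  assumes p: "prime p"
  shows "p \<in> four_squares"
proof (cases "p = 2")
  case True
  then show ?thesis by (intro four_squaresI[of _ 1 1 0 0]) simp
next
  case False
  then have odd: "odd p" using p unfolding prime_int_iff by (metis zero_le_numeral numeral_eq_one_iff semiring_norm(85))
  have p2: "p > 2" using p False prime_ge_2_int[OF p] by linarith
  obtain x y where xy: "p dvd x\<^sup>2 + y\<^sup>2 + 1" "2 * \<bar>x\<bar> < p" "2 * \<bar>y\<bar> < p"
    using prime_dvd_sum_two_squares_plus_1[OF p odd] .
  then obtain k where k: "x\<^sup>2 + y\<^sup>2 + 1 = p * k" by (auto elim!: dvdE)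
  have lt: "4 * x\<^sup>2 < p\<^sup>2" if "2 * \<bar>x\<bar> < p" for x
  proof -
    have "(2 * \<bar>x\<bar>)\<^sup>2 < p\<^sup>2" using that by (intro power_strict_mono) auto
    then show ?thesis by (simp add: power_mult_distrib)
  qed
  have "p\<^sup>2 > 2 * 2" unfolding power2_eq_square using p2 by (intro mult_strict_mono) auto
  then have "x\<^sup>2 + y\<^sup>2 + 1 < p\<^sup>2" using lt[OF xy(2)] lt[OF xy(3)] by linarith
  then have "p * k < p * p" unfolding k by (simp only: power2_eq_square)
  then have "k < p" using p2 by simp
  have "p * k > 0" unfolding k[symmetric] using zero_le_power2[of x] zero_le_power2[of y] by linarith
  then have "k > 0" using p2 by (simp add: zero_less_mult_iff)
  have "k * p \<in> four_squares"
    by (rule four_squaresI[of _ x y 1 0]) (use k in \<open>simp add: mult.commute\<close>)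
  then show ?thesis using four_squares_descent[OF p, of "nat k"] \<open>k < p\<close> \<open>k > 0\<close> by simp
qed

theorem lagrange_four_squares: "int n \<in> four_squares"
proof (induction n rule: less_induct)
  case (less n)
  show ?case
  proof (cases "n < 2")
    case True
    then have "n = 0 \<or> n = 1" by auto
    then show ?thesis by (auto intro: four_squaresI[of _ 0 0 0 0] four_squaresI[of _ 1 0 0 0])
  next
    case False
    then obtain p where p: "prime p" "p dvd n" using prime_factor_nat[of n] by auto
    then obtain k where k: "n = p * k" by (auto elim!: dvdE)
    have "k < n" using k False prime_gt_1_nat[OF p(1)] by (cases "k = 0") auto
    then have "int k \<in> four_squares" by (rule less.IH)
    moreover have "int p \<in> four_squares" using p by (intro four_squares_prime) simp
    ultimately show ?thesis unfolding k using four_squares_mult by simp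
  qed
qed

section \<open>Designs and coordinate symmetries\<close>

text \<open>The sum of a quadratic form over \<open>X\<close> pairs its coefficient matrix with the
  matrix of second moments; a scalar moment matrix sees only the trace, which is zero.\<close>

lemma spherical_3_designI:
  fixes X :: "'a::euclidean_space set"
  assumes "finite X" "X \<noteq> {}" "\<And>x. x \<in> X \<Longrightarrow> norm x = r" "\<And>x. x \<in> X \<Longrightarrow> - x \<in> X"
    and off: "\<And>i j. i \<in> Basis \<Longrightarrow> j \<in> Basis \<Longrightarrow> i \<noteq> j \<Longrightarrow> (\<Sum>x\<in>X. inner x i * inner x j) = 0"
    and diag: "\<And>i. i \<in> Basis \<Longrightarrow> (\<Sum>x\<in>X. inner x i * inner x i) = s"
  shows "spherical_3_design X"
  unfolding spherical_3_design_def
proof (intro conjI allI impI)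
  fix c :: "'a \<Rightarrow> 'a \<Rightarrow> real"
  assume c: "(\<Sum>i\<in>Basis. c i i) = 0"
  have "(\<Sum>x\<in>X. \<Sum>i\<in>Basis. \<Sum>j\<in>Basis. c i j * inner x i * inner x j) =
        (\<Sum>i\<in>Basis. \<Sum>j\<in>Basis. c i j * (\<Sum>x\<in>X. inner x i * inner x j))"
    by (subst sum.swap, rule sum.cong[OF refl], subst sum.swap) (simp add: sum_distrib_left mult.assoc)
  also have "\<dots> = (\<Sum>i\<in>Basis. \<Sum>j\<in>Basis. if j = i then c i i * s else 0)"
    by (intro sum.cong refl) (use off diag in auto)
  also have "\<dots> = (\<Sum>i\<in>Basis. c i i * s)" by (rule sum.cong) auto
  also have "\<dots> = 0" using c by (simp flip: sum_distrib_right)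
  finally show "(\<Sum>x\<in>X. \<Sum>i\<in>Basis. \<Sum>j\<in>Basis. c i j * inner x i * inner x j) = 0" .
qed (use assms in auto)

lemma sum_involution_neg_0:
  fixes f :: "'a \<Rightarrow> real"
  assumes "\<And>x. x \<in> X \<Longrightarrow> g x \<in> X" "\<And>x. x \<in> X \<Longrightarrow> g (g x) = x" "\<And>x. x \<in> X \<Longrightarrow> f (g x) = - f x"
  shows "sum f X = 0"
proof -
  have "sum f X = (\<Sum>x\<in>X. f (g x))"
    by (rule sum.reindex_bij_witness[of _ g g]) (use assms in auto)
  also have "\<dots> = - sum f X" using assms(3) by (simp add: sum_negf)
  finally show ?thesis by simp
qed

section \<open>Sign changes and exchanges of coordinates on Z^3 and W_8\<close>

definition sign_flip :: "'n set \<Rightarrow> real^'n \<Rightarrow> real^'n" where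
  "sign_flip S x = (\<chi> i. if i \<in> S then - x $ i else x $ i)"

lemma sign_flip_nth [simp]: "sign_flip S x $ i = (if i \<in> S then - x $ i else x $ i)"
  by (simp add: sign_flip_def)

lemma sign_flip_twice [simp]: "sign_flip S (sign_flip S x) = x"
  by (simp add: vec_eq_iff)

lemma inner_sign_flip: "inner (sign_flip S x) (sign_flip S x) = inner x x"
  by (simp add: inner_vec_def if_distrib) (rule sum.cong, auto)

definition swap_coords :: "'n \<Rightarrow> 'n \<Rightarrow> real^'n \<Rightarrow> real^'n" where
  "swap_coords i j x = (\<chi> k. x $ Transposition.transpose i j k)"

lemma swap_coords_nth [simp]: "swap_coords i j x $ k = x $ Transposition.transpose i j k"
  by (simp add: swap_coords_def)

lemma swap_coords_twice [simp]: "swap_coords i j (swap_coords i j x) = x"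
  by (simp add: vec_eq_iff)

lemma sum_swap_coords: "(\<Sum>k\<in>UNIV. f (x $ Transposition.transpose i j k)) = (\<Sum>k\<in>UNIV. f (x $ k))" for x :: "real^'n" and f :: "real \<Rightarrow> real"
  by (rule sum.reindex_bij_witness[of _ "Transposition.transpose i j" "Transposition.transpose i j"]) auto

lemma inner_swap_coords: "inner (swap_coords i j x) (swap_coords i j x) = inner x x"
  using sum_swap_coords[of "\<lambda>y. y * y" x i j] by (simp add: inner_vec_def)

lemma Zn_sign_flip: "x \<in> Zn_lattice \<Longrightarrow> sign_flip S x \<in> Zn_lattice"
  by (auto simp: Zn_lattice_def)

lemma Zn_swap: "x \<in> Zn_lattice \<Longrightarrow> swap_coords i j x \<in> Zn_lattice"
  by (auto simp: Zn_lattice_def)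

lemma W8_diff: "x \<in> W8 \<Longrightarrow> x $ i - x $ j \<in> \<int>"
proof -
  assume "x \<in> W8"
  then have "x $ i - x $ 1 \<in> \<int>" "x $ j - x $ 1 \<in> \<int>" by (auto simp: W8_def)
  then have "(x $ i - x $ 1) - (x $ j - x $ 1) \<in> \<int>" by (rule Ints_diff)
  then show ?thesis by simp
qed

lemma W8_sum: "x \<in> W8 \<Longrightarrow> x $ i + x $ j \<in> \<int>"
proof -
  assume x: "x \<in> W8"
  then have "2 * x $ j \<in> \<int>" by (auto simp: W8_def)
  then have "(x $ i - x $ j) + 2 * x $ j \<in> \<int>" using W8_diff[OF x] by (intro Ints_add)
  then show ?thesis by (simp add: add.commute)
qed

lemma W8_swap: "x \<in> W8 \<Longrightarrow> swap_coords i j x \<in> W8"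
  using sum_swap_coords[of "\<lambda>y. y" x i j] W8_diff[of x] by (auto simp: W8_def)

text \<open>A single sign change subtracts \<open>x $ i\<close> from half the coordinate sum, and
  this can be a half-integer; a pair of changes subtracts the integer
  \<open>x $ i + x $ j\<close>.\<close>

lemma W8_sign_flip:
  assumes x: "x \<in> W8" and ij: "i \<noteq> j"
  shows "sign_flip {i, j} x \<in> W8"
proof -
  let ?y = "sign_flip {i, j} x"
  have "2 * ?y $ k \<in> \<int>" for k using x by (auto simp: W8_def)
  moreover have "?y $ k - ?y $ 1 \<in> \<int>" for k
  proof -
    have "- x $ k - x $ 1 = - (x $ k + x $ 1)" "x $ k - - x $ 1 = x $ k + x $ 1" "- x $ k - - x $ 1 = x $ 1 - x $ k" by simp_all
    moreover have "- (x $ k + x $ 1) \<in> \<int>" using W8_sum[OF x] by (rule Ints_minus)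
    ultimately show ?thesis using W8_sum[OF x, of k 1] W8_diff[OF x, of k 1] W8_diff[OF x, of 1 k] by auto
  qed
  moreover have "(\<Sum>k\<in>UNIV. ?y $ k) / 2 \<in> \<int>"
  proof -
    have "?y $ k = x $ k - (if k = i then 2 * x $ i else 0) - (if k = j then 2 * x $ j else 0)" for k
      using ij by auto
    then have "(\<Sum>k\<in>UNIV. ?y $ k) = (\<Sum>k\<in>UNIV. x $ k - (if k = i then 2 * x $ i else 0) - (if k = j then 2 * x $ j else 0))"
      by presburger
    also have "\<dots> = (\<Sum>k\<in>UNIV. x $ k) - 2 * x $ i - 2 * x $ j" by (simp add: sum_subtractf)
    finally have "(\<Sum>k\<in>UNIV. ?y $ k) / 2 = (\<Sum>k\<in>UNIV. x $ k) / 2 - (x $ i + x $ j)" by simp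
    moreover have "(\<Sum>k\<in>UNIV. x $ k) / 2 \<in> \<int>" using x by (auto simp: W8_def)
    ultimately show ?thesis using W8_sum[OF x] by (metis Ints_diff)
  qed
  ultimately show ?thesis unfolding W8_def by blast
qed

text \<open>Sign changes kill the mixed moments, and exchanges make the diagonal ones constant on
  each factor. The balance then reads \<open>8 * (3 * U 1 1) = 3 * (8 * V 1 1)\<close> and equates
  the two constants.\<close>

lemma Z3_W8_design_criterion:
  assumes fin: "finite (shell Z3_W8 m)" and ne: "shell Z3_W8 m \<noteq> {}"
    and bal: "(\<Sum>(u, w)\<in>shell Z3_W8 m. 8 * inner u u - 3 * inner w w) = 0"
  shows "spherical_3_design (shell Z3_W8 m)"
proof -
  let ?X = "shell Z3_W8 m"
  have mem: "(u, w) \<in> ?X \<longleftrightarrow> u \<in> Zn_lattice \<and> w \<in> W8 \<and> inner u u + inner w w = m" for u w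
    by (auto simp: shell_def Z3_W8_def inner_prod_def)
  define U where "U i j = (\<Sum>(u, w)\<in>?X. u $ i * u $ j)" for i j
  define V where "V i j = (\<Sum>(u, w)\<in>?X. w $ i * w $ j)" for i j
  have UV: "(\<Sum>(u, w)\<in>?X. u $ i * w $ j) = 0" for i j
    by (rule sum_involution_neg_0[where g = "\<lambda>(u, w). (sign_flip {i} u, w)"])
       (auto simp: mem Zn_sign_flip inner_sign_flip)
  have Uoff: "U i j = 0" if "i \<noteq> j" for i j
    unfolding U_def by (rule sum_involution_neg_0[where g = "\<lambda>(u, w). (sign_flip {i} u, w)"])
       (use that in \<open>auto simp: mem Zn_sign_flip inner_sign_flip\<close>)
  have Voff: "V i j = 0" if ij: "i \<noteq> j" for i j
  proof -
    \<comment> \<open>Signs in \<open>W8\<close> may be changed in pairs, so the flip at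
      \<open>i\<close> needs a partner outside \<open>{i, j}\<close>.\<close>
    obtain k where k: "k \<noteq> i" "k \<noteq> j"
    proof -
      have "card {i, j} \<le> 2" by (simp add: card_insert_if)
      then have "{i, j} \<noteq> (UNIV :: 8 set)" by auto
      then show ?thesis using that by blast
    qed
    show ?thesis
      unfolding V_def by (rule sum_involution_neg_0[where g = "\<lambda>(u, w). (u, sign_flip {i, k} w)"])
       (use k ij W8_sign_flip in \<open>auto simp: mem inner_sign_flip\<close>)
  qed
  have Udiag: "U i i = U j j" for i j
    unfolding U_def
    by (rule sum.reindex_bij_witness[of _ "\<lambda>(u, w). (swap_coords i j u, w)" "\<lambda>(u, w). (swap_coords i j u, w)"])
       (auto simp: mem Zn_swap inner_swap_coords)
  have Vdiag: "V i i = V j j" for i j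
    unfolding V_def
    by (rule sum.reindex_bij_witness[of _ "\<lambda>(u, w). (u, swap_coords i j w)" "\<lambda>(u, w). (u, swap_coords i j w)"])
       (auto simp: mem W8_swap inner_swap_coords)
  have "(\<Sum>(u, w)\<in>?X. inner u u) = (\<Sum>i\<in>UNIV. U i i)"
    unfolding U_def by (subst sum.swap) (simp add: inner_vec_def split_def)
  also have "\<dots> = (\<Sum>i\<in>(UNIV :: 3 set). U 1 1)" by (rule sum.cong) (use Udiag in auto)
  finally have u: "(\<Sum>(u, w)\<in>?X. inner u u) = 3 * U 1 1" by simp
  have "(\<Sum>(u, w)\<in>?X. inner w w) = (\<Sum>i\<in>UNIV. V i i)"
    unfolding V_def by (subst sum.swap) (simp add: inner_vec_def split_def)
  also have "\<dots> = (\<Sum>i\<in>(UNIV :: 8 set). V 1 1)" by (rule sum.cong) (use Vdiag in auto)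
  finally have w: "(\<Sum>(u, w)\<in>?X. inner w w) = 8 * V 1 1" by simp
  have "8 * (\<Sum>(u, w)\<in>?X. inner u u) - 3 * (\<Sum>(u, w)\<in>?X. inner w w) = 0"
    using bal by (simp add: sum_distrib_left sum_subtractf split_def)
  then have eq: "U 1 1 = V 1 1" unfolding u w by simp
  show ?thesis
  proof (rule spherical_3_designI[OF fin ne, where r = "sqrt m" and s = "V 1 1"])
    fix x assume "x \<in> ?X"
    then show "norm x = sqrt m" by (simp add: shell_def norm_eq_sqrt_inner)
  next
    fix x assume x: "x \<in> ?X"
    obtain u w where [simp]: "x = (u, w)" by (cases x)
    have "- u \<in> Zn_lattice" using x by (auto simp: mem Zn_lattice_def)
    moreover have "- w \<in> W8"
    proof -
      have w: "w \<in> W8" using x by (auto simp: mem)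
      have "- w $ i - - w $ 1 = w $ 1 - w $ i" for i by simp
      then show ?thesis using w W8_diff[OF w, of 1] by (auto simp: W8_def sum_negf)
    qed
    ultimately show "- x \<in> ?X" using x by (simp add: mem)
  next
    have B: "i \<in> Basis \<Longrightarrow> (\<exists>k. i = (axis k 1, 0)) \<or> (\<exists>k. i = (0, axis k 1))" for i :: "(real^3) \<times> (real^8)"
      by (auto simp: Basis_prod_def Basis_vec_def)
    have in1: "inner x (axis k 1, 0) = fst x $ k" for x :: "(real^3) \<times> (real^8)" and k by (simp add: inner_prod_def inner_axis)
    have in2: "inner x (0, axis k 1) = snd x $ k" for x :: "(real^3) \<times> (real^8)" and k by (simp add: inner_prod_def inner_axis)
    have UV': "(\<Sum>(u, w)\<in>?X. w $ i * u $ j) = 0" for i j using UV[of j i] by (simp add: mult.commute)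
    {
      fix i j :: "(real^3) \<times> (real^8)"
      assume "i \<in> Basis" "j \<in> Basis" "i \<noteq> j"
      then consider k l where "i = (axis k 1, 0)" "j = (axis l 1, 0)" "k \<noteq> l"
        | k l where "i = (axis k 1, 0)" "j = (0, axis l 1)" | k l where "i = (0, axis k 1)" "j = (axis l 1, 0)"
        | k l where "i = (0, axis k 1)" "j = (0, axis l 1)" "k \<noteq> l"
        using B[of i] B[of j] by fast
      then show "(\<Sum>x\<in>?X. inner x i * inner x j) = 0"
      proof cases
        case 1 then show ?thesis using Uoff by (simp add: in1 in2 U_def split_def)
      next
        case 2 then show ?thesis using UV by (simp add: in1 in2 split_def)
      next
        case 3 then show ?thesis using UV' by (simp add: in1 in2 split_def)
      next
        case 4 then show ?thesis using Voff by (simp add: in1 in2 V_def split_def)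
      qed
    next
      fix i :: "(real^3) \<times> (real^8)"
      assume "i \<in> Basis"
      then consider k where "i = (axis k 1, 0)" | k where "i = (0, axis k 1)" using B[of i] by blast
      then show "(\<Sum>x\<in>?X. inner x i * inner x i) = V 1 1"
      proof cases
        case 1
        then have "(\<Sum>x\<in>?X. inner x i * inner x i) = U k k" by (simp add: in1 U_def split_def)
        then show ?thesis using Udiag[of k 1] eq by simp
      next
        case 2
        then have "(\<Sum>x\<in>?X. inner x i * inner x i) = V k k" by (simp add: in2 V_def split_def)
        then show ?thesis using Vdiag[of k 1] by simp
      qed
    }
  qed
qed

section \<open>Theta functions as formal power series\<close>

text \<open>Substitution of \<open>c\<close> times the variable. With exp(pi i \<tau>) as variable,
  the values -1, \<open>\<i>\<close> and exp(pi i / 4) of \<open>c\<close> are the translations of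
  \<tau> by 1, 1/2 and 1/4.\<close>

definition fps_twist :: "'a::comm_ring_1 \<Rightarrow> 'a fps \<Rightarrow> 'a fps" where
  "fps_twist c f = Abs_fps (\<lambda>n. c ^ n * f $ n)"

lemma fps_twist_nth [simp]: "fps_twist c f $ n = c ^ n * f $ n"
  by (simp add: fps_twist_def)

lemma fps_twist_add: "fps_twist c (f + g) = fps_twist c f + fps_twist c g"
  by (rule fps_ext) (simp add: algebra_simps)

lemma fps_twist_diff: "fps_twist c (f - g) = fps_twist c f - fps_twist c g"
  by (rule fps_ext) (simp add: algebra_simps)

lemma fps_twist_mult: "fps_twist c (f * g) = fps_twist c f * fps_twist c g"
proof (rule fps_ext)
  fix n
  have "(fps_twist c f * fps_twist c g) $ n = (\<Sum>i=0..n. (c ^ i * c ^ (n - i)) * (f $ i * g $ (n - i)))"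
    by (simp add: fps_mult_nth mult_ac)
  also have "\<dots> = (\<Sum>i=0..n. c ^ n * (f $ i * g $ (n - i)))"
    by (intro sum.cong) (auto simp flip: power_add)
  also have "\<dots> = fps_twist c (f * g) $ n" by (simp add: fps_mult_nth sum_distrib_left)
  finally show "fps_twist c (f * g) $ n = (fps_twist c f * fps_twist c g) $ n" ..
qed

lemma fps_twist_power: "fps_twist c (f ^ k) = fps_twist c f ^ k"
proof (induction k)
  case 0
  show ?case by (rule fps_ext) auto
qed (simp add: fps_twist_mult)

lemma fps_twist_numeral: "fps_twist c (numeral k) = numeral k"
  by (rule fps_ext) (auto simp: fps_numeral_nth)

text \<open>The operator q d/dq, which is d/d\<tau> up to a constant; it weights each coefficient by
  its norm.\<close>

definition fps_euler :: "complex fps \<Rightarrow> complex fps" where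
  "fps_euler f = fps_X * fps_deriv f"

lemma fps_euler_nth [simp]: "fps_euler f $ n = of_nat n * f $ n"
  by (cases n) (auto simp: fps_euler_def)

lemma fps_euler_add: "fps_euler (f + g) = fps_euler f + fps_euler g"
  and fps_euler_diff: "fps_euler (f - g) = fps_euler f - fps_euler g"
  and fps_euler_mult: "fps_euler (f * g) = fps_euler f * g + f * fps_euler g"
  by (simp_all add: fps_euler_def algebra_simps)

lemma fps_euler_numeral: "fps_euler (numeral k) = 0"
  by (rule fps_ext) (simp add: fps_numeral_nth)

lemma fps_euler_power: "fps_euler (f ^ Suc k) = of_nat (Suc k) * f ^ k * fps_euler f"
proof (induction k)
  case (Suc k)
  have "fps_euler (f ^ Suc (Suc k)) = fps_euler f * f ^ Suc k + f * fps_euler (f ^ Suc k)"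
    by (simp only: power_Suc[of f "Suc k"] fps_euler_mult)
  then show ?case unfolding Suc.IH by (simp add: algebra_simps)
qed simp

lemma fps_twist_euler: "fps_twist c (fps_euler f) = fps_euler (fps_twist c f)"
  by (rule fps_ext) (simp add: mult_ac)

definition fps_dilate4 :: "complex fps \<Rightarrow> complex fps" where
  "fps_dilate4 f = f oo (fps_X ^ 4)"

lemma fps_dilate4_nth: "fps_dilate4 f $ n = (if 4 dvd n then f $ (n div 4) else 0)"
proof -
  have "fps_dilate4 f $ n = (\<Sum>i=0..n. f $ i * (if n = 4 * i then 1 else 0))"
    by (simp add: fps_dilate4_def fps_compose_nth flip: power_mult)
  also have "\<dots> = (if 4 dvd n then f $ (n div 4) else 0)"
  proof (cases "4 dvd n")
    case True
    then obtain k where k: "n = 4 * k" by blast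
    have "(\<Sum>i=0..n. f $ i * (if n = 4 * i then 1 else 0)) = (\<Sum>i=0..n. if i = k then f $ k else 0)"
      by (rule sum.cong) (auto simp: k)
    then show ?thesis by (simp add: k)
  qed (auto intro!: sum.neutral)
  finally show ?thesis .
qed

lemma fps_dilate4_add: "fps_dilate4 (f + g) = fps_dilate4 f + fps_dilate4 g"
  and fps_dilate4_diff: "fps_dilate4 (f - g) = fps_dilate4 f - fps_dilate4 g"
  and fps_dilate4_mult: "fps_dilate4 (f * g) = fps_dilate4 f * fps_dilate4 g"
  and fps_dilate4_power: "fps_dilate4 (f ^ k) = fps_dilate4 f ^ k"
  by (simp_all add: fps_dilate4_def fps_compose_add_distrib fps_compose_sub_distrib fps_compose_mult_distrib fps_compose_power)

lemma fps_dilate4_numeral: "fps_dilate4 (numeral k) = numeral k"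
  unfolding fps_dilate4_def numeral_fps_const by simp

lemma fps_euler_dilate4: "fps_euler (fps_dilate4 f) = 4 * fps_dilate4 (fps_euler f)"
proof (rule fps_ext)
  fix n
  have "(4 * fps_dilate4 (fps_euler f)) $ n = 4 * fps_dilate4 (fps_euler f) $ n"
    unfolding numeral_fps_const by simp
  then show "fps_euler (fps_dilate4 f) $ n = (4 * fps_dilate4 (fps_euler f)) $ n"
    by (auto simp: fps_dilate4_nth)
qed

text \<open>\<open>A\<close> and \<open>B\<close> stand for \<open>\<theta>\<^sub>3(4\<tau>)\<close> and \<open>\<theta>\<^sub>2(4\<tau>)\<close>, so that \<open>\<theta>\<^sub>3 = A + B\<close> and \<open>\<theta>\<^sub>4 = A - B\<close>; \<open>A'\<close> is \<open>\<theta>\<^sub>4(4\<tau>)\<close>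
  and \<open>C\<close> is \<open>\<theta>\<^sub>2\<^sup>4\<close>, all as power series in \<open>exp (\<pi> \<i> \<tau>)\<close>.\<close>

locale jacobi_thetas =
  fixes A B A' C :: "complex fps"
  assumes dil3: "fps_dilate4 (A + B) = A" and dil4: "fps_dilate4 (A - B) = A'"
    and dilC: "fps_dilate4 C = B ^ 4" and C: "C = 8 * A * B * (A ^ 2 + B ^ 2)"
    and suppA: "\<And>n. A $ n \<noteq> 0 \<Longrightarrow> n mod 4 = 0" and suppB: "\<And>n. B $ n \<noteq> 0 \<Longrightarrow> n mod 8 = 1"
    and A'A: "\<And>n. A' $ n = (if n mod 8 = 0 then A $ n else - A $ n)"
begin

text \<open>The parenthesis is twice the theta series of \<open>W8\<close>, which avoids a division.
  With 8 and 3 as twice the weights 4 and 3/2, this is a multiple of the first Rankin-Cohen bracket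
  of the two series.\<close>

definition bracket :: "complex fps" where
  "bracket = 8 * fps_euler ((A + B) ^ 3) * (C ^ 2 + (A + B) ^ 8 + (A - B) ^ 8)
      - 3 * (A + B) ^ 3 * fps_euler (C ^ 2 + (A + B) ^ 8 + (A - B) ^ 8)"

abbreviation "DA \<equiv> fps_euler A"
abbreviation "DB \<equiv> fps_euler B"
definition "W = A * DB - B * DA"

lemma DC: "fps_euler C = 8 * (DA * B + A * DB) * (A ^ 2 + B ^ 2) + 16 * A * B * (A * DA + B * DB)"
  unfolding C power2_eq_square
  by (simp add: fps_euler_mult fps_euler_add fps_euler_numeral algebra_simps)

text \<open>The summand \<open>(A + B) ^ 8\<close> drops out, since the bracket of two powers of the
  same series vanishes. What remains involves only \<open>A + B\<close>, \<open>A - B\<close>,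
  \<open>C\<close> and their derivatives, whose dilations are known.\<close>

lemma bracket_eq:
  "bracket = 24 * (A + B) ^ 2 * (C * (C * (DA + DB)) + (A - B) ^ 7 * ((A - B) * (DA + DB) - (A + B) * (DA - DB)))
      - 6 * (A + B) ^ 3 * C * fps_euler C"
proof -
  have p: "f ^ 8 = f ^ Suc 7" "f ^ 3 = f ^ Suc 2" "f ^ 2 = f ^ Suc 1" for f :: "complex fps"
    by (simp_all add: power2_eq_square)
  have e8: "fps_euler (f ^ 8) = 8 * f ^ 7 * fps_euler f" and e3: "fps_euler (f ^ 3) = 3 * f ^ 2 * fps_euler f"
    and e2: "fps_euler (f ^ 2) = 2 * f * fps_euler f" for f
    unfolding p fps_euler_power by simp_all
  have "8 * (3 * t ^ 2 * t') * (c ^ 2 + t ^ 8 + u ^ 8) - 3 * t ^ 3 * (2 * c * c' + 8 * t ^ 7 * t' + 8 * u ^ 7 * u') =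
     24 * t ^ 2 * (c * (c * t') + u ^ 7 * (u * t' - t * u')) - 6 * t ^ 3 * c * c'" for t t' u u' c c' :: "complex fps"
    by (simp add: algebra_simps power_numeral_reduce)
  from this[of "A + B" "DA + DB" C "A - B" "fps_euler C" "DA - DB"] show ?thesis
    unfolding bracket_def e3 fps_euler_add e2 e8 fps_euler_diff .
qed

text \<open>For forms P and Q of degrees p and q in \<open>A\<close> and \<open>B\<close>, Euler's
  relation makes q Q P' - p P Q' the product of \<open>W\<close> and the Jacobian determinant of the
  forms, up to sign. Here P is \<open>A + B\<close> and Q is the quartic form
  \<open>C\<close>.\<close>

lemma C_wronskian: "4 * C * (DA + DB) - (A + B) * fps_euler C = - 8 * (A - B) ^ 3 * W"
  unfolding DC unfolding C W_def by (simp add: algebra_simps power_numeral_reduce)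

lemma bracket_W': "bracket = 48 * W * ((A + B) ^ 2 * (A - B) ^ 3 * ((A - B) ^ 4 - C))"
proof -
  have "(A - B) * (DA + DB) - (A + B) * (DA - DB) = 2 * W" unfolding W_def by (simp add: algebra_simps)
  then have "bracket = 24 * (A + B) ^ 2 * (C * (C * (DA + DB)) + (A - B) ^ 7 * (2 * W)) - 6 * (A + B) ^ 3 * C * fps_euler C"
    using bracket_eq by simp
  also have "\<dots> = 6 * (A + B) ^ 2 * C * (4 * C * (DA + DB) - (A + B) * fps_euler C) + 48 * (A + B) ^ 2 * (A - B) ^ 7 * W"
    by (simp add: right_diff_distrib distrib_left mult_ac power3_eq_cube power2_eq_square)
  also have "\<dots> = 48 * W * ((A + B) ^ 2 * (A - B) ^ 3 * ((A - B) ^ 4 - C))"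
    unfolding C_wronskian by (simp add: right_diff_distrib mult_ac flip: power_add)
  finally show ?thesis .
qed

text \<open>The polynomial is sorted by the degree in \<open>B\<close> modulo 4. Since
  \<open>A\<close> has exponents 0 modulo 4 while \<open>B\<close> and \<open>W\<close> have
  exponents 1, the four summands live on the exponents 1, 2, 3 and 0 modulo 4, in this
  order.\<close>

lemma bracket_W:
  "bracket = 24 * (W * (2 * A ^ 9 - 44 * A ^ 5 * B ^ 4 + 26 * A * B ^ 8)
     + W * (44 * A ^ 4 * B ^ 5 - 26 * A ^ 8 * B - 2 * B ^ 9)
     + W * (32 * A ^ 7 * B ^ 2 - 16 * A ^ 3 * B ^ 6) + W * (16 * A ^ 6 * B ^ 3 - 32 * A ^ 2 * B ^ 7))"
proof -
  have "2 * ((A + B) ^ 2 * (A - B) ^ 3 * ((A - B) ^ 4 - C)) =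
     (2 * A ^ 9 - 44 * A ^ 5 * B ^ 4 + 26 * A * B ^ 8) + (44 * A ^ 4 * B ^ 5 - 26 * A ^ 8 * B - 2 * B ^ 9)
     + (32 * A ^ 7 * B ^ 2 - 16 * A ^ 3 * B ^ 6) + (16 * A ^ 6 * B ^ 3 - 32 * A ^ 2 * B ^ 7)"
    unfolding C by (simp add: algebra_simps power_numeral_reduce)
  note * = arg_cong[OF this, of "\<lambda>f. 24 * (W * f)"]
  have "bracket = 24 * (W * (2 * ((A + B) ^ 2 * (A - B) ^ 3 * ((A - B) ^ 4 - C))))"
    unfolding bracket_W' by simp
  then show ?thesis unfolding * distrib_left .
qed

text \<open>Jacobi's identity at 4\<tau>: the formula for \<open>C\<close> says that it is the
  difference of the fourth powers of \<open>A + B\<close> and \<open>A - B\<close>, and dilation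
  turns these into \<open>B\<close>, \<open>A\<close> and \<open>A'\<close>.\<close>

lemma A'4: "A' ^ 4 = A ^ 4 - B ^ 4"
proof -
  have "C = (A + B) ^ 4 - (A - B) ^ 4" unfolding C by algebra
  then have "fps_dilate4 C = A ^ 4 - A' ^ 4"
    by (simp only: fps_dilate4_diff[of "(A + B) ^ 4"] fps_dilate4_power dil3 dil4)
  then show ?thesis unfolding dilC by (simp add: algebra_simps)
qed

lemma A'3: "A' ^ 3 * fps_euler A' = A ^ 3 * DA - B ^ 3 * DB"
proof -
  have e: "fps_euler (f ^ 4) = 4 * (f ^ 3 * fps_euler f)" for f
    using fps_euler_power[of f 3] by (simp add: mult_ac)
  have "4 * (A' ^ 3 * fps_euler A') = 4 * (A ^ 3 * DA - B ^ 3 * DB)"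
    using arg_cong[OF A'4, of fps_euler] unfolding fps_euler_diff e by (simp add: algebra_simps)
  moreover have "(4 :: complex fps) \<noteq> 0" by simp
  ultimately show ?thesis by (metis mult_left_cancel)
qed

text \<open>Dilation sends \<open>A + B\<close>, \<open>A - B\<close> and \<open>C\<close> to
  \<open>A\<close>, \<open>A'\<close> and \<open>B ^ 4\<close>. The derivative of \<open>A'\<close>
  enters only in the combination of \<open>A'3\<close>, so everything reduces to \<open>A\<close>,
  \<open>B\<close> and \<open>W\<close> again.\<close>

lemma dilate_bracket: "4 * fps_dilate4 bracket = 24 * (A ^ 2 * B ^ 3 * W * (A' ^ 4 - B ^ 4))"
proof -
  have d3: "4 * fps_dilate4 (DA + DB) = DA"
    using fps_euler_dilate4[of "A + B"] by (simp add: dil3 fps_euler_add)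
  have d4: "4 * fps_dilate4 (DA - DB) = fps_euler A'"
    using fps_euler_dilate4[of "A - B"] by (simp add: dil4 fps_euler_diff)
  have "fps_euler (B ^ 4) = 4 * (B ^ 3 * DB)"
    using fps_euler_power[of B 3] by (simp add: mult_ac)
  then have dC: "fps_dilate4 (fps_euler C) = B ^ 3 * DB"
    using fps_euler_dilate4[of C] by (simp add: dilC)
  have "4 * fps_dilate4 bracket = 24 * A ^ 2 * (B ^ 4 * (B ^ 4 * (4 * fps_dilate4 (DA + DB))) + A' ^ 7 * (A' * (4 * fps_dilate4 (DA + DB)) - A * (4 * fps_dilate4 (DA - DB))))
      - 24 * A ^ 3 * B ^ 4 * fps_dilate4 (fps_euler C)"
  proof -
    define t where "t = A + B"
    define u where "u = A - B"
    define t' where "t' = DA + DB"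
    define u' where "u' = DA - DB"
    have "bracket = 24 * t ^ 2 * (C * (C * t') + u ^ 7 * (u * t' - t * u')) - 6 * t ^ 3 * C * fps_euler C"
      unfolding t_def u_def t'_def u'_def by (rule bracket_eq)
    then have "fps_dilate4 bracket = 24 * A ^ 2 * (B ^ 4 * (B ^ 4 * fps_dilate4 t') + A' ^ 7 * (A' * fps_dilate4 t' - A * fps_dilate4 u')) - 6 * A ^ 3 * B ^ 4 * fps_dilate4 (fps_euler C)"
      by (simp only: fps_dilate4_diff fps_dilate4_add fps_dilate4_mult fps_dilate4_power fps_dilate4_numeral dilC
            dil3[folded t_def] dil4[folded u_def])
    then show ?thesis unfolding t'_def[symmetric] u'_def[symmetric] by (simp only:) (simp add: algebra_simps)
  qed
  also have "\<dots> = 24 * A ^ 2 * (B ^ 4 * (B ^ 4 * DA) + A' ^ 4 * (A' ^ 4 * DA - A * (A' ^ 3 * fps_euler A'))) - 24 * A ^ 3 * B ^ 4 * (B ^ 3 * DB)"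
    unfolding d3 d4 dC by algebra
  also have "\<dots> = 24 * (A ^ 2 * B ^ 3 * W * (A' ^ 4 - B ^ 4))"
    unfolding A'3 unfolding A'4 W_def by algebra
  finally show ?thesis .
qed

lemma twist_coeff_0:
  fixes f :: "complex fps"
  assumes "fps_twist c f = fps_const e * f" "c ^ n \<noteq> e"
  shows "f $ n = 0"
  using arg_cong[OF assms(1), of "\<lambda>f. f $ n"] assms(2) by (metis fps_mult_left_const_nth fps_twist_nth mult_right_cancel)

lemma i_power_mod4: "\<i> ^ n = \<i> ^ (n mod 4)"
proof -
  have "\<i> ^ n = (\<i> ^ 4) ^ (n div 4) * \<i> ^ (n mod 4)" by (simp only: flip: power_mult power_add) simp
  then show ?thesis by (simp add: power4_eq_xxxx)
qed

lemma twist_i: "fps_twist \<i> A = A" "fps_twist \<i> B = fps_const \<i> * B" "fps_twist \<i> W = fps_const \<i> * W"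
proof -
  show A: "fps_twist \<i> A = A"
  proof (rule fps_ext)
    fix n show "fps_twist \<i> A $ n = A $ n"
      using suppA[of n] i_power_mod4[of n] by (cases "A $ n = 0") auto
  qed
  show B: "fps_twist \<i> B = fps_const \<i> * B"
  proof (rule fps_ext)
    fix n
    have "n mod 4 = 1" if "n mod 8 = 1" for n :: nat using that by presburger
    then show "fps_twist \<i> B $ n = (fps_const \<i> * B) $ n"
      using suppB[of n] i_power_mod4[of n] by (cases "B $ n = 0") auto
  qed
  have "fps_euler (fps_const c * f) = fps_const c * fps_euler f" for c f by (rule fps_ext) simp
  then show "fps_twist \<i> W = fps_const \<i> * W"
    unfolding W_def by (simp add: fps_twist_diff fps_twist_mult fps_twist_euler A B algebra_simps)
qed

text \<open>Twisting by \<open>\<i>\<close> multiplies the first three summands of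
  \<open>bracket_W\<close> by \<open>\<i>\<close>, -1 and \<open>- \<i>\<close>, so only the last
  one reaches exponents divisible by 4.\<close>

lemma bracket_4: "bracket $ (4 * n) = 64 * bracket $ n"
proof -
  let ?S0 = "W * (2 * A ^ 9 - 44 * A ^ 5 * B ^ 4 + 26 * A * B ^ 8)"
  let ?S1 = "W * (44 * A ^ 4 * B ^ 5 - 26 * A ^ 8 * B - 2 * B ^ 9)"
  let ?S2 = "W * (32 * A ^ 7 * B ^ 2 - 16 * A ^ 3 * B ^ 6)"
  let ?S3 = "W * (16 * A ^ 6 * B ^ 3 - 32 * A ^ 2 * B ^ 7)"
  note tw = fps_twist_add fps_twist_diff fps_twist_mult fps_twist_power fps_twist_numeral twist_i power_mult_distrib
  have i4: "fps_const \<i> ^ 4 = 1" by (simp add: power4_eq_xxxx fps_const_power)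
  have t0: "fps_twist \<i> ?S0 = fps_const \<i> * ?S0"
    unfolding tw using i4 by algebra
  have t1: "fps_twist \<i> ?S1 = fps_const (\<i> ^ 2) * ?S1"
    unfolding tw fps_const_power[symmetric] using i4 by algebra
  have t2: "fps_twist \<i> ?S2 = fps_const (\<i> ^ 3) * ?S2"
    unfolding tw fps_const_power[symmetric] using i4 by algebra
  have z: "\<i> ^ (4 * n) = 1" using i_power_mod4[of "4 * n"] by simp
  have "?S0 $ (4 * n) = 0" by (rule twist_coeff_0[OF t0]) (simp add: z complex_eq_iff)
  moreover have "?S1 $ (4 * n) = 0" by (rule twist_coeff_0[OF t1]) (simp add: z)
  moreover have "?S2 $ (4 * n) = 0" by (rule twist_coeff_0[OF t2]) (simp add: z power3_eq_cube complex_eq_iff)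
  ultimately have "bracket $ (4 * n) = 24 * ?S3 $ (4 * n)"
    unfolding bracket_W numeral_fps_const[of "num.Bit0 (num.Bit0 (num.Bit0 (num.Bit1 num.One)))"]
    by (simp only: fps_mult_left_const_nth fps_add_nth add_0 mult_zero_right)
  \<comment> \<open>By \<open>A'4\<close> the factor \<open>A' ^ 4 - B ^ 4\<close> is
    \<open>A ^ 4 - 2 * B ^ 4\<close>, so the last summand is 16 times the right side of
    \<open>dilate_bracket\<close>; with its factor 4 this gives 64.\<close>
  also have "24 * ?S3 = 16 * (4 * fps_dilate4 bracket)"
    unfolding dilate_bracket unfolding A'4 by algebra
  then have eq: "fps_const 24 * ?S3 = fps_const 64 * fps_dilate4 bracket"
    unfolding numeral_fps_const[symmetric] by simp
  from arg_cong[OF eq, of "\<lambda>f. f $ (4 * n)"]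
  have "24 * ?S3 $ (4 * n) = 64 * fps_dilate4 bracket $ (4 * n)"
    by (simp only: fps_mult_left_const_nth)
  also have "fps_dilate4 bracket $ (4 * n) = bracket $ n" by (simp add: fps_dilate4_nth)
  finally show ?thesis .
qed

text \<open>Exponents 7 modulo 8 can only occur in the third summand. A primitive eighth root of
  unity \<open>c\<close> multiplies that summand by \<open>c ^ 3\<close> under twisting, so all its
  exponents are 3 modulo 8.\<close>

lemma bracket_7_mod_8:
  assumes "n mod 8 = 7"
  shows "bracket $ n = 0"
proof -
  let ?S0 = "W * (2 * A ^ 9 - 44 * A ^ 5 * B ^ 4 + 26 * A * B ^ 8)"
  let ?S1 = "W * (44 * A ^ 4 * B ^ 5 - 26 * A ^ 8 * B - 2 * B ^ 9)"
  let ?S2 = "W * (32 * A ^ 7 * B ^ 2 - 16 * A ^ 3 * B ^ 6)"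
  let ?S3 = "W * (16 * A ^ 6 * B ^ 3 - 32 * A ^ 2 * B ^ 7)"
  note tw = fps_twist_add fps_twist_diff fps_twist_mult fps_twist_power fps_twist_numeral power_mult_distrib
  have i4: "fps_const \<i> ^ 4 = 1" by (simp add: power4_eq_xxxx fps_const_power)
  have t0: "fps_twist \<i> ?S0 = fps_const \<i> * ?S0"
    unfolding tw twist_i using i4 by algebra
  have t1: "fps_twist \<i> ?S1 = fps_const (\<i> ^ 2) * ?S1"
    unfolding tw twist_i fps_const_power[symmetric] using i4 by algebra
  have t3: "fps_twist \<i> ?S3 = fps_const (\<i> ^ 4) * ?S3"
    unfolding tw twist_i fps_const_power[symmetric] using i4 by algebra
  have "n mod 4 = 3" using assms by presburger
  then have z: "\<i> ^ n = - \<i>" using i_power_mod4[of n] by (simp add: power3_eq_cube)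
  \<comment> \<open>The twist by this root exchanges \<open>A\<close> and \<open>A'\<close>, whose
    exponents are 0 or 4 modulo 8, and multiplies \<open>B\<close> by \<open>c\<close>, as its
    exponents are 1 modulo 8.\<close>
  define c where "c = cis (pi / 4)"
  have c2: "c ^ 2 = \<i>" by (simp add: c_def DeMoivre power2_eq_square cis_mult)
  have cn: "c ^ k = \<i> ^ ((k mod 8) div 2) * c ^ (k mod 2)" for k
  proof -
    have "c ^ k = c ^ (2 * (k div 2) + k mod 2)" by simp
    also have "\<dots> = \<i> ^ (k div 2) * c ^ (k mod 2)" by (simp only: power_add power_mult c2)
    also have "\<i> ^ (k div 2) = \<i> ^ ((k div 2) mod 4)" by (rule i_power_mod4)
    also have "(k div 2) mod 4 = (k mod 8) div 2" by presburger
    finally show ?thesis .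
  qed
  have tA: "fps_twist c A = A'"
  proof (rule fps_ext)
    fix k
    show "fps_twist c A $ k = A' $ k"
    proof (cases "A $ k = 0")
      case False
      then have "k mod 8 = 0 \<or> k mod 8 = 4" "k mod 2 = 0" using suppA[of k] by presburger+
      then show ?thesis using cn[of k] by (auto simp: A'A)
    qed (simp add: A'A)
  qed
  have tB: "fps_twist c B = fps_const c * B"
  proof (rule fps_ext)
    fix k
    show "fps_twist c B $ k = (fps_const c * B) $ k"
    proof (cases "B $ k = 0")
      case False
      then have "k mod 8 = 1" "k mod 2 = 1" using suppB[of k] by presburger+
      then show ?thesis using cn[of k] by simp
    qed simp
  qed
  have tA': "fps_twist c A' = A"
  proof (rule fps_ext)
    fix k
    show "fps_twist c A' $ k = A $ k"
    proof (cases "A $ k = 0")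
      case False
      then have "k mod 8 = 0 \<or> k mod 8 = 4" "k mod 2 = 0" using suppA[of k] by presburger+
      then show ?thesis using cn[of k] by (auto simp: A'A)
    qed (simp add: A'A)
  qed
  \<comment> \<open>The twist replaces \<open>A\<close> by \<open>A'\<close> in the Wronskian; with
    the extra factor \<open>A ^ 3\<close> the differentiated Jacobi identity \<open>A'3\<close>
    brings the result back to a multiple of \<open>X\<close>.\<close>
  define X where "X = A ^ 3 * W"
  have "fps_euler (fps_const c * f) = fps_const c * fps_euler f" for f by (rule fps_ext) simp
  then have "fps_twist c X = A' ^ 3 * (A' * (fps_const c * DB) - (fps_const c * B) * fps_euler A')"
    unfolding X_def W_def by (simp add: tw fps_twist_euler tA tB)
  also have "\<dots> = fps_const c * (A' ^ 4 * DB - B * (A' ^ 3 * fps_euler A'))"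
    by algebra
  also have "\<dots> = fps_const c * X"
    unfolding A'3 unfolding A'4 X_def W_def by algebra
  finally have tX: "fps_twist c X = fps_const c * X" .
  \<comment> \<open>By \<open>A'4\<close> the factor \<open>2 * A ^ 4 - B ^ 4\<close> is
    \<open>A ^ 4 + A' ^ 4\<close>, which is symmetric under the exchange.\<close>
  have S2: "?S2 = 16 * X * B ^ 2 * (A ^ 4 + A' ^ 4)"
    unfolding A'4 X_def by algebra
  have "fps_twist c ?S2 = fps_const (c ^ 3) * ?S2"
    unfolding S2 tw tX tA tA' tB fps_const_power[symmetric] by algebra
  moreover have "c ^ n \<noteq> c ^ 3"
  proof -
    have "n mod 2 = 1" using assms by presburger
    then have "c ^ n = - \<i> * c" using cn[of n] assms by (simp add: power3_eq_cube)
    moreover have "c ^ 3 = \<i> * c" using c2 by (simp add: power3_eq_cube power2_eq_square)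
    moreover have "c \<noteq> 0" using c2 by auto
    ultimately show ?thesis by simp
  qed
  ultimately have "?S2 $ n = 0" by (rule twist_coeff_0)
  moreover have "?S0 $ n = 0" by (rule twist_coeff_0[OF t0]) (simp add: z complex_eq_iff)
  moreover have "?S1 $ n = 0" by (rule twist_coeff_0[OF t1]) (simp add: z complex_eq_iff)
  moreover have "?S3 $ n = 0" by (rule twist_coeff_0[OF t3]) (simp add: z power4_eq_xxxx complex_eq_iff)
  ultimately show ?thesis
    unfolding bracket_W numeral_fps_const[of "num.Bit0 (num.Bit0 (num.Bit0 (num.Bit1 num.One)))"]
    by (simp only: fps_mult_left_const_nth fps_add_nth add_0 mult_zero_right)
qed

end

section \<open>Generating functions that count by norm\<close>

definition count_gf :: "'a set \<Rightarrow> ('a \<Rightarrow> nat) \<Rightarrow> complex fps" where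
  "count_gf S N = Abs_fps (\<lambda>n. of_nat (card {x\<in>S. N x = n}))"

lemma count_gf_nth: "count_gf S N $ n = of_nat (card {x\<in>S. N x = n})"
  by (simp add: count_gf_def)

lemma count_gf_times:
  assumes "\<And>n. finite {x\<in>S. N x = n}" "\<And>n. finite {x\<in>T. M x = n}"
  shows "count_gf (S \<times> T) (\<lambda>(x, y). N x + M y) = count_gf S N * count_gf T M"
proof (rule fps_ext)
  fix n
  have "{p \<in> S \<times> T. (case p of (x, y) \<Rightarrow> N x + M y) = n} = (\<Union>i\<in>{0..n}. {x\<in>S. N x = i} \<times> {y\<in>T. M y = n - i})"
    by auto
  moreover have "card (\<Union>i\<in>{0..n}. {x\<in>S. N x = i} \<times> {y\<in>T. M y = n - i}) = (\<Sum>i\<in>{0..n}. card ({x\<in>S. N x = i} \<times> {y\<in>T. M y = n - i}))"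
    by (rule card_UN_disjoint) (use assms in auto)
  ultimately show "count_gf (S \<times> T) (\<lambda>(x, y). N x + M y) $ n = (count_gf S N * count_gf T M) $ n"
    by (simp add: count_gf_nth fps_mult_nth card_cartesian_product)
qed

lemma count_gf_bij:
  assumes "bij_betw h S T" "\<And>x. x \<in> S \<Longrightarrow> M (h x) = N x"
  shows "count_gf S N = count_gf T M"
proof (rule fps_ext)
  fix n
  have "bij_betw h {x\<in>S. N x = n} {y\<in>T. M y = n}"
    using assms unfolding bij_betw_def by (auto simp: inj_on_def)
  then show "count_gf S N $ n = count_gf T M $ n"
    using bij_betw_same_card by (fastforce simp: count_gf_nth)
qed

lemma finite_PiE_shell:
  assumes "\<And>n. finite {x\<in>S. N x = (n::nat)}" "finite I"
  shows "finite {f \<in> PiE I (\<lambda>_. S). (\<Sum>i\<in>I. N (f i)) = n}"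
proof (rule finite_subset)
  have "finite {x\<in>S. N x \<le> n}"
  proof -
    have "{x\<in>S. N x \<le> n} = (\<Union>k\<le>n. {x\<in>S. N x = k})" by auto
    then show ?thesis using assms by simp
  qed
  then show "finite (PiE I (\<lambda>_. {x\<in>S. N x \<le> n}))" using assms(2) by (intro finite_PiE) auto
  show "{f \<in> PiE I (\<lambda>_. S). (\<Sum>i\<in>I. N (f i)) = n} \<subseteq> PiE I (\<lambda>_. {x\<in>S. N x \<le> n})"
    using assms(2) by (auto simp: PiE_def Pi_def intro: member_le_sum)
qed

lemma count_gf_PiE:
  assumes "\<And>n. finite {x\<in>S. N x = n}" "finite I"
  shows "count_gf (PiE I (\<lambda>_. S)) (\<lambda>f. \<Sum>i\<in>I. N (f i)) = count_gf S N ^ card I"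
  using assms(2)
proof (induction I)
  case empty
  show ?case by (rule fps_ext) (auto simp: count_gf_nth)
next
  case (insert a I)
  have "bij_betw (\<lambda>(x, f). f(a := x)) (S \<times> PiE I (\<lambda>_. S)) (PiE (insert a I) (\<lambda>_. S))"
  proof (rule bij_betw_byWitness[where f' = "\<lambda>g. (g a, g(a := undefined))"])
    show "\<forall>p\<in>S \<times> PiE I (\<lambda>_. S). (\<lambda>g. (g a, g(a := undefined))) ((\<lambda>(x, f). f(a := x)) p) = p"
      using insert.hyps(2) by (auto simp: PiE_def extensional_def fun_eq_iff)
  qed (use insert.hyps(2) in \<open>auto simp: PiE_def Pi_def extensional_def\<close>)
  then have "count_gf (S \<times> PiE I (\<lambda>_. S)) (\<lambda>(x, f). N x + (\<Sum>i\<in>I. N (f i))) = count_gf (PiE (insert a I) (\<lambda>_. S)) (\<lambda>f. \<Sum>i\<in>insert a I. N (f i))"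
  proof (rule count_gf_bij)
    fix p assume "p \<in> S \<times> PiE I (\<lambda>_. S)"
    obtain x f where p: "p = (x, f)" by (cases p)
    have "(\<Sum>i\<in>I. N ((f(a := x)) i)) = (\<Sum>i\<in>I. N (f i))" using insert.hyps(2) by (intro sum.cong) auto
    then show "(\<Sum>i\<in>insert a I. N ((case p of (x, f) \<Rightarrow> f(a := x)) i)) = (case p of (x, f) \<Rightarrow> N x + (\<Sum>i\<in>I. N (f i)))"
      using insert.hyps by (simp add: p)
  qed
  also have "count_gf (S \<times> PiE I (\<lambda>_. S)) (\<lambda>(x, f). N x + (\<Sum>i\<in>I. N (f i))) = count_gf S N * count_gf (PiE I (\<lambda>_. S)) (\<lambda>f. \<Sum>i\<in>I. N (f i))"
    by (rule count_gf_times) (use assms(1) insert.hyps(1) in \<open>auto intro: finite_PiE_shell\<close>)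
  finally show ?case using insert by simp
qed

lemma count_gf_functions:
  assumes "\<And>n. finite {x\<in>S. N x = n}"
  shows "count_gf {f :: 'n::finite \<Rightarrow> 'a. \<forall>i. f i \<in> S} (\<lambda>f. \<Sum>i\<in>UNIV. N (f i)) = count_gf S N ^ CARD('n)"
proof -
  have "{f :: 'n \<Rightarrow> 'a. \<forall>i. f i \<in> S} = PiE UNIV (\<lambda>_. S)" by (auto simp: PiE_UNIV_domain)
  then show ?thesis using count_gf_PiE[OF assms, of "UNIV :: 'n set"] by simp
qed

lemma finite_int_square_le: "finite {k::int. k\<^sup>2 \<le> c}"
proof (rule finite_subset)
  show "{k::int. k\<^sup>2 \<le> c} \<subseteq> {-\<bar>c\<bar>..\<bar>c\<bar>}"
  proof
    fix k :: int assume "k \<in> {k. k\<^sup>2 \<le> c}"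
    moreover have "\<bar>k\<bar> * 1 \<le> \<bar>k\<bar> * \<bar>k\<bar>" 
    proof (cases "k = 0")
      case False
      then show ?thesis by (intro mult_left_mono) auto
    qed simp
    then have "\<bar>k\<bar> \<le> k\<^sup>2" by (simp add: power2_eq_square)
    ultimately show "k \<in> {-\<bar>c\<bar>..\<bar>c\<bar>}" by auto
  qed
qed simp


lemma finite_int_square_eq: "finite {k \<in> S. nat (k\<^sup>2) = n}" for S :: "int set"
  by (rule finite_subset[OF _ finite_int_square_le[of "int n"]]) auto

section \<open>Theta constants and Jacobi's identity\<close>

definition evens :: "int set" where "evens = {k. even k}"
definition odds :: "int set" where "odds = {k. odd k}"

text \<open>In the variable exp(pi i \<tau>) these are theta_3(4\<tau>), theta_2(4\<tau>) and
  theta_3(\<tau>). The argument 4\<tau> keeps the exponents of theta_2 integral.\<close>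

definition theta_even :: "complex fps" where "theta_even = count_gf evens (\<lambda>k. nat (k\<^sup>2))"
definition theta_odd :: "complex fps" where "theta_odd = count_gf odds (\<lambda>k. nat (k\<^sup>2))"
definition theta_all :: "complex fps" where "theta_all = count_gf UNIV (\<lambda>k::int. nat (k\<^sup>2))"

lemma theta_even_nth: "theta_even $ n = (if even n then theta_all $ n else 0)"
proof -
  have "{k \<in> evens. nat (k\<^sup>2) = n} = (if even n then {k \<in> UNIV. nat (k\<^sup>2) = n} else {})"
  proof -
    have "even k \<longleftrightarrow> even n" if "nat (k\<^sup>2) = n" for k :: int
      using that by (metis even_nat_iff even_power pos2 zero_le_power2)
    then show ?thesis by (auto simp: evens_def)
  qed
  then show ?thesis by (simp add: theta_even_def theta_all_def count_gf_nth)
qed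

lemma theta_odd_nth: "theta_odd $ n = (if odd n then theta_all $ n else 0)"
proof -
  have "{k \<in> odds. nat (k\<^sup>2) = n} = (if odd n then {k \<in> UNIV. nat (k\<^sup>2) = n} else {})"
  proof -
    have "even k \<longleftrightarrow> even n" if "nat (k\<^sup>2) = n" for k :: int
      using that by (metis even_nat_iff even_power pos2 zero_le_power2)
    then show ?thesis by (auto simp: odds_def)
  qed
  then show ?thesis by (simp add: theta_odd_def theta_all_def count_gf_nth)
qed

lemma theta_all_eq: "theta_even + theta_odd = theta_all"
  by (rule fps_ext) (simp add: theta_even_nth theta_odd_nth)

lemma theta_diff_eq: "theta_even - theta_odd = fps_twist (- 1) theta_all"
  by (rule fps_ext) (simp add: theta_even_nth theta_odd_nth)

lemma odd_square_mod_8: "odd k \<Longrightarrow> k\<^sup>2 mod 8 = 1" for k :: int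
proof -
  assume "odd k"
  then obtain m where m: "k = 2 * m + 1" by (rule oddE)
  have "even (m * (m + 1))" by simp
  then obtain j where j: "m * (m + 1) = 2 * j" by (rule evenE)
  have "k\<^sup>2 = 4 * (m * (m + 1)) + 1" by (simp add: m power2_eq_square algebra_simps)
  also have "\<dots> = 8 * j + 1" by (simp add: j)
  finally show ?thesis by simp
qed

lemma theta_odd_support: "theta_odd $ n \<noteq> 0 \<Longrightarrow> n mod 8 = 1"
proof -
  assume "theta_odd $ n \<noteq> 0"
  then have "{k \<in> odds. nat (k\<^sup>2) = n} \<noteq> {}" unfolding theta_odd_def count_gf_nth by (metis card.empty of_nat_0)
  then obtain k where "odd k" "nat (k\<^sup>2) = n" by (auto simp: odds_def)
  then have "int n mod 8 = 1" using odd_square_mod_8[of k] by auto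
  then show ?thesis by presburger
qed

lemma theta_even_dilate: "fps_dilate4 theta_all = theta_even"
proof (rule fps_ext)
  fix n
  show "fps_dilate4 theta_all $ n = theta_even $ n"
  proof (cases "4 dvd n")
    case True
    then obtain m where m: "n = 4 * m" by blast
    have "bij_betw (\<lambda>k. 2 * k) {k \<in> UNIV :: int set. nat (k\<^sup>2) = m} {k \<in> evens. nat (k\<^sup>2) = n}"
    proof (rule bij_betw_byWitness[where f' = "\<lambda>k. k div 2"])
      show "(\<lambda>k. 2 * k) ` {k \<in> UNIV :: int set. nat (k\<^sup>2) = m} \<subseteq> {k \<in> evens. nat (k\<^sup>2) = n}"
        by (auto simp: evens_def m power_mult_distrib nat_mult_distrib)
      show "(\<lambda>k. k div 2) ` {k \<in> evens. nat (k\<^sup>2) = n} \<subseteq> {k \<in> UNIV :: int set. nat (k\<^sup>2) = m}"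
        by (auto simp: evens_def m power_mult_distrib nat_mult_distrib elim!: evenE)
    qed (auto simp: evens_def)
    then have "card {k \<in> UNIV :: int set. nat (k\<^sup>2) = m} = card {k \<in> evens. nat (k\<^sup>2) = n}"
      by (rule bij_betw_same_card)
    then show ?thesis by (simp add: fps_dilate4_nth m theta_all_def theta_even_def count_gf_nth)
  next
    case False
    have e: "{k \<in> evens. nat (k\<^sup>2) = n} = {}"
    proof -
      have "4 dvd n" if "nat (k\<^sup>2) = n" "even k" for k :: int
        using that by (auto elim!: evenE simp: power_mult_distrib nat_mult_distrib)
      then show ?thesis using False by (auto simp: evens_def)
    qed
    show ?thesis unfolding theta_even_def count_gf_nth e using False by (simp add: fps_dilate4_nth)
  qed
qed

lemma fps_support_mult:
  fixes f g :: "complex fps"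
  assumes "\<And>n. f $ n \<noteq> 0 \<Longrightarrow> n mod m = r mod m" "\<And>n. g $ n \<noteq> 0 \<Longrightarrow> n mod m = s mod m" "(f * g) $ n \<noteq> 0"
  shows "n mod m = (r + s) mod m"
proof -
  obtain i where i: "i \<in> {0..n}" "f $ i * g $ (n - i) \<noteq> 0"
    using assms(3) unfolding fps_mult_nth by (metis (no_types, lifting) sum.neutral)
  then have "i mod m = r mod m" "(n - i) mod m = s mod m" using assms(1,2) by auto
  moreover have "n = i + (n - i)" using i by simp
  ultimately show ?thesis by (metis mod_add_eq)
qed

lemma theta_odd_4_support: "(theta_odd ^ 4) $ n \<noteq> 0 \<Longrightarrow> n mod 8 = 4"
proof -
  have 1: "theta_odd $ n \<noteq> 0 \<Longrightarrow> n mod 8 = 1 mod 8" for n using theta_odd_support by simp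
  have 2: "(theta_odd * theta_odd) $ n \<noteq> 0 \<Longrightarrow> n mod 8 = 2 mod 8" for n
    using fps_support_mult[OF 1 1] by simp
  have "theta_odd ^ 4 = (theta_odd * theta_odd) * (theta_odd * theta_odd)" by (simp add: power4_eq_xxxx mult.assoc)
  then show "(theta_odd ^ 4) $ n \<noteq> 0 \<Longrightarrow> n mod 8 = 4" using fps_support_mult[OF 2 2] by simp
qed

definition quad_norm :: "int \<times> int \<times> int \<times> int \<Rightarrow> nat" where
  "quad_norm = (\<lambda>(a, b, c, d). nat (a\<^sup>2) + (nat (b\<^sup>2) + (nat (c\<^sup>2) + nat (d\<^sup>2))))"

lemma quad_norm_eq: "quad_norm (a, b, c, d) = n \<longleftrightarrow> a\<^sup>2 + b\<^sup>2 + c\<^sup>2 + d\<^sup>2 = int n"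
  unfolding quad_norm_def by (auto simp flip: nat_add_distrib)

lemma count_gf_quad: "count_gf (S \<times> S \<times> S \<times> S) quad_norm = count_gf S (\<lambda>k. nat (k\<^sup>2)) ^ 4" for S :: "int set"
proof -
  let ?N = "\<lambda>k::int. nat (k\<^sup>2)" and ?g = "count_gf S (\<lambda>k::int. nat (k\<^sup>2))"
  have f1: "finite {x \<in> S. ?N x = n}" for n by (rule finite_int_square_eq)
  have fin: "finite {x \<in> T. M x \<le> n}" if "\<And>n. finite {x \<in> T. M x = n}" for T and M :: "'x \<Rightarrow> nat" and n
  proof -
    have "{x\<in>T. M x \<le> n} = (\<Union>k\<le>n. {x\<in>T. M x = k})" by auto
    then show ?thesis using that by simp
  qed
  have ft: "finite {p \<in> S \<times> T. (case p of (x, y) \<Rightarrow> ?N x + M y) = n}" if "\<And>n. finite {x \<in> T. M x = n}" for T and M :: "'x \<Rightarrow> nat" and n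
    by (rule finite_subset[of _ "{x \<in> S. ?N x \<le> n} \<times> {x \<in> T. M x \<le> n}"]) (use fin[OF f1] fin[OF that] in auto)
  have "count_gf (S \<times> S) (\<lambda>(c, d). ?N c + ?N d) = ?g * ?g" by (rule count_gf_times[OF f1 f1])
  moreover have "count_gf (S \<times> (S \<times> S)) (\<lambda>(b, y). ?N b + (case y of (c, d) \<Rightarrow> ?N c + ?N d)) = ?g * count_gf (S \<times> S) (\<lambda>(c, d). ?N c + ?N d)"
    by (rule count_gf_times[OF f1 ft[OF f1]])
  moreover have "count_gf (S \<times> (S \<times> (S \<times> S))) (\<lambda>(a, z). ?N a + (case z of (b, y) \<Rightarrow> ?N b + (case y of (c, d) \<Rightarrow> ?N c + ?N d)))
     = ?g * count_gf (S \<times> (S \<times> S)) (\<lambda>(b, y). ?N b + (case y of (c, d) \<Rightarrow> ?N c + ?N d))"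
    by (rule count_gf_times[OF f1 ft[OF ft[OF f1]]])
  moreover have "quad_norm = (\<lambda>(a, z). ?N a + (case z of (b, y) \<Rightarrow> ?N b + (case y of (c, d) \<Rightarrow> ?N c + ?N d)))"
    by (auto simp: quad_norm_def fun_eq_iff)
  ultimately show ?thesis by (simp add: power4_eq_xxxx mult.assoc)
qed

text \<open>Half of the integral Hadamard matrix of order 4 is an isometry; it maps vectors of odd norm \<open>n\<close> to
  vectors with half-odd coordinates.\<close>

lemma jacobi_card:
  assumes "odd n"
  shows "card {p \<in> odds \<times> odds \<times> odds \<times> odds. quad_norm p = 4 * n} = 2 * card {p \<in> UNIV. quad_norm p = n}"
proof -
  define Q where "Q = {p \<in> odds \<times> odds \<times> odds \<times> odds. quad_norm p = 4 * n}"
  \<comment> \<open>For odd entries a sign change of one entry flips divisibility of the sum by 4,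
    so \<open>Q1\<close> is half of \<open>Q\<close>, which is the factor 2. The Hadamard matrix
    maps the vectors of norm \<open>n\<close> onto \<open>Q1\<close>.\<close>
  define Q1 where "Q1 = {(a, b, c, d). (a, b, c, d) \<in> Q \<and> 4 dvd a + b + c + d}"
  define Q2 where "Q2 = {(a, b, c, d). (a, b, c, d) \<in> Q \<and> \<not> 4 dvd a + b + c + d}"
  have finQ: "finite Q"
  proof (rule finite_subset)
    let ?K = "{k::int. k\<^sup>2 \<le> 4 * int n}"
    show "finite (?K \<times> ?K \<times> ?K \<times> ?K)" by (intro finite_cartesian_product finite_int_square_le)
    show "Q \<subseteq> ?K \<times> ?K \<times> ?K \<times> ?K"
    proof
      fix p assume p: "p \<in> Q"
      obtain a b c d where [simp]: "p = (a, b, c, d)" by (cases p) auto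
      have "a\<^sup>2 + b\<^sup>2 + c\<^sup>2 + d\<^sup>2 = 4 * int n" using p by (simp add: Q_def quad_norm_eq)
      moreover have "a\<^sup>2 \<ge> 0" "b\<^sup>2 \<ge> 0" "c\<^sup>2 \<ge> 0" "d\<^sup>2 \<ge> 0" by simp_all
      ultimately have "a\<^sup>2 \<le> 4 * int n" "b\<^sup>2 \<le> 4 * int n" "c\<^sup>2 \<le> 4 * int n" "d\<^sup>2 \<le> 4 * int n"
        by linarith+
      then show "p \<in> ?K \<times> ?K \<times> ?K \<times> ?K" by simp
    qed
  qed
  have "Q = Q1 \<union> Q2" "Q1 \<inter> Q2 = {}" by (auto simp: Q1_def Q2_def)
  then have "card Q = card Q1 + card Q2" using finQ by (metis card_Un_disjoint finite_Un)
  moreover have "bij_betw (\<lambda>(a, b, c, d). (- a, b, c, d)) Q1 Q2"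
  proof (rule bij_betw_byWitness[where f' = "\<lambda>(a, b, c, d). (- a, b, c, d)"])
    have flip: "4 dvd - a + b + c + d \<longleftrightarrow> \<not> 4 dvd a + b + c + d" if "odd a" "odd b" "odd c" "odd d" for a b c d :: int
      using that by presburger
    show "(\<lambda>(a, b, c, d). (- a, b, c, d)) ` Q1 \<subseteq> Q2" "(\<lambda>(a, b, c, d). (- a, b, c, d)) ` Q2 \<subseteq> Q1"
      using flip by (auto simp: Q1_def Q2_def Q_def odds_def quad_norm_eq)
  qed auto
  then have "card Q1 = card Q2" by (rule bij_betw_same_card)
  moreover have "bij_betw (\<lambda>(a, b, c, d). (a + b + c + d, a + b - c - d, a - b + c - d, a - b - c + d)) {p \<in> UNIV. quad_norm p = n} Q1"
  proof (rule bij_betw_byWitness[where f' = "\<lambda>(a, b, c, d). ((a + b + c + d) div 4, (a + b - c - d) div 4, (a - b + c - d) div 4, (a - b - c + d) div 4)"])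
    show "(\<lambda>(a, b, c, d). (a + b + c + d, a + b - c - d, a - b + c - d, a - b - c + d)) ` {p \<in> UNIV. quad_norm p = n} \<subseteq> Q1"
    proof (rule image_subsetI)
      fix p :: "int \<times> int \<times> int \<times> int"
      assume p: "p \<in> {p \<in> UNIV. quad_norm p = n}"
      obtain a b c d where [simp]: "p = (a, b, c, d)" by (cases p) auto
      have s: "a\<^sup>2 + b\<^sup>2 + c\<^sup>2 + d\<^sup>2 = int n" using p by (simp add: quad_norm_eq)
      then have "odd (a\<^sup>2 + b\<^sup>2 + c\<^sup>2 + d\<^sup>2)" using assms by simp
      then have o: "odd (a + b + c + d)" by simp
      have "(a + b + c + d)\<^sup>2 + (a + b - c - d)\<^sup>2 + (a - b + c - d)\<^sup>2 + (a - b - c + d)\<^sup>2 = 4 * (a\<^sup>2 + b\<^sup>2 + c\<^sup>2 + d\<^sup>2)"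
        by (simp add: power2_eq_square algebra_simps)
      then have "quad_norm (a + b + c + d, a + b - c - d, a - b + c - d, a - b - c + d) = 4 * n"
        by (simp add: quad_norm_eq s)
      then show "(\<lambda>(a, b, c, d). (a + b + c + d, a + b - c - d, a - b + c - d, a - b - c + d)) p \<in> Q1"
        using o by (simp add: Q1_def Q_def odds_def)
    qed
    have dv: "4 dvd a + b - c - d" "4 dvd a - b + c - d" "4 dvd a - b - c + d"
      if "odd a" "odd b" "odd c" "odd d" "4 dvd a + b + c + d" for a b c d :: int
      using that by presburger+
    have inv: "(let a' = (a + b + c + d) div 4; b' = (a + b - c - d) div 4; c' = (a - b + c - d) div 4; d' = (a - b - c + d) div 4
         in (a' + b' + c' + d', a' + b' - c' - d', a' - b' + c' - d', a' - b' - c' + d')) = (a, b, c, d)"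
      if "(a, b, c, d) \<in> Q1" for a b c d
    proof -
      have o: "odd a" "odd b" "odd c" "odd d" "4 dvd a + b + c + d" using that by (auto simp: Q1_def Q_def odds_def)
      obtain a' b' c' d' where *: "a + b + c + d = 4 * a'" "a + b - c - d = 4 * b'" "a - b + c - d = 4 * c'" "a - b - c + d = 4 * d'"
        using o(5) dv[OF o] by (auto elim!: dvdE)
      show ?thesis unfolding * Let_def using * by simp
    qed
    show "\<forall>p\<in>Q1. (\<lambda>(a, b, c, d). (a + b + c + d, a + b - c - d, a - b + c - d, a - b - c + d)) ((\<lambda>(a, b, c, d). ((a + b + c + d) div 4, (a + b - c - d) div 4, (a - b + c - d) div 4, (a - b - c + d) div 4)) p) = p"
      using inv by (auto simp: Let_def)
    show "(\<lambda>(a, b, c, d). ((a + b + c + d) div 4, (a + b - c - d) div 4, (a - b + c - d) div 4, (a - b - c + d) div 4)) ` Q1 \<subseteq> {p \<in> UNIV. quad_norm p = n}"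
    proof (rule image_subsetI)
      fix p assume "p \<in> Q1"
      obtain a b c d where [simp]: "p = (a, b, c, d)" by (cases p) auto
      have q: "(a, b, c, d) \<in> Q1" using \<open>p \<in> Q1\<close> by simp
      have o: "odd a" "odd b" "odd c" "odd d" "4 dvd a + b + c + d" using q by (auto simp: Q1_def Q_def odds_def)
      obtain a' b' c' d' where *: "a + b + c + d = 4 * a'" "a + b - c - d = 4 * b'" "a - b + c - d = 4 * c'" "a - b - c + d = 4 * d'"
        using o(5) dv[OF o] by (auto elim!: dvdE)
      have "(a + b + c + d)\<^sup>2 + (a + b - c - d)\<^sup>2 + (a - b + c - d)\<^sup>2 + (a - b - c + d)\<^sup>2 = 4 * (a\<^sup>2 + b\<^sup>2 + c\<^sup>2 + d\<^sup>2)"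
        by (simp add: power2_eq_square algebra_simps)
      also have "a\<^sup>2 + b\<^sup>2 + c\<^sup>2 + d\<^sup>2 = 4 * int n" using q by (simp add: Q1_def Q_def quad_norm_eq)
      finally have "a'\<^sup>2 + b'\<^sup>2 + c'\<^sup>2 + d'\<^sup>2 = int n" unfolding * by (simp add: power_mult_distrib)
      then have "quad_norm ((a + b + c + d) div 4, (a + b - c - d) div 4, (a - b + c - d) div 4, (a - b - c + d) div 4) = n"
        unfolding * by (simp add: quad_norm_eq)
      then show "(\<lambda>(a, b, c, d). ((a + b + c + d) div 4, (a + b - c - d) div 4, (a - b + c - d) div 4, (a - b - c + d) div 4)) p \<in> {p \<in> UNIV. quad_norm p = n}"
        by simp
    qed
  qed (auto simp: algebra_simps)
  then have "card {p \<in> UNIV. quad_norm p = n} = card Q1" by (rule bij_betw_same_card)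
  ultimately show ?thesis by (simp add: Q_def)
qed

text \<open>This is theta_2^4 at \<tau> itself: \<open>theta_odd ^ 4\<close> has only exponents 4
  modulo 8, so the dilation can be undone, although theta_2 has fractional exponents.\<close>

definition theta_half4 :: "complex fps" where
  "theta_half4 = Abs_fps (\<lambda>n. (theta_odd ^ 4) $ (4 * n))"

lemma theta_half4_dilate: "fps_dilate4 theta_half4 = theta_odd ^ 4"
proof (rule fps_ext)
  fix n :: nat
  have "4 dvd n" if "n mod 8 = 4" using that by presburger
  then show "fps_dilate4 theta_half4 $ n = (theta_odd ^ 4) $ n"
    using theta_odd_4_support[of n] by (auto simp: fps_dilate4_nth theta_half4_def)
qed

text \<open>\<open>theta_even - theta_odd\<close> is theta_3 twisted by -1, so the right side is
  twice the odd part of theta_3^4. Odd coefficients agree by \<open>jacobi_card\<close>; at even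
  ones both sides vanish.\<close>

lemma jacobi_identity: "theta_half4 = (theta_even + theta_odd) ^ 4 - (theta_even - theta_odd) ^ 4"
proof (rule fps_ext)
  fix n
  have R: "((theta_even + theta_odd) ^ 4 - (theta_even - theta_odd) ^ 4) $ n = (1 - (- 1) ^ n) * (theta_all ^ 4) $ n"
    unfolding theta_all_eq theta_diff_eq fps_twist_power[symmetric] by (simp add: algebra_simps)
  show "theta_half4 $ n = ((theta_even + theta_odd) ^ 4 - (theta_even - theta_odd) ^ 4) $ n"
  proof (cases "even n")
    case True
    then have "(4 * n) mod 8 \<noteq> 4" by presburger
    then have "(theta_odd ^ 4) $ (4 * n) = 0" using theta_odd_4_support[of "4 * n"] by blast
    then show ?thesis unfolding R using True by (simp add: theta_half4_def)
  next
    case False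
    have "theta_half4 $ n = of_nat (card {p \<in> odds \<times> odds \<times> odds \<times> odds. quad_norm p = 4 * n})"
      using count_gf_quad[of odds] by (simp add: theta_half4_def theta_odd_def count_gf_nth flip: count_gf_quad)
    moreover have "(theta_all ^ 4) $ n = of_nat (card {p \<in> UNIV. quad_norm p = n})"
      unfolding theta_all_def count_gf_quad[symmetric] count_gf_nth by simp
    ultimately show ?thesis unfolding R jacobi_card[OF False] using False by simp
  qed
qed

interpretation thetas: jacobi_thetas theta_even theta_odd "fps_dilate4 (theta_even - theta_odd)" theta_half4
proof
  show "fps_dilate4 (theta_even + theta_odd) = theta_even" unfolding theta_all_eq by (rule theta_even_dilate)
  show "fps_dilate4 theta_half4 = theta_odd ^ 4" by (rule theta_half4_dilate)
  show "theta_half4 = 8 * theta_even * theta_odd * (theta_even ^ 2 + theta_odd ^ 2)"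
    unfolding jacobi_identity by algebra
  show "n mod 4 = 0" if "theta_even $ n \<noteq> 0" for n
    using that unfolding theta_even_dilate[symmetric] fps_dilate4_nth by (simp split: if_splits)
  show "n mod 8 = 1" if "theta_odd $ n \<noteq> 0" for n using theta_odd_support[OF that] .
  show "fps_dilate4 (theta_even - theta_odd) $ n = (if n mod 8 = 0 then theta_even $ n else - theta_even $ n)" for n
  proof -
    have "even (n div 4) \<longleftrightarrow> n mod 8 = 0" if "4 dvd n" using that by presburger
    moreover have "n mod 8 \<noteq> 0" if "\<not> 4 dvd n" using that by presburger
    moreover have "fps_dilate4 (theta_even - theta_odd) $ n = (if 4 dvd n then (- 1) ^ (n div 4) * theta_all $ (n div 4) else 0)"
      unfolding theta_diff_eq fps_dilate4_nth by simp
    moreover have "theta_even $ n = (if 4 dvd n then theta_all $ (n div 4) else 0)"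
      unfolding theta_even_dilate[symmetric] fps_dilate4_nth ..
    ultimately show ?thesis by auto
  qed
qed simp

section \<open>Shell sizes of Z^3 and W_8\<close>

lemma sum_nat_square_eq:
  fixes f :: "'n::finite \<Rightarrow> int"
  shows "(\<Sum>i\<in>UNIV. nat ((f i)\<^sup>2)) = n \<longleftrightarrow> (\<Sum>i\<in>UNIV. (f i)\<^sup>2) = int n"
proof -
  have "int (\<Sum>i\<in>UNIV. nat ((f i)\<^sup>2)) = (\<Sum>i\<in>UNIV. (f i)\<^sup>2)" by simp
  then show ?thesis by (metis of_nat_eq_iff)
qed

lemma theta_all_power_nth:
  "fps_nth (theta_all ^ CARD('n::finite)) n = of_nat (card {f :: 'n \<Rightarrow> int. (\<Sum>i\<in>UNIV. (f i)\<^sup>2) = int n})"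
  using count_gf_functions[of UNIV "\<lambda>k::int. nat (k\<^sup>2)", where ?'n = 'n] finite_int_square_eq[of UNIV]
  by (simp add: theta_all_def count_gf_nth sum_nat_square_eq flip: count_gf_functions)

lemma theta_odd_power_nth:
  "fps_nth (theta_odd ^ CARD('n::finite)) n = of_nat (card {f :: 'n \<Rightarrow> int. (\<forall>i. odd (f i)) \<and> (\<Sum>i\<in>UNIV. (f i)\<^sup>2) = int n})"
proof -
  have "theta_odd ^ CARD('n) = count_gf {f :: 'n \<Rightarrow> int. \<forall>i. f i \<in> odds} (\<lambda>f. \<Sum>i\<in>UNIV. nat ((f i)\<^sup>2))"
    unfolding theta_odd_def by (rule count_gf_functions[symmetric]) (rule finite_int_square_eq)
  then show ?thesis by (simp add: count_gf_nth odds_def sum_nat_square_eq)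
qed

lemma finite_int_functions: "finite {f :: 'n::finite \<Rightarrow> int. (\<Sum>i\<in>UNIV. (f i)\<^sup>2) = c}"
proof (rule finite_subset)
  show "finite (PiE (UNIV :: 'n set) (\<lambda>_. {k::int. k\<^sup>2 \<le> c}))"
    by (intro finite_PiE) (auto intro: finite_int_square_le)
  show "{f :: 'n \<Rightarrow> int. (\<Sum>i\<in>UNIV. (f i)\<^sup>2) = c} \<subseteq> PiE UNIV (\<lambda>_. {k. k\<^sup>2 \<le> c})"
    by (auto simp: PiE_UNIV_domain intro!: member_le_sum)
qed

definition Z3_shell :: "nat \<Rightarrow> (real^3) set" where
  "Z3_shell k = {u \<in> Zn_lattice. inner u u = real k}"

definition W8_shell :: "nat \<Rightarrow> (real^8) set" where
  "W8_shell k = {w \<in> W8. inner w w = real k}"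

lemma Z3_shell_card: "of_nat (card (Z3_shell k)) = fps_nth (theta_all ^ 3) k" and finite_Z3_shell: "finite (Z3_shell k)"
proof -
  let ?F = "{f :: 3 \<Rightarrow> int. (\<Sum>i\<in>UNIV. (f i)\<^sup>2) = int k}"
  let ?h = "\<lambda>f :: 3 \<Rightarrow> int. (\<chi> i. of_int (f i)) :: real^3"
  have nrm: "inner (?h f) (?h f) = of_int (\<Sum>i\<in>UNIV. (f i)\<^sup>2)" for f
    by (simp add: inner_vec_def power2_eq_square)
  have inj: "inj_on ?h ?F" by (auto simp: inj_on_def vec_eq_iff)
  have img: "Z3_shell k = ?h ` ?F"
  proof (intro set_eqI iffI)
    fix u assume u: "u \<in> Z3_shell k"
    then have "\<forall>i. \<exists>a. u $ i = of_int a" by (auto simp: Z3_shell_def Zn_lattice_def elim!: Ints_cases)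
    then obtain f where f: "\<And>i. u $ i = of_int (f i)" by metis
    then have uf: "u = ?h f" by (simp add: vec_eq_iff)
    have "real_of_int (\<Sum>i\<in>UNIV. (f i)\<^sup>2) = of_int (int k)" using u unfolding uf nrm[symmetric] by (simp add: Z3_shell_def)
    then have "f \<in> ?F" by (simp only: of_int_eq_iff mem_Collect_eq)
    then show "u \<in> ?h ` ?F" using uf by blast
  next
    fix u assume "u \<in> ?h ` ?F"
    then obtain f where f: "f \<in> ?F" "u = ?h f" by blast
    then have "inner u u = of_int (int k)" using nrm[of f] by simp
    then show "u \<in> Z3_shell k" using f(2) by (simp add: Z3_shell_def Zn_lattice_def)
  qed
  show "of_nat (card (Z3_shell k)) = fps_nth (theta_all ^ 3) k"
    unfolding img card_image[OF inj] using theta_all_power_nth[where ?'n = 3, of k] by simp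
  show "finite (Z3_shell k)" unfolding img by (intro finite_imageI finite_int_functions)
qed

text \<open>Doubling turns \<open>W8\<close> into integer vectors with all entries even or all odd
  and sum divisible by 4. Half of the odd vectors qualify, by a sign change of one entry. The even
  ones, halved again, are the integer vectors of even norm, which theta_3^8 + theta_4^8 counts
  twice.\<close>

lemma W8_shell_card:
  "2 * of_nat (card (W8_shell k)) = fps_nth (theta_half4 ^ 2 + (theta_even + theta_odd) ^ 8 + (theta_even - theta_odd) ^ 8) k"
  and finite_W8_shell: "finite (W8_shell k)"
proof -
  let ?N = "\<lambda>f :: 8 \<Rightarrow> int. \<Sum>i\<in>UNIV. (f i)\<^sup>2"
  let ?h = "\<lambda>f :: 8 \<Rightarrow> int. (\<chi> i. of_int (f i) / 2) :: real^8"
  define Ev where "Ev = {f :: 8 \<Rightarrow> int. (\<forall>i. even (f i)) \<and> 4 dvd (\<Sum>i\<in>UNIV. f i) \<and> ?N f = 4 * int k}"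
  define Od where "Od = {f :: 8 \<Rightarrow> int. (\<forall>i. odd (f i)) \<and> 4 dvd (\<Sum>i\<in>UNIV. f i) \<and> ?N f = 4 * int k}"
  define Od' where "Od' = {f :: 8 \<Rightarrow> int. (\<forall>i. odd (f i)) \<and> \<not> 4 dvd (\<Sum>i\<in>UNIV. f i) \<and> ?N f = 4 * int k}"
  have fin: "finite Ev" "finite Od" "finite Od'"
    using finite_int_functions[where ?'n = 8, of "4 * int k"] by (auto simp: Ev_def Od_def Od'_def intro: rev_finite_subset)
  have nrm: "inner (?h f) (?h f) = of_int (?N f) / 4" for f
    by (simp add: inner_vec_def power2_eq_square sum_divide_distrib)
  have h2: "(of_int n / 2 :: real) \<in> \<int> \<longleftrightarrow> 2 dvd n" "(of_int n / 4 :: real) \<in> \<int> \<longleftrightarrow> 4 dvd n" for n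
    using of_int_div_of_int_in_Ints_iff[of n 2, where ?'a = real] of_int_div_of_int_in_Ints_iff[of n 4, where ?'a = real] by auto
  have hW: "?h f \<in> W8 \<longleftrightarrow> (\<forall>i. 2 dvd f i - f 1) \<and> 4 dvd (\<Sum>i\<in>UNIV. f i)" for f
  proof -
    have "?h f $ i - ?h f $ 1 = of_int (f i - f 1) / 2" for i by (simp add: diff_divide_distrib)
    moreover have "(\<Sum>i\<in>UNIV. ?h f $ i) / 2 = of_int (\<Sum>i\<in>UNIV. f i) / 4" by (simp add: sum_divide_distrib)
    ultimately show ?thesis unfolding W8_def mem_Collect_eq by (simp only: h2) simp
  qed
  have par: "(\<forall>i. 2 dvd f i - f 1) \<longleftrightarrow> (\<forall>i. even (f i)) \<or> (\<forall>i. odd (f i))" for f :: "8 \<Rightarrow> int"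
    by (cases "even (f 1)") (auto simp: even_diff)
  have img: "W8_shell k = ?h ` (Ev \<union> Od)"
  proof (intro set_eqI iffI)
    fix w assume w: "w \<in> W8_shell k"
    then have "\<forall>i. \<exists>a. 2 * w $ i = of_int a" by (auto simp: W8_shell_def W8_def elim!: Ints_cases)
    then obtain f where f: "\<And>i. 2 * w $ i = of_int (f i)" by metis
    have wf: "w = ?h f" by (simp add: vec_eq_iff f[symmetric])
    have "real_of_int (?N f) = of_int (4 * int k)" using w nrm[of f] unfolding wf[symmetric] by (simp add: W8_shell_def)
    then have N: "?N f = 4 * int k" by (simp only: of_int_eq_iff)
    have "?h f \<in> W8" using w unfolding wf[symmetric] by (simp add: W8_shell_def)
    then have "f \<in> Ev \<union> Od" using N unfolding hW par by (auto simp: Ev_def Od_def)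
    then show "w \<in> ?h ` (Ev \<union> Od)" using wf by blast
  next
    fix w assume "w \<in> ?h ` (Ev \<union> Od)"
    then obtain f where f: "f \<in> Ev \<union> Od" "w = ?h f" by blast
    then have "?h f \<in> W8" unfolding hW par by (auto simp: Ev_def Od_def)
    moreover have "?N f = 4 * int k" using f(1) by (auto simp: Ev_def Od_def)
    then have "inner w w = real k" unfolding f(2) nrm by simp
    ultimately show "w \<in> W8_shell k" using f(2) by (simp add: W8_shell_def)
  qed
  have inj: "inj_on ?h (Ev \<union> Od)" by (auto simp: inj_on_def vec_eq_iff)
  show "finite (W8_shell k)" unfolding img using fin by simp
  have "Ev \<inter> Od = {}" by (auto simp: Ev_def Od_def)
  then have card: "card (W8_shell k) = card Ev + card Od"
    unfolding img card_image[OF inj] using fin by (simp add: card_Un_disjoint)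
  have cOd: "2 * card Od = card {f :: 8 \<Rightarrow> int. (\<forall>i. odd (f i)) \<and> ?N f = 4 * int k}"
  proof -
    define g where "g f = f(1 := - f 1)" for f :: "8 \<Rightarrow> int"
    have gg: "g (g f) = f" and og: "even (g f i) \<longleftrightarrow> even (f i)" for f i
      by (auto simp: g_def)
    have Ng: "?N (g f) = ?N f" for f by (rule sum.cong) (auto simp: g_def)
    have Sg: "(\<Sum>i\<in>UNIV. g f i) = (\<Sum>i\<in>UNIV. f i) - 2 * f 1" for f
    proof -
      have "(\<Sum>i\<in>UNIV. g f i) = (\<Sum>i\<in>UNIV. f i - (if i = 1 then 2 * f 1 else 0))" by (rule sum.cong) (auto simp: g_def)
      then show ?thesis by (simp add: sum_subtractf)
    qed
    have ev: "even (\<Sum>i\<in>UNIV. f i)" if "\<forall>i. odd (f i)" for f :: "8 \<Rightarrow> int"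
    proof -
      have "even (\<Sum>i\<in>UNIV. f i - 1)" using that by (intro dvd_sum) auto
      then show ?thesis by (simp add: sum_subtractf)
    qed
    have flip: "4 dvd (\<Sum>i\<in>UNIV. g f i) \<longleftrightarrow> \<not> 4 dvd (\<Sum>i\<in>UNIV. f i)" if "\<forall>i. odd (f i)" for f
    proof -
      have "odd (f 1)" using that by blast
      then show ?thesis unfolding Sg using ev[OF that] by presburger
    qed
    have "bij_betw g Od Od'"
      by (rule bij_betw_byWitness[where f' = g]) (auto simp: Od_def Od'_def Ng flip gg og)
    then have "card Od = card Od'" by (rule bij_betw_same_card)
    moreover have "{f :: 8 \<Rightarrow> int. (\<forall>i. odd (f i)) \<and> ?N f = 4 * int k} = Od \<union> Od'" "Od \<inter> Od' = {}"
      by (auto simp: Od_def Od'_def)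
    ultimately show ?thesis using fin by (simp add: card_Un_disjoint)
  qed
  have tOd: "fps_nth (theta_half4 ^ 2) k = of_nat (2 * card Od)"
  proof -
    have "fps_dilate4 (theta_half4 ^ 2) = theta_odd ^ 8"
      unfolding fps_dilate4_power theta_half4_dilate by (simp flip: power_mult)
    then have "fps_nth (theta_half4 ^ 2) k = fps_nth (theta_odd ^ 8) (4 * k)"
      using fps_dilate4_nth[of "theta_half4 ^ 2" "4 * k"] by simp
    also have "\<dots> = of_nat (card {f :: 8 \<Rightarrow> int. (\<forall>i. odd (f i)) \<and> ?N f = 4 * int k})"
      using theta_odd_power_nth[where ?'n = 8, of "4 * k"] by simp
    finally show ?thesis unfolding cOd .
  qed
  have cEv: "card Ev = (if even k then card {f :: 8 \<Rightarrow> int. ?N f = int k} else 0)"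
  proof -
    have evN: "even (?N f) \<longleftrightarrow> even (\<Sum>i\<in>UNIV. f i)" for f
    proof -
      have "even (\<Sum>i\<in>UNIV. (f i)\<^sup>2 - f i)" by (intro dvd_sum) auto
      then show ?thesis by (simp add: sum_subtractf)
    qed
    have "bij_betw (\<lambda>f i. 2 * f i) {f :: 8 \<Rightarrow> int. ?N f = int k \<and> even k} Ev"
    proof (rule bij_betw_byWitness[where f' = "\<lambda>f i. f i div 2"])
      show "(\<lambda>f i. 2 * f i) ` {f :: 8 \<Rightarrow> int. ?N f = int k \<and> even k} \<subseteq> Ev"
      proof (rule image_subsetI)
        fix f :: "8 \<Rightarrow> int" assume f: "f \<in> {f. ?N f = int k \<and> even k}"
        then have "even (\<Sum>i\<in>UNIV. f i)" using evN[of f] by simp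
        then have "4 dvd 2 * (\<Sum>i\<in>UNIV. f i)" by presburger
        moreover have "?N (\<lambda>i. 2 * f i) = 4 * int k" using f by (simp add: power_mult_distrib flip: sum_distrib_left)
        ultimately show "(\<lambda>i. 2 * f i) \<in> Ev" by (simp add: Ev_def sum_distrib_left)
      qed
      show "(\<lambda>f i. f i div 2) ` Ev \<subseteq> {f. ?N f = int k \<and> even k}"
      proof (rule image_subsetI)
        fix f :: "8 \<Rightarrow> int" assume f: "f \<in> Ev"
        define g where "g i = f i div 2" for i
        have fg: "f i = 2 * g i" for i using f by (simp add: g_def Ev_def)
        have "4 * ?N g = 4 * int k" using f by (simp add: Ev_def fg power_mult_distrib flip: sum_distrib_left)
        then have N: "?N g = int k" by simp
        have "4 dvd 2 * (\<Sum>i\<in>UNIV. g i)" using f by (simp add: Ev_def fg sum_distrib_left)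
        then have "even (\<Sum>i\<in>UNIV. g i)" by presburger
        then have "even k" using evN[of g] N by simp
        then show "(\<lambda>i. f i div 2) \<in> {f. ?N f = int k \<and> even k}" using N unfolding g_def by simp
      qed
    qed (auto simp: Ev_def)
    then have "card {f :: 8 \<Rightarrow> int. ?N f = int k \<and> even k} = card Ev" by (rule bij_betw_same_card)
    then show ?thesis by (cases "even k") auto
  qed
  have tEv: "fps_nth ((theta_even + theta_odd) ^ 8 + (theta_even - theta_odd) ^ 8) k = of_nat (2 * card Ev)"
    unfolding theta_all_eq theta_diff_eq fps_twist_power[symmetric] cEv
    using theta_all_power_nth[where ?'n = 8, of k] by simp
  show "2 * of_nat (card (W8_shell k)) = fps_nth (theta_half4 ^ 2 + (theta_even + theta_odd) ^ 8 + (theta_even - theta_odd) ^ 8) k"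
    using tEv tOd by (simp add: card add.assoc distrib_left)
qed

lemma W8_norm_nat: "w \<in> W8 \<Longrightarrow> \<exists>k::nat. inner w w = real k"
proof -
  assume w: "w \<in> W8"
  then have "\<forall>i. \<exists>a. 2 * w $ i = of_int a" by (auto simp: W8_def elim!: Ints_cases)
  then obtain f where f: "\<And>i. 2 * w $ i = of_int (f i)" by metis
  have par: "even (f i - f 1)" for i
  proof -
    have "w $ i - w $ 1 = of_int (f i - f 1) / of_int 2" using f[of i] f[of 1] by simp
    moreover have "w $ i - w $ 1 \<in> \<int>" using w by (auto simp: W8_def)
    ultimately have "of_int (f i - f 1) / of_int 2 \<in> (\<int> :: real set)" by metis
    then show ?thesis unfolding of_int_div_of_int_in_Ints_iff by simp
  qed
  have "4 dvd (\<Sum>i\<in>UNIV. (f i)\<^sup>2)"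
  proof (cases "even (f 1)")
    case True
    then have "even (f i)" for i using par[of i] by simp
    then have "4 dvd (f i)\<^sup>2" for i using dvd_power_same[of 2 "f i" 2] by simp
    then show ?thesis by (intro dvd_sum) auto
  next
    case False
    then have "odd (f i)" for i using par[of i] by simp
    then have "(f i)\<^sup>2 mod 8 = 1" for i by (rule odd_square_mod_8)
    moreover have "4 dvd y - 1" if "y mod 8 = 1" for y :: int using that by presburger
    ultimately have "4 dvd (f i)\<^sup>2 - 1" for i by blast
    then have "4 dvd (\<Sum>i\<in>UNIV. (f i)\<^sup>2 - 1)" by (intro dvd_sum) auto
    then show ?thesis by (simp add: sum_subtractf) presburger
  qed
  then obtain n where n: "(\<Sum>i\<in>UNIV. (f i)\<^sup>2) = 4 * n" by blast
  have "4 * inner w w = (\<Sum>i\<in>UNIV. (2 * w $ i)\<^sup>2)"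
    by (simp add: inner_vec_def power2_eq_square sum_distrib_left)
  also have "\<dots> = of_int (\<Sum>i\<in>UNIV. (f i)\<^sup>2)" by (simp add: f)
  finally have "inner w w = of_int n" unfolding n by simp
  moreover have "n \<ge> 0" using n sum_nonneg[of UNIV "\<lambda>i. (f i)\<^sup>2"] by simp
  ultimately show ?thesis by (intro exI[of _ "nat n"]) simp
qed

lemma Zn_norm_nat: "u \<in> Zn_lattice \<Longrightarrow> \<exists>k::nat. inner u u = real k"
proof -
  assume "u \<in> Zn_lattice"
  then have "inner u u \<in> \<int>" unfolding inner_vec_def by (intro Ints_sum) (auto simp: Zn_lattice_def)
  then obtain n where "inner u u = of_int n" by (rule Ints_cases)
  moreover have "inner u u \<ge> 0" by simp
  ultimately show ?thesis by (intro exI[of _ "nat n"]) simp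
qed

lemma shell_Z3_W8_decomp: "shell Z3_W8 (real m) = (\<Union>k\<in>{0..m}. Z3_shell k \<times> W8_shell (m - k))"
proof (intro set_eqI iffI)
  fix x assume x: "x \<in> shell Z3_W8 (real m)"
  obtain u w where [simp]: "x = (u, w)" by (cases x)
  have uw: "u \<in> Zn_lattice" "w \<in> W8" "inner u u + inner w w = real m"
    using x by (auto simp: shell_def Z3_W8_def inner_prod_def)
  obtain k l where kl: "inner u u = real k" "inner w w = real l" using Zn_norm_nat[OF uw(1)] W8_norm_nat[OF uw(2)] by blast
  then have "m = k + l" using uw(3) by linarith
  then show "x \<in> (\<Union>k\<in>{0..m}. Z3_shell k \<times> W8_shell (m - k))"
    using uw kl by (auto simp: Z3_shell_def W8_shell_def intro!: bexI[of _ k])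
next
  fix x assume "x \<in> (\<Union>k\<in>{0..m}. Z3_shell k \<times> W8_shell (m - k))"
  then show "x \<in> shell Z3_W8 (real m)"
    by (auto simp: shell_def Z3_W8_def inner_prod_def Z3_shell_def W8_shell_def of_nat_diff)
qed

text \<open>\<open>fps_euler\<close> multiplies a coefficient by its norm, so the two products in
  the bracket add up \<open>inner u u\<close> and \<open>inner w w\<close> over the shell; the
  factor 2 comes from the doubled series of \<open>W8\<close>.\<close>

lemma sum_shell_Z3_W8:
  "2 * complex_of_real (\<Sum>(u, w)\<in>shell Z3_W8 (real m). 8 * inner u u - 3 * inner w w) = fps_nth thetas.bracket m"
proof -
  let ?E = "theta_half4 ^ 2 + (theta_even + theta_odd) ^ 8 + (theta_even - theta_odd) ^ 8"
  have "(\<Sum>(u, w)\<in>shell Z3_W8 (real m). 8 * inner u u - 3 * inner w w) =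
     (\<Sum>k\<in>{0..m}. \<Sum>(u, w)\<in>Z3_shell k \<times> W8_shell (m - k). 8 * inner u u - 3 * inner w w)"
    unfolding shell_Z3_W8_decomp
    by (rule sum.UNION_disjoint) (auto simp: finite_Z3_shell finite_W8_shell, auto simp: Z3_shell_def)
  also have "\<dots> = (\<Sum>k\<in>{0..m}. real (card (Z3_shell k)) * real (card (W8_shell (m - k))) * (8 * real k - 3 * real (m - k)))"
  proof (rule sum.cong[OF refl])
    fix k assume "k \<in> {0..m}"
    have "(\<Sum>(u, w)\<in>Z3_shell k \<times> W8_shell (m - k). 8 * inner u u - 3 * inner w w) = (\<Sum>x\<in>Z3_shell k \<times> W8_shell (m - k). 8 * real k - 3 * real (m - k))"
      by (rule sum.cong) (auto simp: Z3_shell_def W8_shell_def)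
    then show "(\<Sum>(u, w)\<in>Z3_shell k \<times> W8_shell (m - k). 8 * inner u u - 3 * inner w w) = real (card (Z3_shell k)) * real (card (W8_shell (m - k))) * (8 * real k - 3 * real (m - k))"
      by (simp add: card_cartesian_product)
  qed
  finally have S: "(\<Sum>(u, w)\<in>shell Z3_W8 (real m). 8 * inner u u - 3 * inner w w) = \<dots>" .
  have num: "fps_nth (numeral c * f) n = numeral c * fps_nth f n" for c n and f :: "complex fps"
    unfolding numeral_fps_const by simp
  have "fps_nth thetas.bracket m = 8 * fps_nth (fps_euler (theta_all ^ 3) * ?E) m - 3 * fps_nth (theta_all ^ 3 * fps_euler ?E) m"
    unfolding thetas.bracket_def theta_all_eq by (simp only: mult.assoc fps_sub_nth num)
  also have "\<dots> = (\<Sum>k=0..m. 8 * (of_nat k * fps_nth (theta_all ^ 3) k * fps_nth ?E (m - k)) - 3 * (fps_nth (theta_all ^ 3) k * (of_nat (m - k) * fps_nth ?E (m - k))))"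
    unfolding fps_mult_nth[of _ ?E] fps_mult_nth[of _ "fps_euler ?E"] fps_euler_nth sum_distrib_left sum_subtractf ..
  also have "\<dots> = (\<Sum>k=0..m. 2 * (of_nat (card (Z3_shell k)) * of_nat (card (W8_shell (m - k))) * (8 * of_nat k - 3 * of_nat (m - k))))"
    unfolding W8_shell_card[symmetric] Z3_shell_card[symmetric] by (rule sum.cong) (simp_all add: algebra_simps)
  also have "\<dots> = 2 * complex_of_real (\<Sum>(u, w)\<in>shell Z3_W8 (real m). 8 * inner u u - 3 * inner w w)"
    unfolding S by (simp add: sum_distrib_left)
  finally show ?thesis ..
qed

theorem Z3_W8_shell_design: "spherical_3_design (shell Z3_W8 (4 ^ a * (8 * real b + 7)))"
proof -
  define m where "m = 4 ^ a * (8 * b + 7)"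
  have m: "4 ^ a * (8 * real b + 7) = real m" by (simp add: m_def)
  have br: "fps_nth thetas.bracket m = 0"
    unfolding m_def
  proof (induction a)
    case 0
    have "(8 * b + 7) mod 8 = 7" by presburger
    then show ?case using thetas.bracket_7_mod_8 by simp
  next
    case (Suc a)
    then show ?case using thetas.bracket_4[of "4 ^ a * (8 * b + 7)"] by (simp add: mult.assoc)
  qed
  have "complex_of_real (\<Sum>(u, w)\<in>shell Z3_W8 (real m). 8 * inner u u - 3 * inner w w) = 0"
    using sum_shell_Z3_W8[of m] br by simp
  then have bal: "(\<Sum>(u, w)\<in>shell Z3_W8 (real m). 8 * inner u u - 3 * inner w w) = 0"
    by (simp only: of_real_eq_0_iff)
  have fin: "finite (shell Z3_W8 (real m))"
    unfolding shell_Z3_W8_decomp by (simp add: finite_Z3_shell finite_W8_shell)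
  have "m \<ge> 1" unfolding m_def by simp
  \<comment> \<open>A point on the shell: the parity of \<open>m\<close> goes into Z^3 and leaves an
    even norm. Four squares with even sum have roots with even sum, so these roots form a vector of
    \<open>W8\<close>.\<close>
  define e where "e = m mod 2"
  have "even (m - e)" "e \<le> 1" "e \<le> m" unfolding e_def using \<open>m \<ge> 1\<close> by (auto simp: minus_mod_eq_mult_div)
  obtain p q r s :: int where pq: "int (m - e) = p\<^sup>2 + q\<^sup>2 + r\<^sup>2 + s\<^sup>2"
    using lagrange_four_squares[of "m - e"] by (auto simp: four_squares_def)
  define u :: "real^3" where "u = axis 1 (real e)"
  define w :: "real^8" where "w = axis 1 (of_int p) + axis 2 (of_int q) + axis 3 (of_int r) + axis 4 (of_int s)"
  have "u \<in> Zn_lattice" by (auto simp: u_def Zn_lattice_def axis_def)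
  moreover have "inner u u = real e"
  proof -
    have "e = 0 \<or> e = 1" using \<open>e \<le> 1\<close> by auto
    then show ?thesis by (auto simp: u_def inner_axis_axis)
  qed
  moreover have "inner w w = real (m - e)"
  proof -
    have "inner w w = (of_int p)\<^sup>2 + (of_int q)\<^sup>2 + (of_int r)\<^sup>2 + (of_int s)\<^sup>2"
      unfolding w_def by (simp add: inner_add_left inner_add_right inner_axis_axis power2_eq_square)
    also have "\<dots> = of_int (p\<^sup>2 + q\<^sup>2 + r\<^sup>2 + s\<^sup>2)" by simp
    finally show ?thesis unfolding pq[symmetric] by simp
  qed
  moreover have "w \<in> W8"
  proof -
    have int: "w $ i \<in> \<int>" for i unfolding w_def by (auto simp: axis_def)
    have ax: "(\<Sum>i\<in>UNIV. axis j x $ i) = x" for j :: 8 and x :: real by (simp add: axis_def)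
    have "(\<Sum>i\<in>UNIV. w $ i) = of_int (p + q + r + s)"
      unfolding w_def by (simp add: sum.distrib ax)
    moreover have "even (p + q + r + s)"
    proof -
      have "even (p\<^sup>2 + q\<^sup>2 + r\<^sup>2 + s\<^sup>2)" unfolding pq[symmetric] using \<open>even (m - e)\<close> by simp
      then show ?thesis by simp
    qed
    then obtain t where "p + q + r + s = 2 * t" by (rule evenE)
    ultimately have "(\<Sum>i\<in>UNIV. w $ i) / 2 = of_int t" by simp
    then have "(\<Sum>i\<in>UNIV. w $ i) / 2 \<in> \<int>" by simp
    moreover have "2 * w $ i \<in> \<int>" "w $ i - w $ 1 \<in> \<int>" for i using int by auto
    ultimately show ?thesis unfolding W8_def by blast
  qed
  ultimately have "(u, w) \<in> shell Z3_W8 (real m)"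
    using \<open>e \<le> m\<close> by (simp add: shell_def Z3_W8_def inner_prod_def of_nat_diff)
  then have "shell Z3_W8 (real m) \<noteq> {}" by blast
  then show ?thesis unfolding m by (rule Z3_W8_design_criterion[OF fin _ bal])
qed

section \<open>Theta series of selfdual lattices\<close>

lemma cis_2pi_eq_1_iff: "cis (2 * pi * x) = 1 \<longleftrightarrow> x \<in> \<int>"
proof
  assume "cis (2 * pi * x) = 1"
  then have "cos (2 * pi * x) = 1" by (simp add: complex_eq_iff)
  then obtain n :: int where "2 * pi * x = of_int n * 2 * pi" unfolding cos_one_2pi_int by blast
  then have "x = of_int n" by simp
  then show "x \<in> \<int>" by simp
qed (rule cis_multiple_2pi)

section \<open>Poisson summation on a selfdual lattice with an orthogonal frame\<close>

locale orthogonal_frame =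
  fixes e :: "'n::finite \<Rightarrow> real^'n" and d :: "'n \<Rightarrow> int"
  assumes orth: "\<And>i j. i \<noteq> j \<Longrightarrow> inner (e i) (e j) = 0"
    and nrm: "\<And>i. inner (e i) (e i) = of_int (d i)" and dpos: "\<And>i. d i > 0"
begin

text \<open>The vector whose inner product with \<open>e i\<close> is \<open>k i\<close>. These
  points form the dual of the lattice spanned by the frame; they include \<open>L\<close> and the
  cosets considered below, and membership in a coset depends on \<open>k\<close> modulo
  \<open>d\<close> only.\<close>

definition point :: "('n \<Rightarrow> int) \<Rightarrow> real^'n" where
  "point k = (\<Sum>i\<in>UNIV. (of_int (k i) / of_int (d i)) *\<^sub>R e i)"

lemma inner_sum_frame: "inner (\<Sum>i\<in>UNIV. c i *\<^sub>R e i) (e j) = c j * of_int (d j)"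
proof -
  have "inner (\<Sum>i\<in>UNIV. c i *\<^sub>R e i) (e j) = (\<Sum>i\<in>UNIV. if i = j then c j * of_int (d j) else 0)"
    unfolding inner_sum_left by (rule sum.cong) (auto simp: orth nrm)
  then show ?thesis by simp
qed

lemma inner_point [simp]: "inner (point k) (e j) = of_int (k j)"
  unfolding point_def inner_sum_frame using dpos[of j] by simp

lemma frame_expand: "x = (\<Sum>i\<in>UNIV. (inner x (e i) / of_int (d i)) *\<^sub>R e i)"
proof -
  have ne: "e i \<noteq> 0" for i using nrm[of i] dpos[of i] by auto
  have inj: "inj e"
  proof (rule injI, rule ccontr)
    fix i j assume "e i = e j" "i \<noteq> j"
    then show False using orth[of i j] ne[of i] by simp
  qed
  have "pairwise orthogonal (range e)"
    unfolding pairwise_def orthogonal_def using orth by (metis imageE)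
  then have ind: "independent (range e)" using ne by (intro pairwise_orthogonal_independent) auto
  have "card (range e) = DIM(real^'n)" using inj by (simp add: card_image)
  then have span: "UNIV \<subseteq> span (range e)"
    using ind by (intro card_ge_dim_independent) auto
  define y where "y = x - (\<Sum>i\<in>UNIV. (inner x (e i) / of_int (d i)) *\<^sub>R e i)"
  have "inner y (e j) = 0" for j
    unfolding y_def inner_diff_left inner_sum_frame using dpos[of j] by simp
  then have "orthogonal y z" if "z \<in> range e" for z using that by (auto simp: orthogonal_def)
  then have "orthogonal y y" using span by (intro orthogonal_to_span[of y "range e"]) auto
  then have "y = 0" by (simp add: orthogonal_self)
  then show ?thesis by (simp add: y_def)
qed

lemma inner_frame: "inner x y = (\<Sum>i\<in>UNIV. inner x (e i) * inner y (e i) / of_int (d i))"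
proof -
  have "inner x y = inner (\<Sum>i\<in>UNIV. (inner x (e i) / of_int (d i)) *\<^sub>R e i) y" using frame_expand[of x] by simp
  then show ?thesis by (simp add: inner_sum_left inner_commute[of y])
qed

lemma point_eqI: "(\<And>i. inner x (e i) = of_int (k i)) \<Longrightarrow> point k = x"
  unfolding point_def using frame_expand[of x] by simp

lemma inj_point: "inj point"
proof (rule injI, rule ext)
  fix k l i assume "point k = point l"
  then show "k i = l i" using inner_point[of k i] inner_point[of l i] by simp
qed

lemma point_add: "point (\<lambda>i. k i + l i) = point k + point l"
  by (rule point_eqI) (simp add: inner_add_left)

lemma frac_pairing_eq: "frac_pairing d l k = inner (point l) (point k)"
  unfolding inner_frame[of "point l" "point k"] frac_pairing_def by simp

lemma point_mod: "point (\<lambda>i. k i mod d i) = point k - (\<Sum>i\<in>UNIV. of_int (k i div d i) *\<^sub>R e i)"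
proof (rule point_eqI)
  fix j
  have "k j mod d j = k j - (k j div d j) * d j" by (simp add: minus_div_mult_eq_mod)
  then show "inner (point k - (\<Sum>i\<in>UNIV. of_int (k i div d i) *\<^sub>R e i)) (e j) = of_int (k j mod d j)"
    by (simp add: inner_diff_left inner_sum_frame)
qed

definition G :: "real \<Rightarrow> real^'n \<Rightarrow> real" where
  "G t x = exp (- (pi * t * inner x x))"

lemma prod_gaussian: "(\<Prod>i\<in>UNIV. gaussian (d i) t (k i)) = of_real (G t (point k))"
proof -
  have "(\<Prod>i\<in>UNIV. gaussian (d i) t (k i)) = of_real (\<Prod>i\<in>UNIV. exp (- (pi * t * (of_int (k i))\<^sup>2 / of_int (d i))))"
    by (simp add: gaussian_def)
  also have "(\<Prod>i\<in>UNIV. exp (- (pi * t * (of_int (k i))\<^sup>2 / of_int (d i)))) = exp (\<Sum>i\<in>UNIV. - (pi * t * (of_int (k i))\<^sup>2 / of_int (d i)))"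
    by (simp add: exp_sum)
  also have "(\<Sum>i\<in>UNIV. - (pi * t * (of_int (k i))\<^sup>2 / of_int (d i))) = - (pi * t * inner (point k) (point k))"
    unfolding inner_frame[of "point k" "point k"] by (simp add: sum_negf sum_distrib_left power2_eq_square)
  finally show ?thesis by (simp add: G_def)
qed

lemma sum_shift_box:
  fixes f :: "('n \<Rightarrow> int) \<Rightarrow> complex"
  assumes per: "\<And>k. f (\<lambda>i. k i mod d i) = f k"
  shows "(\<Sum>r\<in>residue_box d. f (\<lambda>i. r i + h i)) = (\<Sum>r\<in>residue_box d. f r)"
proof (rule sum.reindex_bij_witness[of _ "\<lambda>r i. (r i - h i) mod d i" "\<lambda>r i. (r i + h i) mod d i"])
  fix r assume r: "r \<in> residue_box d"
  then have m: "r i mod d i = r i" for i by (simp add: residue_box_iff)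
  show "(\<lambda>i. ((r i + h i) mod d i - h i) mod d i) = r" "(\<lambda>i. ((r i - h i) mod d i + h i) mod d i) = r"
    using m by (auto simp: mod_simps)
  show "(\<lambda>i. (r i + h i) mod d i) \<in> residue_box d" "(\<lambda>i. (r i - h i) mod d i) \<in> residue_box d"
    using dpos by (auto simp: residue_box_iff)
  show "f (\<lambda>i. (r i + h i) mod d i) = f (\<lambda>i. r i + h i)" by (rule per)
qed

end

locale selfdual_frame = orthogonal_frame e d for e :: "'n::finite \<Rightarrow> real^'n" and d +
  fixes L :: "(real^'n) set"
  assumes L0: "0 \<in> L" and Ladd: "\<And>x y. x \<in> L \<Longrightarrow> y \<in> L \<Longrightarrow> x + y \<in> L" and Lneg: "\<And>x. x \<in> L \<Longrightarrow> - x \<in> L"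
    and dual: "dual_lattice L = L" and eL: "\<And>i. e i \<in> L"
begin

lemma Ldiff: "x \<in> L \<Longrightarrow> y \<in> L \<Longrightarrow> x - y \<in> L"
  using Ladd[OF _ Lneg] by simp

lemma Lint: "x \<in> L \<Longrightarrow> of_int n *\<^sub>R x \<in> L"
proof (induction n rule: int_induct[of _ 0])
  case base then show ?case using L0 by simp
next
  case (step1 i) then show ?case using Ladd[of "of_int i *\<^sub>R x" x] by (simp add: algebra_simps)
next
  case (step2 i) then show ?case using Ldiff[of "of_int i *\<^sub>R x" x] by (simp add: algebra_simps)
qed

lemma Lsum: "finite A \<Longrightarrow> (\<And>i. i \<in> A \<Longrightarrow> f i \<in> L) \<Longrightarrow> sum f A \<in> L"
  by (induction A rule: finite_induct) (auto simp: L0 Ladd)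

lemma Lmem: "y \<in> L \<longleftrightarrow> (\<forall>x\<in>L. inner x y \<in> \<int>)"
  using dual unfolding dual_lattice_def by blast

lemma shift_in_L: "(\<Sum>i\<in>UNIV. of_int (k i) *\<^sub>R e i) \<in> L"
  by (intro Lsum Lint eL) simp

lemma point_surj:
  assumes "\<And>i. inner x (e i) \<in> \<int>"
  obtains k where "point k = x"
proof -
  have "\<forall>i. \<exists>n. inner x (e i) = of_int n" using assms by (auto elim: Ints_cases)
  then obtain k where "\<And>i. inner x (e i) = of_int (k i)" by metis
  then have "point k = x" by (rule point_eqI)
  then show ?thesis by (rule that)
qed

lemma L_frame_int: "x \<in> L \<Longrightarrow> inner x (e i) \<in> \<int>"
  using Lmem[of x] eL by (metis inner_commute)

definition coset :: "real^'n \<Rightarrow> (real^'n) set" where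
  "coset s = {x. x - s \<in> L}"

text \<open>The index in \<open>L\<close> of the sublattice spanned by the frame.\<close>

definition R :: nat where "R = card {r \<in> residue_box d. point r \<in> L}"

definition ind :: "(real^'n) set \<Rightarrow> ('n \<Rightarrow> int) \<Rightarrow> complex" where
  "ind S k = of_bool (point k \<in> S)"

lemma coset_0: "coset 0 = L" by (simp add: coset_def)

lemma coset_add: "v \<in> L \<Longrightarrow> x + v \<in> coset s \<longleftrightarrow> x \<in> coset s"
proof -
  assume v: "v \<in> L"
  have "x + v - s = (x - s) + v" "x - s = (x + v - s) - v" by simp_all
  then show ?thesis unfolding coset_def mem_Collect_eq using Ladd[OF _ v] Ldiff[OF _ v] by metis
qed

lemma ind_mod: "ind (coset s) (\<lambda>i. k i mod d i) = ind (coset s) k"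
proof -
  have "point k = point (\<lambda>i. k i mod d i) + (\<Sum>i\<in>UNIV. of_int (k i div d i) *\<^sub>R e i)"
    by (simp add: point_mod)
  then have "point k \<in> coset s \<longleftrightarrow> point (\<lambda>i. k i mod d i) \<in> coset s"
    using coset_add[OF shift_in_L] by metis
  then show ?thesis by (simp add: ind_def)
qed

lemma cis_mod:
  "cis (2 * pi * inner (point l) (point (\<lambda>i. k i mod d i))) = cis (2 * pi * inner (point l) (point k))"
proof -
  let ?v = "\<Sum>i\<in>UNIV. of_int (k i div d i) *\<^sub>R e i"
  have "inner (point l) ?v = of_int (\<Sum>i\<in>UNIV. (k i div d i) * l i)"
    by (simp add: inner_sum_right)
  then have "cis (2 * pi * inner (point l) ?v) = 1" by (simp only: cis_2pi_eq_1_iff Ints_of_int)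
  moreover have "inner (point l) (point k) = inner (point l) (point (\<lambda>i. k i mod d i)) + inner (point l) ?v"
    by (simp add: point_mod inner_diff_right)
  ultimately show ?thesis by (simp add: distrib_left flip: cis_mult)
qed

text \<open>Orthogonality of characters. If \<open>point l\<close> lies in \<open>L\<close>, the
  phase is constant on the coset. If not, selfduality provides \<open>v\<close> in \<open>L\<close>
  with nonintegral pairing, and shifting the sum by \<open>v\<close> multiplies it by a number other
  than 1.\<close>

lemma finite_fourier_coset:
  assumes s: "\<And>i. inner s (e i) \<in> \<int>"
  shows "finite_fourier d (ind (coset s)) l = of_nat R * (ind L l * cis (2 * pi * inner (point l) s))"
proof -
  let ?y = "point l"
  let ?F = "\<lambda>k. ind (coset s) k * cis (2 * pi * inner ?y (point k))"
  have ff: "finite_fourier d (ind (coset s)) l = (\<Sum>r\<in>residue_box d. ?F r)"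
    by (simp add: finite_fourier_def frac_pairing_eq)
  have per: "?F (\<lambda>i. k i mod d i) = ?F k" for k by (simp only: ind_mod cis_mod)
  show ?thesis
  proof (cases "?y \<in> L")
    case True
    have "?F r = ind (coset s) r * cis (2 * pi * inner ?y s)" for r
    proof (cases "point r \<in> coset s")
      case T: True
      then have "inner ?y (point r - s) \<in> \<int>"
        using Lmem[of "point r - s"] True by (auto simp: coset_def)
      then have "cis (2 * pi * inner ?y (point r - s)) = 1" by (simp only: cis_2pi_eq_1_iff)
      moreover have "inner ?y (point r) = inner ?y s + inner ?y (point r - s)" by (simp add: inner_diff_right)
      ultimately show ?thesis by (simp add: distrib_left flip: cis_mult)
    qed (simp add: ind_def)
    then have "(\<Sum>r\<in>residue_box d. ?F r) = (\<Sum>r\<in>residue_box d. ind (coset s) r) * cis (2 * pi * inner ?y s)"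
      unfolding sum_distrib_right by (rule sum.cong[OF refl])
    also have "(\<Sum>r\<in>residue_box d. ind (coset s) r) = of_nat R"
    proof -
      obtain h where h: "point h = s" using point_surj[OF s] .
      have "(\<Sum>r\<in>residue_box d. ind (coset s) r) = (\<Sum>r\<in>residue_box d. ind (coset s) (\<lambda>i. r i + h i))"
        by (rule sum_shift_box[symmetric]) (rule ind_mod)
      also have "\<dots> = (\<Sum>r\<in>residue_box d. of_bool (point r \<in> L))"
        by (simp add: ind_def point_add h coset_def)
      also have "\<dots> = of_nat R"
        using finite_residue_box[of d] by (simp add: R_def of_bool_def sum.If_cases Int_def)
      finally show ?thesis .
    qed
    finally show ?thesis unfolding ff using True by (simp add: ind_def)
  next
    case False
    then obtain v where v: "v \<in> L" "inner v ?y \<notin> \<int>" using Lmem by blast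
    obtain h where h: "point h = v" using point_surj[OF L_frame_int[OF v(1)]] .
    have "(\<Sum>r\<in>residue_box d. ?F r) = (\<Sum>r\<in>residue_box d. ?F (\<lambda>i. r i + h i))"
      by (rule sum_shift_box[symmetric]) (rule per)
    also have "\<dots> = (\<Sum>r\<in>residue_box d. ?F r * cis (2 * pi * inner ?y v))"
      by (rule sum.cong) (simp_all add: ind_def point_add h coset_add[OF v(1)] inner_add_right distrib_left cis_mult)
    also have "\<dots> = (\<Sum>r\<in>residue_box d. ?F r) * cis (2 * pi * inner ?y v)"
      by (simp add: sum_distrib_right)
    finally have "(\<Sum>r\<in>residue_box d. ?F r) * (1 - cis (2 * pi * inner ?y v)) = 0"
      by (simp add: algebra_simps)
    moreover have "cis (2 * pi * inner ?y v) \<noteq> 1" using v(2) by (simp add: cis_2pi_eq_1_iff inner_commute)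
    ultimately have "(\<Sum>r\<in>residue_box d. ?F r) = 0" by simp
    then show ?thesis unfolding ff using False by (simp add: ind_def)
  qed
qed

lemma poisson_coset:
  assumes "\<And>i. inner s (e i) \<in> \<int>" "\<And>i. poisson_pair (d i) (a i) (b i)"
  shows "(\<Sum>\<^sub>\<infinity>k. ind (coset s) k * (\<Prod>i\<in>UNIV. a i (k i))) =
    of_nat R * (\<Sum>\<^sub>\<infinity>l. ind L l * cis (2 * pi * inner (point l) s) * (\<Prod>i\<in>UNIV. b i (l i)))"
proof -
  have "(\<Sum>\<^sub>\<infinity>k. ind (coset s) k * (\<Prod>i\<in>UNIV. a i (k i))) =
      (\<Sum>\<^sub>\<infinity>l. of_nat R * (ind L l * cis (2 * pi * inner (point l) s) * (\<Prod>i\<in>UNIV. b i (l i))))"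
    unfolding poisson_pair_multi[of d a b "ind (coset s)", OF dpos assms(2) ind_mod] finite_fourier_coset[OF assms(1)]
    by (simp only: mult.assoc)
  then show ?thesis by (simp only: infsum_cmult_right')
qed

text \<open>The index is read off from the self-duality of the plain theta series at \<open>t = 1\<close>, so no determinants are needed.\<close>

lemma R_eq: "real R = (\<Prod>i\<in>UNIV. sqrt (of_int (d i)))"
proof -
  define f where "f k = (if point k \<in> L then G 1 (point k) else 0)" for k
  have abs: "(\<lambda>k. norm (\<Prod>i\<in>UNIV. gaussian (d i) 1 (k i))) summable_on UNIV"
    by (rule abs_summable_prod) (use gaussian_moment_abs_summable[OF dpos, of 1 0] in simp)
  then have fs: "f summable_on UNIV"
  proof -
    have "(\<lambda>k. norm (f k)) summable_on UNIV"
      by (rule Infinite_Sum.abs_summable_on_comparison_test'[OF abs]) (auto simp: prod_gaussian f_def)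
    then show ?thesis by (rule abs_summable_summable)
  qed
  \<comment> \<open>The zero vector alone contributes 1 and all terms are nonnegative, so the theta
    value is nonzero and can be cancelled.\<close>
  have "f (\<lambda>_. 0) = 1"
  proof -
    have "point (\<lambda>_. 0) = 0" by (simp add: point_def)
    then show ?thesis by (simp add: f_def L0 G_def)
  qed
  then have "1 \<le> (\<Sum>k\<in>{\<lambda>_. 0}. f k)" by simp
  also have "\<dots> \<le> infsum f UNIV"
    by (rule finite_sum_le_infsum[OF fs]) (auto simp: f_def G_def)
  finally have Z: "infsum f UNIV \<noteq> 0" by auto
  have z: "ind L k * (\<Prod>i\<in>UNIV. gaussian (d i) 1 (k i)) = of_real (f k)" for k
    by (simp add: ind_def prod_gaussian f_def)
  have pp: "poisson_pair (d i) (gaussian (d i) 1) (\<lambda>l. gaussian (d i) 1 l / of_real (sqrt (of_int (d i))))" for i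
    using poisson_pair_gaussian(1)[OF dpos, of 1] by simp
  have "complex_of_real (infsum f UNIV) = (\<Sum>\<^sub>\<infinity>k. ind (coset 0) k * (\<Prod>i\<in>UNIV. gaussian (d i) 1 (k i)))"
    by (simp add: coset_0 z infsum_complex_of_real)
  also have "\<dots> = of_nat R * (\<Sum>\<^sub>\<infinity>l. ind L l * cis (2 * pi * inner (point l) 0) * (\<Prod>i\<in>UNIV. gaussian (d i) 1 (l i) / of_real (sqrt (of_int (d i)))))"
    by (rule poisson_coset[OF _ pp]) simp
  also have "(\<lambda>l. ind L l * cis (2 * pi * inner (point l) 0) * (\<Prod>i\<in>UNIV. gaussian (d i) 1 (l i) / of_real (sqrt (of_int (d i))))) =
      (\<lambda>l. of_real (f l) * inverse (\<Prod>i\<in>UNIV. of_real (sqrt (of_int (d i)))))"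
    unfolding prod_dividef z[symmetric] by (simp add: divide_inverse mult.assoc)
  also have "(\<Sum>\<^sub>\<infinity>l. complex_of_real (f l) * inverse (\<Prod>i\<in>UNIV. of_real (sqrt (of_int (d i))))) = of_real (infsum f UNIV) * inverse (\<Prod>i\<in>UNIV. of_real (sqrt (of_int (d i))))"
    by (simp only: infsum_cmult_left' infsum_complex_of_real)
  finally have "complex_of_real (infsum f UNIV) = of_nat R * (of_real (infsum f UNIV) * inverse (\<Prod>i\<in>UNIV. of_real (sqrt (of_int (d i)))))" .
  then have "complex_of_real (infsum f UNIV) = of_real (infsum f UNIV * (real R / (\<Prod>i\<in>UNIV. sqrt (of_int (d i)))))"
    by (simp add: divide_inverse mult_ac)
  then have "infsum f UNIV = infsum f UNIV * (real R / (\<Prod>i\<in>UNIV. sqrt (of_int (d i))))"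
    by (simp only: of_real_eq_iff)
  then have "real R / (\<Prod>i\<in>UNIV. sqrt (of_int (d i))) = 1" using Z by (metis mult_cancel_left1)
  then show ?thesis by (simp add: divide_eq_1_iff)
qed

lemma prod_sqrt_scaled: "t > 0 \<Longrightarrow> (\<Prod>i\<in>UNIV. sqrt (t * of_int (d i))) = sqrt t ^ CARD('n) * real R"
  by (simp add: real_sqrt_mult prod.distrib R_eq)

text \<open>The product of the roots \<open>sqrt (t * d i)\<close> is
  \<open>sqrt t ^ CARD('n)\<close> times the index \<open>R\<close>, and \<open>R\<close> cancels
  against the factor from the finite Fourier transform. The weights \<open>p\<close> and
  \<open>q\<close> carry one monomial, coordinate by coordinate.\<close>

lemma poisson_coset_gaussian:
  assumes s: "\<And>i. inner s (e i) \<in> \<int>" and t: "t > 0"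
    and pp: "\<And>m. poisson_pair (d m) (\<lambda>k. p m k * gaussian (d m) t k) (\<lambda>l. q m l * gaussian (d m) (1/t) l / of_real (sqrt (t * of_int (d m))))"
  shows "(\<Sum>\<^sub>\<infinity>k. ind (coset s) k * ((\<Prod>m\<in>UNIV. p m (k m)) * of_real (G t (point k)))) =
    (\<Sum>\<^sub>\<infinity>l. ind L l * cis (2 * pi * inner (point l) s) * ((\<Prod>m\<in>UNIV. q m (l m)) * of_real (G (1/t) (point l)))) / of_real (sqrt t ^ CARD('n))"
    and "(\<lambda>k. norm ((\<Prod>m\<in>UNIV. p m (k m)) * of_real (G t (point k)))) summable_on UNIV"
    and "(\<lambda>l. norm ((\<Prod>m\<in>UNIV. q m (l m)) * of_real (G (1/t) (point l)))) summable_on UNIV"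
proof -
  let ?c = "complex_of_real (sqrt t ^ CARD('n) * real R)"
  have Rpos: "real R > 0" unfolding R_eq using dpos by (intro prod_pos) auto
  then have R0: "complex_of_nat R \<noteq> 0" by simp
  have c0: "?c \<noteq> 0" using Rpos t by simp
  have a: "(\<Prod>m\<in>UNIV. p m (k m) * gaussian (d m) t (k m)) = (\<Prod>m\<in>UNIV. p m (k m)) * of_real (G t (point k))" for k
    by (simp add: prod.distrib prod_gaussian)
  have b: "(\<Prod>m\<in>UNIV. q m (l m) * gaussian (d m) (1/t) (l m) / of_real (sqrt (t * of_int (d m)))) =
      (\<Prod>m\<in>UNIV. q m (l m)) * of_real (G (1/t) (point l)) / ?c" for l
    unfolding prod_dividef prod.distrib prod_gaussian prod_sqrt_scaled[OF t, symmetric] by simp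
  have "(\<Sum>\<^sub>\<infinity>k. ind (coset s) k * ((\<Prod>m\<in>UNIV. p m (k m)) * of_real (G t (point k)))) =
     of_nat R * (\<Sum>\<^sub>\<infinity>l. ind L l * cis (2 * pi * inner (point l) s) * ((\<Prod>m\<in>UNIV. q m (l m)) * of_real (G (1/t) (point l)) / ?c))"
    using poisson_coset[OF s pp] unfolding a b .
  also have "\<dots> = of_nat R * ((\<Sum>\<^sub>\<infinity>l. ind L l * cis (2 * pi * inner (point l) s) * ((\<Prod>m\<in>UNIV. q m (l m)) * of_real (G (1/t) (point l)))) * inverse ?c)"
    unfolding divide_inverse mult.assoc[symmetric] infsum_cmult_left' ..
  also have "\<dots> = (\<Sum>\<^sub>\<infinity>l. ind L l * cis (2 * pi * inner (point l) s) * ((\<Prod>m\<in>UNIV. q m (l m)) * of_real (G (1/t) (point l)))) / of_real (sqrt t ^ CARD('n))"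
    using R0 by (simp add: field_simps)
  finally show "(\<Sum>\<^sub>\<infinity>k. ind (coset s) k * ((\<Prod>m\<in>UNIV. p m (k m)) * of_real (G t (point k)))) = \<dots>" .
  show "(\<lambda>k. norm ((\<Prod>m\<in>UNIV. p m (k m)) * of_real (G t (point k)))) summable_on UNIV"
    unfolding a[symmetric] by (rule abs_summable_prod) (use pp in \<open>simp add: poisson_pair_def\<close>)
  have "(\<lambda>l. norm ((\<Prod>m\<in>UNIV. q m (l m)) * of_real (G (1/t) (point l)) / ?c)) summable_on UNIV"
    unfolding b[symmetric] by (rule abs_summable_prod) (use pp in \<open>simp add: poisson_pair_def\<close>)
  then have "(\<lambda>l. norm ((\<Prod>m\<in>UNIV. q m (l m)) * of_real (G (1/t) (point l)) / ?c) * norm ?c) summable_on UNIV"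
    by (rule summable_on_cmult_left)
  then show "(\<lambda>l. norm ((\<Prod>m\<in>UNIV. q m (l m)) * of_real (G (1/t) (point l)))) summable_on UNIV"
    using c0 by (simp add: norm_divide norm_mult del: of_real_mult)
qed

end

section \<open>From lattice sums to q-series\<close>

text \<open>Absolute summability permits collecting terms of equal norm, which turns sums over a
  lattice into power series.\<close>

lemma graded_sums:
  fixes f :: "'a \<Rightarrow> complex" and N :: "'a \<Rightarrow> nat"
  assumes abs: "(\<lambda>x. norm (f x)) summable_on S" and fin: "\<And>m. finite {x\<in>S. N x = m}"
  shows "(\<lambda>m. \<Sum>x\<in>{x\<in>S. N x = m}. f x) sums infsum f S"
    and "summable (\<lambda>m. \<Sum>x\<in>{x\<in>S. N x = m}. norm (f x))"
proof -
  let ?B = "\<lambda>m. {x\<in>S. N x = m}"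
  have bij: "bij_betw snd (Sigma UNIV ?B) S"
    by (rule bij_betw_byWitness[where f' = "\<lambda>x. (N x, x)"]) auto
  have gen: "(\<lambda>m. \<Sum>x\<in>?B m. g x) sums infsum g S" if g: "g summable_on S" for g :: "'a \<Rightarrow> 'c::banach"
  proof -
    have "(\<lambda>p. g (snd p)) summable_on Sigma UNIV ?B"
      using summable_on_reindex_bij_betw[OF bij, of g] g by simp
    then have s: "(\<lambda>(m, x). g x) summable_on Sigma UNIV ?B" by (simp add: split_def)
    have "infsum g S = infsum (\<lambda>p. g (snd p)) (Sigma UNIV ?B)"
      by (rule infsum_reindex_bij_betw[OF bij, symmetric])
    also have "\<dots> = infsum (\<lambda>(m, x). g x) (Sigma UNIV ?B)" by (simp add: split_def)
    also have "\<dots> = (\<Sum>\<^sub>\<infinity>m. \<Sum>\<^sub>\<infinity>x\<in>?B m. g x)"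
      by (rule infsum_Sigma'_banach[OF s, symmetric])
    also have "\<dots> = (\<Sum>\<^sub>\<infinity>m. \<Sum>x\<in>?B m. g x)" using fin by simp
    finally have eq: "infsum g S = (\<Sum>\<^sub>\<infinity>m. \<Sum>x\<in>?B m. g x)" .
    have "(\<lambda>m. infsum g (?B m)) summable_on UNIV" by (rule summable_on_Sigma_banach[OF s])
    then have "(\<lambda>m. \<Sum>x\<in>?B m. g x) summable_on UNIV" using fin by simp
    then show ?thesis unfolding eq by (intro has_sum_imp_sums has_sum_infsum)
  qed
  show "(\<lambda>m. \<Sum>x\<in>?B m. f x) sums infsum f S" by (rule gen[OF abs_summable_summable[OF abs]])
  show "summable (\<lambda>m. \<Sum>x\<in>?B m. norm (f x))" using gen[OF abs] by (rule sums_summable)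
qed

text \<open>The Gaussian laws hold at purely imaginary arguments; the identity theorem carries them
  to the half-plane.\<close>

lemma uhp_eqI:
  assumes "F holomorphic_on uhp" "H holomorphic_on uhp" "\<And>t. t > 0 \<Longrightarrow> F (\<i> * of_real t) = H (\<i> * of_real t)" "z \<in> uhp"
  shows "F z = H z"
proof -
  have "(\<lambda>z. F z - H z) z = 0"
  proof (rule analytic_continuation[of "\<lambda>z. F z - H z" uhp "(\<lambda>t. \<i> * of_real t) ` {0<..}" \<i>])
    show "(\<lambda>z. F z - H z) holomorphic_on uhp" by (intro holomorphic_intros assms)
    show "\<i> islimpt (\<lambda>t. \<i> * complex_of_real t) ` {0<..}"
      unfolding islimpt_approachable
    proof safe
      fix e :: real assume "e > 0"
      then show "\<exists>x'\<in>(\<lambda>t. \<i> * complex_of_real t) ` {0<..}. x' \<noteq> \<i> \<and> dist x' \<i> < e"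
      proof (intro bexI[of _ "\<i> * complex_of_real (1 + e / 2)"] conjI)
        have "\<i> * complex_of_real (1 + e / 2) - \<i> = \<i> * complex_of_real (e / 2)" by (simp add: algebra_simps)
        then have "dist (\<i> * complex_of_real (1 + e / 2)) \<i> = e / 2" using \<open>e > 0\<close> by (simp add: dist_norm norm_mult del: of_real_divide of_real_add)
        then show "dist (\<i> * complex_of_real (1 + e / 2)) \<i> < e" "\<i> * complex_of_real (1 + e / 2) \<noteq> \<i>"
          using \<open>e > 0\<close> by auto
        show "\<i> * complex_of_real (1 + e / 2) \<in> (\<lambda>t. \<i> * complex_of_real t) ` {0<..}"
          using \<open>e > 0\<close> by (intro imageI) simp
      qed
    qed
  qed (use assms open_uhp connected_uhp in \<open>auto simp: uhp_def\<close>)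
  then show ?thesis by simp
qed

lemma qseries_holomorphic:
  assumes "\<And>w::complex. norm w < 1 \<Longrightarrow> summable (\<lambda>n. a n * w ^ n)"
  shows "qseries a holomorphic_on uhp"
  unfolding holomorphic_on_open[OF open_uhp] using qseries_has_derivative[OF assms] by blast

context selfdual_frame
begin

text \<open>Relative to the frame these forms span the quadratic forms of trace zero; squares are
  divided by \<open>d i\<close>, the squared length of \<open>e i\<close>. Each is a product over
  coordinates or a difference of two such products, as the coordinatewise Poisson formula
  requires.\<close>

definition harmonic :: "(real^'n \<Rightarrow> real) \<Rightarrow> bool" where
  "harmonic P \<longleftrightarrow> (\<exists>i j. i \<noteq> j \<and> (P = (\<lambda>x. inner x (e i) * inner x (e j)) \<or>
      P = (\<lambda>x. (inner x (e i))\<^sup>2 / of_int (d i) - (inner x (e j))\<^sup>2 / of_int (d j))))"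

lemma norm_ind_le: "norm (ind S k) \<le> 1" by (simp add: ind_def)

lemma ind_abs_summable:
  fixes u f :: "'b \<Rightarrow> complex"
  assumes "(\<lambda>k. norm (f k)) summable_on UNIV" "\<And>k. norm (u k) \<le> 1"
  shows "(\<lambda>k. u k * f k) summable_on UNIV"
proof (rule abs_summable_summable, rule Infinite_Sum.abs_summable_on_comparison_test'[OF assms(1)])
  fix k show "norm (u k * f k) \<le> norm (f k)"
    using assms(2)[of k] by (simp add: norm_mult mult_left_le_one_le)
qed

text \<open>Each of the two linear factors contributes \<open>- (\<i> / t)\<close>, together
  \<open>- 1 / t\<^sup>2\<close>; the factor \<open>sqrt t ^ 24\<close> raises the denominator to
  \<open>t ^ 14\<close>.\<close>

lemma theta_law_off_diagonal:
  assumes n: "CARD('n) = 24" and ij: "i \<noteq> j" and s: "\<And>i. inner s (e i) \<in> \<int>" and t: "t > 0"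
  defines "P \<equiv> \<lambda>x. inner x (e i) * inner x (e j)"
  shows "(\<lambda>k. norm (complex_of_real (P (point k) * G t (point k)))) summable_on UNIV"
    and "(\<Sum>\<^sub>\<infinity>k. ind (coset s) k * of_real (P (point k) * G t (point k))) =
      - (\<Sum>\<^sub>\<infinity>l. ind L l * cis (2 * pi * inner (point l) s) * of_real (P (point l) * G (1/t) (point l))) / of_real (t ^ 14)"
proof -
  define p where "p m k = (if m = i then of_int k else 1) * (if m = j then of_int k else (1::complex))" for m :: 'n and k :: int
  define q where "q m l = (if m = i then - (\<i> / of_real t) * of_int l else 1) * (if m = j then - (\<i> / of_real t) * of_int l else (1::complex))" for m :: 'n and l :: int
  have pp: "poisson_pair (d m) (\<lambda>k. p m k * gaussian (d m) t k) (\<lambda>l. q m l * gaussian (d m) (1/t) l / of_real (sqrt (t * of_int (d m))))" for m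
    using poisson_pair_gaussian(1,2)[OF dpos[of m] t] ij
    by (cases "m = i"; cases "m = j") (simp_all add: p_def q_def)
  have P: "(\<Prod>m\<in>UNIV. p m (k m)) = of_real (P (point k))" for k
    unfolding p_def prod.distrib by (simp add: P_def)
  have Q: "(\<Prod>m\<in>UNIV. q m (l m)) = - of_real (P (point l)) / of_real (t\<^sup>2)" for l
    unfolding q_def prod.distrib by (simp add: P_def power2_eq_square mult_ac)
  note * = poisson_coset_gaussian[of s t p q, OF s t pp, unfolded P Q n]
  show "(\<lambda>k. norm (complex_of_real (P (point k) * G t (point k)))) summable_on UNIV" using *(2) by (simp only: of_real_mult)
  have "sqrt t ^ 24 = (sqrt t ^ 2) ^ 12" by (simp flip: power_mult)
  then have t12: "sqrt t ^ 24 = t ^ 12" using t by simp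
  have "(\<Sum>\<^sub>\<infinity>k. ind (coset s) k * of_real (P (point k) * G t (point k))) =
    (\<Sum>\<^sub>\<infinity>l. ind L l * cis (2 * pi * inner (point l) s) * (- of_real (P (point l)) / of_real (t\<^sup>2) * of_real (G (1/t) (point l)))) / of_real (t ^ 12)"
    using *(1) unfolding t12 by (simp only: of_real_mult)
  also have "(\<lambda>l. ind L l * cis (2 * pi * inner (point l) s) * (- of_real (P (point l)) / of_real (t\<^sup>2) * of_real (G (1/t) (point l)))) =
     (\<lambda>l. ind L l * cis (2 * pi * inner (point l) s) * of_real (P (point l) * G (1/t) (point l)) * (- inverse (of_real (t\<^sup>2))))"
    by (simp add: divide_inverse mult_ac)
  also have "(\<Sum>\<^sub>\<infinity>l. ind L l * cis (2 * pi * inner (point l) s) * of_real (P (point l) * G (1/t) (point l)) * (- inverse (of_real (t\<^sup>2)))) =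
     (\<Sum>\<^sub>\<infinity>l. ind L l * cis (2 * pi * inner (point l) s) * of_real (P (point l) * G (1/t) (point l))) * (- inverse (of_real (t\<^sup>2)))"
    by (rule infsum_cmult_left')
  finally show "(\<Sum>\<^sub>\<infinity>k. ind (coset s) k * of_real (P (point k) * G t (point k))) =
      - (\<Sum>\<^sub>\<infinity>l. ind L l * cis (2 * pi * inner (point l) s) * of_real (P (point l) * G (1/t) (point l))) / of_real (t ^ 14)"
    using t by (simp add: field_simps flip: power_add)
qed

text \<open>After division by \<open>d i\<close> and \<open>d j\<close> both squares have the same
  nonharmonic correction \<open>1 / (2 * pi * t)\<close>, which cancels in the difference.\<close>

lemma theta_law_diagonal:
  fixes i j :: 'n
  assumes n: "CARD('n) = 24" and s: "\<And>i. inner s (e i) \<in> \<int>" and t: "t > 0"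
  defines "P \<equiv> \<lambda>x. (inner x (e i))\<^sup>2 / of_int (d i) - (inner x (e j))\<^sup>2 / of_int (d j)"
  shows "(\<lambda>k. norm (complex_of_real (P (point k) * G t (point k)))) summable_on UNIV"
    and "(\<Sum>\<^sub>\<infinity>k. ind (coset s) k * of_real (P (point k) * G t (point k))) =
      - (\<Sum>\<^sub>\<infinity>l. ind L l * cis (2 * pi * inner (point l) s) * of_real (P (point l) * G (1/t) (point l))) / of_real (t ^ 14)"
proof -
  define p where "p i m k = (if m = i then (of_int k)\<^sup>2 else (1::complex))" for i m :: 'n and k :: int
  define q where "q i m l = (if m = i then of_int (d m) / of_real (2 * pi * t) - (of_int l)\<^sup>2 / of_real (t\<^sup>2) else (1::complex))" for i m :: 'n and l :: int
  have pp: "poisson_pair (d m) (\<lambda>k. p i m k * gaussian (d m) t k) (\<lambda>l. q i m l * gaussian (d m) (1/t) l / of_real (sqrt (t * of_int (d m))))" for i m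
    using poisson_pair_gaussian(1,3)[OF dpos[of m] t]
    by (cases "m = i") (simp_all add: p_def q_def)
  have Pp: "(\<Prod>m\<in>UNIV. p i m (k m)) = (of_int (k i))\<^sup>2" for i k unfolding p_def by simp
  have Qq: "(\<Prod>m\<in>UNIV. q i m (l m)) = of_int (d i) / of_real (2 * pi * t) - (of_int (l i))\<^sup>2 / of_real (t\<^sup>2)" for i l unfolding q_def by simp
  note * = poisson_coset_gaussian[of s t "p i" "q i" for i, OF s t pp, unfolded Pp Qq n]
  have "sqrt t ^ 24 = (sqrt t ^ 2) ^ 12" by (simp flip: power_mult)
  then have t12: "sqrt t ^ 24 = t ^ 12" using t by simp
  define A where "A i = (\<Sum>\<^sub>\<infinity>k. ind (coset s) k * ((of_int (k i))\<^sup>2 * of_real (G t (point k))))" for i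
  define B where "B i = (\<Sum>\<^sub>\<infinity>l. (ind L l * cis (2 * pi * inner (point l) s)) * ((of_int (d i) / of_real (2 * pi * t) - (of_int (l i))\<^sup>2 / of_real (t\<^sup>2)) * of_real (G (1/t) (point l))))" for i
  have AB: "A i = B i / of_real (t ^ 12)" for i unfolding A_def B_def *(1) t12 ..
  have hA: "((\<lambda>k. ind (coset s) k * ((of_int (k i))\<^sup>2 * of_real (G t (point k)))) has_sum A i) UNIV" for i
    unfolding A_def by (rule has_sum_infsum, rule ind_abs_summable[OF *(2)]) (rule norm_ind_le)
  have hB: "((\<lambda>l. (ind L l * cis (2 * pi * inner (point l) s)) * ((of_int (d i) / of_real (2 * pi * t) - (of_int (l i))\<^sup>2 / of_real (t\<^sup>2)) * of_real (G (1/t) (point l)))) has_sum B i) UNIV" for i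
    unfolding B_def by (rule has_sum_infsum, rule ind_abs_summable[OF *(3)]) (simp add: norm_mult norm_ind_le)
  have d0: "complex_of_int (d m) \<noteq> 0" for m using dpos[of m] by simp
  have "((\<lambda>k. 1 / of_int (d i) * (ind (coset s) k * ((of_int (k i))\<^sup>2 * of_real (G t (point k)))) - 1 / of_int (d j) * (ind (coset s) k * ((of_int (k j))\<^sup>2 * of_real (G t (point k))))) has_sum (1 / of_int (d i) * A i - 1 / of_int (d j) * A j)) UNIV"
    by (intro has_sum_diff_complex has_sum_cmult_right hA)
  moreover have "(\<lambda>k. 1 / of_int (d i) * (ind (coset s) k * ((of_int (k i))\<^sup>2 * of_real (G t (point k)))) - 1 / of_int (d j) * (ind (coset s) k * ((of_int (k j))\<^sup>2 * of_real (G t (point k))))) =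
     (\<lambda>k. ind (coset s) k * complex_of_real (P (point k) * G t (point k)))"
    by (rule ext) (simp add: P_def algebra_simps)
  ultimately have L: "(\<Sum>\<^sub>\<infinity>k. ind (coset s) k * complex_of_real (P (point k) * G t (point k))) = 1 / of_int (d i) * A i - 1 / of_int (d j) * A j"
    by (simp add: infsumI)
  have "((\<lambda>l. 1 / of_int (d i) * ((ind L l * cis (2 * pi * inner (point l) s)) * ((of_int (d i) / of_real (2 * pi * t) - (of_int (l i))\<^sup>2 / of_real (t\<^sup>2)) * of_real (G (1/t) (point l)))) -
      1 / of_int (d j) * ((ind L l * cis (2 * pi * inner (point l) s)) * ((of_int (d j) / of_real (2 * pi * t) - (of_int (l j))\<^sup>2 / of_real (t\<^sup>2)) * of_real (G (1/t) (point l))))) has_sum (1 / of_int (d i) * B i - 1 / of_int (d j) * B j)) UNIV"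
    by (intro has_sum_diff_complex has_sum_cmult_right hB)
  moreover have "(\<lambda>l. 1 / of_int (d i) * ((ind L l * cis (2 * pi * inner (point l) s)) * ((of_int (d i) / of_real (2 * pi * t) - (of_int (l i))\<^sup>2 / of_real (t\<^sup>2)) * of_real (G (1/t) (point l)))) -
      1 / of_int (d j) * ((ind L l * cis (2 * pi * inner (point l) s)) * ((of_int (d j) / of_real (2 * pi * t) - (of_int (l j))\<^sup>2 / of_real (t\<^sup>2)) * of_real (G (1/t) (point l))))) =
     (\<lambda>l. - inverse (of_real (t\<^sup>2)) * (ind L l * cis (2 * pi * inner (point l) s) * of_real (P (point l) * G (1/t) (point l))))"
  proof
    fix l
    have "1 / di * (u * ((di / c - x / w) * g)) - 1 / dj * (u * ((dj / c - y / w) * g)) = - inverse w * (u * ((x / di - y / dj) * g))"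
      if "di \<noteq> 0" "dj \<noteq> 0" for u di dj c x y w g :: complex
      using that by (simp add: divide_inverse algebra_simps)
    from this[OF d0 d0] show "1 / of_int (d i) * ((ind L l * cis (2 * pi * inner (point l) s)) * ((of_int (d i) / of_real (2 * pi * t) - (of_int (l i))\<^sup>2 / of_real (t\<^sup>2)) * of_real (G (1/t) (point l)))) -
      1 / of_int (d j) * ((ind L l * cis (2 * pi * inner (point l) s)) * ((of_int (d j) / of_real (2 * pi * t) - (of_int (l j))\<^sup>2 / of_real (t\<^sup>2)) * of_real (G (1/t) (point l)))) =
      - inverse (of_real (t\<^sup>2)) * (ind L l * cis (2 * pi * inner (point l) s) * of_real (P (point l) * G (1/t) (point l)))"
      by (simp add: P_def)
  qed
  ultimately have Rr: "- inverse (of_real (t\<^sup>2)) * (\<Sum>\<^sub>\<infinity>l. ind L l * cis (2 * pi * inner (point l) s) * of_real (P (point l) * G (1/t) (point l))) = 1 / of_int (d i) * B i - 1 / of_int (d j) * B j"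
    unfolding infsum_cmult_right'[symmetric] by (simp add: infsumI)
  have "(\<Sum>\<^sub>\<infinity>k. ind (coset s) k * complex_of_real (P (point k) * G t (point k))) = (1 / of_int (d i) * B i - 1 / of_int (d j) * B j) / of_real (t ^ 12)"
    unfolding L AB by (simp add: diff_divide_distrib)
  also have "\<dots> = - (\<Sum>\<^sub>\<infinity>l. ind L l * cis (2 * pi * inner (point l) s) * of_real (P (point l) * G (1/t) (point l))) / of_real (t ^ 14)"
    unfolding Rr[symmetric] using t by (simp add: field_simps flip: power_add)
  finally show "(\<Sum>\<^sub>\<infinity>k. ind (coset s) k * complex_of_real (P (point k) * G t (point k))) = \<dots>" .
  have "(\<lambda>k. norm (1 / complex_of_int (d i)) * norm ((of_int (k i))\<^sup>2 * complex_of_real (G t (point k))) + norm (1 / complex_of_int (d j)) * norm ((of_int (k j))\<^sup>2 * complex_of_real (G t (point k)))) summable_on UNIV"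
    by (intro summable_on_add summable_on_cmult_right *(2))
  then show "(\<lambda>k. norm (complex_of_real (P (point k) * G t (point k)))) summable_on UNIV"
  proof (rule Infinite_Sum.abs_summable_on_comparison_test')
    fix k
    have "complex_of_real (P (point k) * G t (point k)) = 1 / complex_of_int (d i) * ((of_int (k i))\<^sup>2 * complex_of_real (G t (point k))) - 1 / complex_of_int (d j) * ((of_int (k j))\<^sup>2 * complex_of_real (G t (point k)))"
      by (simp add: P_def algebra_simps)
    then show "norm (complex_of_real (P (point k) * G t (point k))) \<le> norm (1 / complex_of_int (d i)) * norm ((of_int (k i))\<^sup>2 * complex_of_real (G t (point k))) + norm (1 / complex_of_int (d j)) * norm ((of_int (k j))\<^sup>2 * complex_of_real (G t (point k)))"
      by (metis norm_mult norm_triangle_ineq4)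
  qed
qed

lemma theta_law_points:
  assumes "CARD('n) = 24" "harmonic P" "\<And>i. inner s (e i) \<in> \<int>" "t > 0"
  shows "(\<lambda>k. norm (complex_of_real (P (point k) * G t (point k)))) summable_on UNIV"
    and "(\<Sum>\<^sub>\<infinity>k. ind (coset s) k * of_real (P (point k) * G t (point k))) =
      - (\<Sum>\<^sub>\<infinity>l. ind L l * cis (2 * pi * inner (point l) s) * of_real (P (point l) * G (1/t) (point l))) / of_real (t ^ 14)"
  using assms(2) theta_law_off_diagonal[OF assms(1) _ assms(3,4)] theta_law_diagonal[OF assms(1,3,4)]
  unfolding harmonic_def by blast+

lemma points_bij:
  assumes "\<And>x i. x \<in> S \<Longrightarrow> inner x (e i) \<in> \<int>"
  shows "bij_betw point {k. point k \<in> S} S"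
  unfolding bij_betw_def
proof
  show "inj_on point {k. point k \<in> S}" using inj_point by (rule inj_on_subset) simp
  have "x \<in> point ` {k. point k \<in> S}" if x: "x \<in> S" for x
  proof -
    obtain k where "point k = x" using point_surj[OF assms[OF x]] .
    then show ?thesis using x by blast
  qed
  then show "point ` {k. point k \<in> S} = S" by auto
qed

lemma infsum_ind:
  assumes "\<And>x i. x \<in> S \<Longrightarrow> inner x (e i) \<in> \<int>"
  shows "(\<Sum>\<^sub>\<infinity>k. ind S k * f (point k)) = (\<Sum>\<^sub>\<infinity>x\<in>S. f x)"
proof -
  have "(\<Sum>\<^sub>\<infinity>k. ind S k * f (point k)) = (\<Sum>\<^sub>\<infinity>k\<in>{k. point k \<in> S}. f (point k))"
    by (rule infsum_cong_neutral) (auto simp: ind_def)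
  also have "\<dots> = (\<Sum>\<^sub>\<infinity>x\<in>S. f x)" by (rule infsum_reindex_bij_betw[OF points_bij[OF assms]])
  finally show ?thesis .
qed

lemma coset_frame_int:
  assumes "\<And>i. inner s (e i) \<in> \<int>" "x \<in> coset s"
  shows "inner x (e i) \<in> \<int>"
proof -
  have "inner (x - s) (e i) + inner s (e i) \<in> \<int>"
    using assms L_frame_int[of "x - s" i] by (intro Ints_add) (auto simp: coset_def)
  then show ?thesis by (simp add: inner_diff_left)
qed

lemma theta_law:
  assumes "CARD('n) = 24" "harmonic P" and s: "\<And>i. inner s (e i) \<in> \<int>" and "t > 0"
  shows "(\<lambda>x. norm (complex_of_real (P x * G t x))) summable_on coset s"
    and "(\<Sum>\<^sub>\<infinity>x\<in>coset s. of_real (P x * G t x)) =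
      - (\<Sum>\<^sub>\<infinity>x\<in>L. cis (2 * pi * inner x s) * of_real (P x * G (1/t) x)) / of_real (t ^ 14)"
proof -
  have bij: "bij_betw point {k. point k \<in> coset s} (coset s)"
    by (rule points_bij) (rule coset_frame_int[OF s])
  have "(\<Sum>\<^sub>\<infinity>k. ind (coset s) k * of_real (P (point k) * G t (point k))) = (\<Sum>\<^sub>\<infinity>x\<in>coset s. complex_of_real (P x * G t x))"
    by (rule infsum_ind) (rule coset_frame_int[OF s])
  moreover have "(\<Sum>\<^sub>\<infinity>k. ind L k * (cis (2 * pi * inner (point k) s) * of_real (P (point k) * G (1/t) (point k)))) = (\<Sum>\<^sub>\<infinity>x\<in>L. cis (2 * pi * inner x s) * of_real (P x * G (1/t) x))"
    by (rule infsum_ind) (rule L_frame_int)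
  ultimately show "(\<Sum>\<^sub>\<infinity>x\<in>coset s. of_real (P x * G t x)) =
      - (\<Sum>\<^sub>\<infinity>x\<in>L. cis (2 * pi * inner x s) * of_real (P x * G (1/t) x)) / of_real (t ^ 14)"
    using theta_law_points(2)[OF assms] by (simp only: mult.assoc)
  have "(\<lambda>k. norm (complex_of_real (P (point k) * G t (point k)))) summable_on {k. point k \<in> coset s}"
    by (rule summable_on_subset_banach[OF theta_law_points(1)[OF assms]]) auto
  then show "(\<lambda>x. norm (complex_of_real (P x * G t x))) summable_on coset s"
    using summable_on_reindex_bij_betw[OF bij, of "\<lambda>x. norm (complex_of_real (P x * G t x))"] by simp
qed

text \<open>By Cauchy-Schwarz the norm bounds every inner product with the frame, and these are
  integers that determine the point.\<close>

lemma finite_frame_shell: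
  assumes "\<And>x i. x \<in> S \<Longrightarrow> inner x (e i) \<in> \<int>"
  shows "finite {x \<in> S. inner x x = c}"
proof -
  have "finite (PiE UNIV (\<lambda>i. {k::int. k\<^sup>2 \<le> \<lceil>c * of_int (d i)\<rceil>}))"
  proof (rule finite_PiE)
    fix i
    show "finite {k::int. k\<^sup>2 \<le> \<lceil>c * of_int (d i)\<rceil>}" by (rule finite_int_square_le)
  qed simp
  then have "finite (point ` (PiE UNIV (\<lambda>i. {k::int. k\<^sup>2 \<le> \<lceil>c * of_int (d i)\<rceil>})))" by (rule finite_imageI)
  then show ?thesis
  proof (rule rev_finite_subset, intro subsetI)
    fix x assume x: "x \<in> {x \<in> S. inner x x = c}"
    obtain k where k: "point k = x" using point_surj[OF assms] x by blast
    have "(k i)\<^sup>2 \<le> \<lceil>c * of_int (d i)\<rceil>" for i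
    proof -
      have "(of_int (k i))\<^sup>2 \<le> inner x x * inner (e i) (e i)"
        using Cauchy_Schwarz_ineq[of x "e i"] k by auto
      then have "of_int ((k i)\<^sup>2) \<le> c * of_int (d i)" using x by (simp add: nrm)
      then show ?thesis by (metis ceiling_mono ceiling_of_int)
    qed
    then show "x \<in> point ` (PiE UNIV (\<lambda>i. {k::int. k\<^sup>2 \<le> \<lceil>c * of_int (d i)\<rceil>}))"
      using k by (auto simp: PiE_UNIV_domain)
  qed
qed

end

lemma qexp_imag: "qexp (\<i> * of_real y) = of_real (exp (- (2 * pi * y)))"
  unfolding qexp_def by (simp add: mult_ac flip: exp_of_real)

context selfdual_frame
begin

lemma harmonic_0: "harmonic P \<Longrightarrow> P 0 = 0"
  by (auto simp: harmonic_def)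

text \<open>One statement for three series: \<open>c\<close> is the spacing of the norms, 1 for
  \<open>L\<close> and 2 for the shadow, and \<open>h = - 1\<close> inserts the character.\<close>

lemma coset_series:
  assumes n: "CARD('n) = 24" and P: "harmonic P" and s: "\<And>i. inner s (e i) \<in> \<int>"
    and c: "c > 0" and N: "\<And>x. x \<in> coset s \<Longrightarrow> inner x x = real c * real (N x)"
  defines "\<beta> \<equiv> \<lambda>m. \<Sum>x\<in>{x\<in>coset s. N x = m}. complex_of_real (P x)"
  shows "norm w < 1 \<Longrightarrow> summable (\<lambda>m. \<beta> m * w ^ m)"
    and "t > 0 \<Longrightarrow> \<bar>h\<bar> = 1 \<Longrightarrow> (\<lambda>m. \<beta> m * of_real (h * exp (- (pi * real c * t))) ^ m) sums
        (\<Sum>\<^sub>\<infinity>x\<in>coset s. of_real (h ^ N x) * of_real (P x * G t x))"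
proof -
  have fin: "finite {x\<in>coset s. N x = m}" for m
    by (rule finite_subset[OF _ finite_frame_shell[OF coset_frame_int[OF s], of _ "real c * real m"]]) (auto simp: N)
  have GN: "G t x = exp (- (pi * real c * t)) ^ N x" if "x \<in> coset s" for t x
    using N[OF that] by (simp add: G_def mult_ac flip: exp_of_nat_mult)
  {
    fix t h :: real assume t: "t > 0" and h: "\<bar>h\<bar> = 1"
    have nf: "norm (complex_of_real (h ^ N x) * of_real (P x * G t x)) = norm (complex_of_real (P x * G t x))" for x
      using h by (simp add: norm_mult norm_power)
    have abs: "(\<lambda>x. norm (complex_of_real (h ^ N x) * of_real (P x * G t x))) summable_on coset s"
      unfolding nf by (rule theta_law(1)[OF n P s t])
    have fib: "(\<Sum>x\<in>{x\<in>coset s. N x = m}. complex_of_real (h ^ N x) * of_real (P x * G t x)) = \<beta> m * of_real (h * exp (- (pi * real c * t))) ^ m" for m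
      unfolding \<beta>_def sum_distrib_right by (rule sum.cong) (auto simp: GN power_mult_distrib)
    show "(\<lambda>m. \<beta> m * of_real (h * exp (- (pi * real c * t))) ^ m) sums
        (\<Sum>\<^sub>\<infinity>x\<in>coset s. of_real (h ^ N x) * of_real (P x * G t x))"
      using graded_sums(1)[OF abs fin] unfolding fib .
  }
  assume w: "norm w < 1"
  show "summable (\<lambda>m. \<beta> m * w ^ m)"
  proof (cases "w = 0")
    case False
    \<comment> \<open>Chosen so that the Gaussian at \<open>x\<close> equals
      \<open>norm w ^ N x\<close>; the absolutely convergent graded sum then dominates the series at
      \<open>w\<close>.\<close>
    define t where "t = - ln (norm w) / (pi * real c)"
    have t: "t > 0" using w False c by (simp add: t_def divide_neg_pos)
    have ew: "exp (- (pi * real c * t)) = norm w" using False c by (simp add: t_def)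
    have sm: "summable (\<lambda>m. \<Sum>x\<in>{x\<in>coset s. N x = m}. norm (complex_of_real (P x * G t x)))"
      by (rule graded_sums(2)[OF theta_law(1)[OF n P s t] fin])
    show ?thesis
    proof (rule summable_comparison_test'[OF sm, of 0])
      fix m
      have "norm (\<beta> m * w ^ m) \<le> (\<Sum>x\<in>{x\<in>coset s. N x = m}. norm (complex_of_real (P x))) * norm w ^ m"
        unfolding \<beta>_def norm_mult norm_power by (intro mult_right_mono norm_sum) auto
      also have "\<dots> = (\<Sum>x\<in>{x\<in>coset s. N x = m}. norm (complex_of_real (P x * G t x)))"
        unfolding sum_distrib_right by (rule sum.cong) (auto simp: GN ew norm_mult norm_power)
      finally show "norm (\<beta> m * w ^ m) \<le> (\<Sum>x\<in>{x\<in>coset s. N x = m}. norm (complex_of_real (P x * G t x)))" .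
    qed
  qed simp
qed

section \<open>Vanishing of harmonic sums and the design property in rank 24\<close>

text \<open>By \<open>chr\<close> the Gaussian sum of the coset is dual to the sum over
  \<open>L\<close> twisted by the parity of the norm. \<open>even\<close> makes half the norm an
  integral index, and \<open>no2\<close> gives \<open>g 1 = 0\<close>, the start of the
  recursion.\<close>

lemma harmonic_sums_vanish:
  assumes n: "CARD('n) = 24" and P: "harmonic P" and s: "\<And>i. inner s (e i) \<in> \<int>"
    and chr: "\<And>x. x \<in> L \<Longrightarrow> cis (2 * pi * inner x s) = (- 1) ^ nat \<lfloor>inner x x\<rfloor>"
    and even: "\<And>x. x \<in> coset s \<Longrightarrow> \<exists>k::nat. inner x x = 2 * real k"
    and no2: "\<And>x. x \<in> coset s \<Longrightarrow> inner x x \<noteq> 2"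
  shows "(\<Sum>x\<in>shell L (2 * 4 ^ a). P x) = 0" and "(\<Sum>x\<in>shell (coset s) (2 * 4 ^ a). P x) = 0"
proof -
  define NL where "NL x = nat \<lfloor>inner x x\<rfloor>" for x :: "real^'n"
  define NS where "NS x = nat \<lfloor>inner x x / 2\<rfloor>" for x :: "real^'n"
  have NL: "inner x x = real 1 * real (NL x)" if "x \<in> coset 0" for x
  proof -
    have "inner x x \<in> \<int>" using that Lmem[of x] by (simp add: coset_0)
    then show ?thesis using inner_ge_zero[of x] by (auto simp: NL_def elim!: Ints_cases)
  qed
  have NS: "inner x x = real 2 * real (NS x)" if "x \<in> coset s" for x
    using even[OF that] by (auto simp: NS_def)
  define b where "b m = (\<Sum>x\<in>{x\<in>L. NL x = m}. complex_of_real (P x))" for m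
  define g where "g m = (\<Sum>x\<in>{x\<in>coset s. NS x = m}. complex_of_real (P x))" for m
  have z: "inner 0 (e i) \<in> \<int>" for i by simp
  note bs = coset_series[OF n P z _ NL, unfolded coset_0, folded b_def, simplified]
  note gs = coset_series[OF n P s _ NS, folded g_def, simplified]
  have smb: "summable (\<lambda>m. b m * w ^ m)" if "norm w < 1" for w using bs(1) that by blast
  have smg: "summable (\<lambda>m. g m * w ^ m)" if "norm w < 1" for w using gs(1) that by blast
  define TL where "TL t = (\<Sum>\<^sub>\<infinity>x\<in>L. complex_of_real (P x * G t x))" for t
  define TS where "TS t = (\<Sum>\<^sub>\<infinity>x\<in>coset s. complex_of_real (P x * G t x))" for t
  define TM where "TM t = (\<Sum>\<^sub>\<infinity>x\<in>L. (- 1) ^ NL x * complex_of_real (P x * G t x))" for t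
  have lawL: "TL t = - TL (1/t) / of_real (t ^ 14)" if "t > 0" for t
    using theta_law(2)[OF n P z that] by (simp add: TL_def coset_0)
  have lawS: "TS t = - TM (1/t) / of_real (t ^ 14)" if "t > 0" for t
  proof -
    have "(\<Sum>\<^sub>\<infinity>x\<in>L. cis (2 * pi * inner x s) * complex_of_real (P x * G (1/t) x)) = TM (1/t)"
      unfolding TM_def by (rule infsum_cong) (simp add: chr NL_def)
    then show ?thesis using theta_law(2)[OF n P s that] by (simp add: TS_def)
  qed
  have qL: "qseries b (\<i> * of_real t / 2) = TL t" if "t > 0" for t
  proof -
    have "(\<lambda>m. b m * of_real (1 * exp (- (pi * t))) ^ m) sums TL t"
      using bs(2)[of t 1] that by (simp add: TL_def)
    moreover have "qexp (\<i> * of_real t / 2) = of_real (1 * exp (- (pi * t)))"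
      using qexp_imag[of "t / 2"] by simp
    ultimately show ?thesis unfolding qseries_def by (simp add: sums_iff)
  qed
  have qM: "qseries b ((\<i> * of_real t + 1) / 2) = TM t" if "t > 0" for t
  proof -
    have "(\<lambda>m. b m * of_real (- 1 * exp (- (pi * t))) ^ m) sums TM t"
      using bs(2)[of t "- 1"] that by (simp add: TM_def)
    moreover have "qexp ((\<i> * of_real t + 1) / 2) = of_real (- 1 * exp (- (pi * t)))"
      using qexp_imag[of "t / 2"] qexp_half(2)[of "\<i> * of_real t"] by simp
    ultimately show ?thesis unfolding qseries_def by (simp add: sums_iff)
  qed
  have qS: "qseries g (\<i> * of_real t) = TS t" if "t > 0" for t
  proof -
    have "(\<lambda>m. g m * of_real (1 * exp (- (pi * 2 * t))) ^ m) sums TS t"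
      using gs(2)[of t 1] that by (simp add: TS_def)
    moreover have "qexp (\<i> * of_real t) = of_real (1 * exp (- (pi * 2 * t)))"
      using qexp_imag[of t] by (simp add: mult_ac)
    ultimately show ?thesis unfolding qseries_def by (simp add: sums_iff)
  qed
  have S_imag: "- 1 / (\<i> * complex_of_real t) = \<i> * of_real (1/t)" for t
    by (simp add: divide_inverse)
  \<comment> \<open>The minus sign in the Gaussian laws is the value of \<open>\<i> ^ 14\<close>, so
    on the half-plane the factor is \<open>z ^ 14\<close> without a sign.\<close>
  have i14: "(\<i> * complex_of_real t) ^ 14 = - of_real (t ^ 14)" for t
  proof -
    have "\<i> ^ 14 = (\<i> ^ 2) ^ 7" by (simp flip: power_mult)
    then show ?thesis by (simp add: power_mult_distrib)
  qed
  have holS: "(\<lambda>z. - 1 / z) holomorphic_on uhp" using uhp_nonzero by (auto intro!: holomorphic_intros)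
  have holb: "(\<lambda>z. qseries b (f z)) holomorphic_on uhp" if "f holomorphic_on uhp" "\<And>z. z \<in> uhp \<Longrightarrow> f z \<in> uhp" for f
    using holomorphic_on_compose_gen[OF that(1) qseries_holomorphic[OF smb]] that(2) by (auto simp: o_def)
  have holg: "(\<lambda>z. qseries g (f z)) holomorphic_on uhp" if "f holomorphic_on uhp" "\<And>z. z \<in> uhp \<Longrightarrow> f z \<in> uhp" for f
    using holomorphic_on_compose_gen[OF that(1) qseries_holomorphic[OF smg]] that(2) by (auto simp: o_def)
  have f_law: "qseries b ((- 1 / z) / 2) = z ^ 14 * qseries b (z / 2)" if z: "z \<in> uhp" for z
  proof (rule uhp_eqI[of "\<lambda>z. qseries b ((- 1 / z) / 2)" "\<lambda>z. z ^ 14 * qseries b (z / 2)", OF _ _ _ z])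
    show "(\<lambda>z. qseries b ((- 1 / z) / 2)) holomorphic_on uhp"
      by (rule holb, rule holomorphic_on_divide[OF holS]) (use uhp_half(1)[OF uhp_S] in \<open>auto intro!: holomorphic_intros\<close>)
    show "(\<lambda>z. z ^ 14 * qseries b (z / 2)) holomorphic_on uhp"
      by (intro holomorphic_intros holb) (use uhp_half(1) in auto)
    fix t :: real assume t: "t > 0"
    then show "qseries b ((- 1 / (\<i> * of_real t)) / 2) = (\<i> * of_real t) ^ 14 * qseries b (\<i> * of_real t / 2)"
      unfolding S_imag i14 using qL[of "1/t"] qL[of t] lawL[of t] by simp
  qed
  have g_law: "qseries g (- 1 / z) = z ^ 14 * qseries b ((z + 1) / 2)" if z: "z \<in> uhp" for z
  proof (rule uhp_eqI[of "\<lambda>z. qseries g (- 1 / z)" "\<lambda>z. z ^ 14 * qseries b ((z + 1) / 2)", OF _ _ _ z])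
    show "(\<lambda>z. qseries g (- 1 / z)) holomorphic_on uhp"
      by (rule holg[OF holS]) (use uhp_S in auto)
    show "(\<lambda>z. z ^ 14 * qseries b ((z + 1) / 2)) holomorphic_on uhp"
      by (intro holomorphic_intros holb) (use uhp_half(2) in auto)
    fix t :: real assume t: "t > 0"
    then show "qseries g (- 1 / (\<i> * of_real t)) = (\<i> * of_real t) ^ 14 * qseries b ((\<i> * of_real t + 1) / 2)"
      unfolding S_imag i14 using qS[of "1/t"] qM[of t] lawS[of "1/t"] by (simp add: power_divide)
  qed
  have b0: "b 0 = 0" unfolding b_def
  proof (rule sum.neutral, rule ballI)
    fix x assume "x \<in> {x \<in> L. NL x = 0}"
    then have "inner x x = 0" using NL[of x] by (simp add: coset_0)
    then show "complex_of_real (P x) = 0" using harmonic_0[OF P] by simp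
  qed
  have g0: "g 0 = 0" unfolding g_def
  proof (rule sum.neutral, rule ballI)
    fix x assume "x \<in> {x \<in> coset s. NS x = 0}"
    then have "inner x x = 0" using NS[of x] by simp
    then show "complex_of_real (P x) = 0" using harmonic_0[OF P] by simp
  qed
  have "{x \<in> coset s. NS x = 1} = {}" using NS no2 by fastforce
  then have g1: "g 1 = 0" unfolding g_def by (metis (no_types, lifting) sum.empty)
  have van: "g (4 ^ a) = 0 \<and> b (2 * 4 ^ a) = 0"
    by (rule coeffs_vanish[OF smb smg b0 g0 f_law g_law g1])
  have "{x \<in> L. NL x = 2 * 4 ^ a} = shell L (2 * 4 ^ a)"
  proof -
    have "NL x = 2 * 4 ^ a \<longleftrightarrow> inner x x = 2 * 4 ^ a" if "x \<in> L" for x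
    proof -
      have "NL x = 2 * 4 ^ a \<longleftrightarrow> real (NL x) = real (2 * 4 ^ a)" by (simp only: of_nat_eq_iff)
      then show ?thesis using NL[of x] that by (simp add: coset_0)
    qed
    then show ?thesis by (auto simp: shell_def)
  qed
  then have "complex_of_real (\<Sum>x\<in>shell L (2 * 4 ^ a). P x) = 0" using van by (simp add: b_def)
  then show "(\<Sum>x\<in>shell L (2 * 4 ^ a). P x) = 0" by (simp only: of_real_eq_0_iff)
  have "{x \<in> coset s. NS x = 4 ^ a} = shell (coset s) (2 * 4 ^ a)"
  proof -
    have "NS x = 4 ^ a \<longleftrightarrow> inner x x = 2 * 4 ^ a" if "x \<in> coset s" for x
    proof -
      have "NS x = 4 ^ a \<longleftrightarrow> real (NS x) = real (4 ^ a)" by (simp only: of_nat_eq_iff)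
      then show ?thesis using NS[OF that] by simp
    qed
    then show ?thesis by (auto simp: shell_def)
  qed
  then have "complex_of_real (\<Sum>x\<in>shell (coset s) (2 * 4 ^ a). P x) = 0" using van by (simp add: g_def)
  then show "(\<Sum>x\<in>shell (coset s) (2 * 4 ^ a). P x) = 0" by (simp only: of_real_eq_0_iff)
qed

text \<open>If the forms adapted to the frame sum to zero, the moment form \<open>M\<close> is
  diagonal in the frame with entries proportional to \<open>d i\<close>. It is thus a multiple of
  the inner product, and so is its matrix in the standard basis.\<close>

lemma shell_design:
  assumes fint: "\<And>x i. x \<in> S \<Longrightarrow> inner x (e i) \<in> \<int>" and neg: "\<And>x. x \<in> S \<Longrightarrow> - x \<in> S" and ne: "shell S c \<noteq> {}"
    and van: "\<And>P. harmonic P \<Longrightarrow> (\<Sum>x\<in>shell S c. P x) = 0"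
  shows "spherical_3_design (shell S c)"
proof -
  define M where "M u v = (\<Sum>x\<in>shell S c. inner x u * inner x v)" for u v
  have off: "M (e i) (e j) = 0" if "i \<noteq> j" for i j
    unfolding M_def using that by (intro van) (auto simp: harmonic_def)
  have diag: "M (e i) (e i) / of_int (d i) = M (e j) (e j) / of_int (d j)" for i j
  proof (cases "i = j")
    case False
    then have "harmonic (\<lambda>x. (inner x (e i))\<^sup>2 / of_int (d i) - (inner x (e j))\<^sup>2 / of_int (d j))"
      by (auto simp: harmonic_def)
    from van[OF this] show ?thesis
      by (simp add: M_def sum_subtractf sum_divide_distrib power2_eq_square)
  qed simp
  \<comment> \<open>\<open>undefined\<close> is just some index; by \<open>diag\<close> the quotient
    is the same for all.\<close>
  define lam where "lam = M (e undefined) (e undefined) / of_int (d undefined)"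
  have diag': "M (e i) (e i) = lam * of_int (d i)" for i
    using diag[of i undefined] dpos[of i] by (simp add: lam_def field_simps)
  have Me: "M u v = lam * inner u v" for u v
  proof -
    have "M u v = (\<Sum>x\<in>shell S c. \<Sum>i\<in>UNIV. \<Sum>j\<in>UNIV. (inner u (e i) / of_int (d i)) * (inner v (e j) / of_int (d j)) * (inner x (e i) * inner x (e j)))"
      unfolding M_def inner_frame[of _ u] inner_frame[of _ v] sum_product
      by (intro sum.cong refl) (simp add: field_simps)
    also have "\<dots> = (\<Sum>i\<in>UNIV. \<Sum>j\<in>UNIV. (inner u (e i) / of_int (d i)) * (inner v (e j) / of_int (d j)) * M (e i) (e j))"
      unfolding M_def by (subst sum.swap, rule sum.cong[OF refl], subst sum.swap) (simp add: sum_distrib_left)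
    also have "\<dots> = (\<Sum>i\<in>UNIV. \<Sum>j\<in>UNIV. if j = i then lam * (inner u (e i) * inner v (e i) / of_int (d i)) else 0)"
    proof (intro sum.cong refl)
      fix i j
      show "(inner u (e i) / of_int (d i)) * (inner v (e j) / of_int (d j)) * M (e i) (e j) = (if j = i then lam * (inner u (e i) * inner v (e i) / of_int (d i)) else 0)"
        using off[of i j] diag'[of i] dpos[of i] by auto
    qed
    also have "\<dots> = lam * inner u v" by (simp add: inner_frame[of u v] sum_distrib_left)
    finally show ?thesis .
  qed
  show ?thesis
  proof (rule spherical_3_designI[where r = "sqrt c" and s = lam])
    show "finite (shell S c)" unfolding shell_def by (rule finite_frame_shell[OF fint])
    show "shell S c \<noteq> {}" by (rule ne)
    fix x assume x: "x \<in> shell S c"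
    then show "norm x = sqrt c" by (simp add: shell_def norm_eq_sqrt_inner)
    show "- x \<in> shell S c" using x neg by (simp add: shell_def)
  next
    fix i j :: "real^'n" assume "i \<in> Basis" "j \<in> Basis" "i \<noteq> j"
    then show "(\<Sum>x\<in>shell S c. inner x i * inner x j) = 0"
      using Me[of i j] by (simp add: M_def inner_not_same_Basis)
  next
    fix i :: "real^'n" assume "i \<in> Basis"
    then show "(\<Sum>x\<in>shell S c. inner x i * inner x i) = lam"
      using Me[of i i] by (simp add: M_def inner_same_Basis)
  qed
qed

end

section \<open>Selfdual lattices and their shadows\<close>

text \<open>Gram-Schmidt with denominators cleared: multiplying by the product \<open>N\<close> of
  all norms makes every coefficient \<open>c f\<close> an integer, so the new vector stays in
  \<open>L\<close>.\<close>

lemma integral_orthogonal_set: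
  fixes L :: "'a::euclidean_space set"
  assumes L0: "0 \<in> L" and Ladd: "\<And>x y. x \<in> L \<Longrightarrow> y \<in> L \<Longrightarrow> x + y \<in> L"
    and Lint: "\<And>x (n::int). x \<in> L \<Longrightarrow> of_int n *\<^sub>R x \<in> L"
    and int: "\<And>x y. x \<in> L \<Longrightarrow> y \<in> L \<Longrightarrow> inner x y \<in> \<int>"
    and "finite B" "B \<subseteq> L"
  shows "\<exists>E. finite E \<and> E \<subseteq> L \<and> pairwise orthogonal E \<and> 0 \<notin> E \<and> span E = span B"
  using assms(5,6)
proof (induction B)
  case empty
  show ?case by (intro exI[of _ "{}"]) auto
next
  case (insert b B)
  then obtain E where E: "finite E" "E \<subseteq> L" "pairwise orthogonal E" "0 \<notin> E" "span E = span B" by auto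
  have bL: "b \<in> L" using insert.prems by simp
  define N where "N = (\<Prod>f\<in>E. inner f f)"
  define c where "c f = (\<Prod>g\<in>E - {f}. inner g g) * inner b f" for f
  define v where "v = N *\<^sub>R b - (\<Sum>f\<in>E. c f *\<^sub>R f)"
  have scal: "r *\<^sub>R x \<in> L" if "r \<in> \<int>" "x \<in> L" for r x
    using that Lint by (auto elim!: Ints_cases)
  have Lsum: "sum h A \<in> L" if "finite A" "\<And>i. i \<in> A \<Longrightarrow> h i \<in> L" for h and A :: "'a set"
    using that by (induction A rule: finite_induct) (auto simp: L0 Ladd)
  have NZ: "N \<in> \<int>" unfolding N_def using E(2) int by (intro Ints_prod) auto
  have cZ: "c f \<in> \<int>" if "f \<in> E" for f
    unfolding c_def using E(2) int bL that by (intro Ints_mult Ints_prod) auto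
  have N0: "N \<noteq> 0" unfolding N_def using E(1,4) by auto
  have sumL: "(\<Sum>f\<in>E. c f *\<^sub>R f) \<in> L" using E(1,2) cZ by (intro Lsum scal) auto
  have vL: "v \<in> L"
  proof -
    have "v = N *\<^sub>R b + of_int (- 1) *\<^sub>R (\<Sum>f\<in>E. c f *\<^sub>R f)" by (simp add: v_def)
    then show ?thesis using Ladd[OF scal[OF NZ bL] Lint[OF sumL, of "- 1"]] by simp
  qed
  have vo: "inner v g = 0" if g: "g \<in> E" for g
  proof -
    have "inner (\<Sum>f\<in>E. c f *\<^sub>R f) g = (\<Sum>f\<in>E. if f = g then c g * inner g g else 0)"
      unfolding inner_sum_left using E(3) g by (intro sum.cong refl) (auto simp: pairwise_def orthogonal_def)
    also have "\<dots> = c g * inner g g" using E(1) g by simp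
    also have "\<dots> = N * inner b g" unfolding c_def N_def using E(1) g by (simp add: prod.remove[of E g])
    finally show ?thesis by (simp add: v_def inner_diff_left)
  qed
  have sE: "(\<Sum>f\<in>E. c f *\<^sub>R f) \<in> span E" by (intro span_sum span_scale span_base)
  have b_eq: "b = (1 / N) *\<^sub>R (v + (\<Sum>f\<in>E. c f *\<^sub>R f))" using N0 by (simp add: v_def)
  show ?case
  proof (cases "v = 0")
    case True
    then have "b \<in> span E" using b_eq sE by (metis add_0 span_scale)
    then have "span E = span (insert b B)"
      using E(5) by (simp add: span_redundant)
    then show ?thesis using E by blast
  next
    case False
    have "span (insert v E) = span (insert b E)"
    proof -
      have "(\<Sum>f\<in>E. c f *\<^sub>R f) \<in> span (insert b E)" "(\<Sum>f\<in>E. c f *\<^sub>R f) \<in> span (insert v E)"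
        using sE span_mono[OF subset_insertI] by blast+
      note sums = this
      have "v \<in> span (insert b E)"
        unfolding v_def by (rule span_diff[OF span_scale[OF span_base] sums(1)]) simp
      moreover have "(1 / N) *\<^sub>R (v + (\<Sum>f\<in>E. c f *\<^sub>R f)) \<in> span (insert v E)"
        by (rule span_scale[OF span_add[OF span_base sums(2)]]) simp
      then have "b \<in> span (insert v E)" using b_eq by simp
      ultimately show ?thesis
        unfolding span_eq by (auto intro: span_base)
    qed
    also have "\<dots> = span (insert b B)"
      unfolding span_eq using E(5) span_mono[of E "insert b E"] span_mono[of B "insert b B"] span_superset[of E] span_superset[of B]
      by (auto intro: span_base)
    finally have "span (insert v E) = span (insert b B)" .
    moreover have "pairwise orthogonal (insert v E)"
      using E(3) vo by (auto simp: pairwise_insert orthogonal_def inner_commute)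
    ultimately show ?thesis using E vL False by (intro exI[of _ "insert v E"]) auto
  qed
qed

lemma lattice_obtain_basis:
  assumes "is_lattice L"
  obtains B where "finite B" "independent B" "span B = UNIV" "L = {x. \<exists>c::_ \<Rightarrow> int. x = (\<Sum>b\<in>B. of_int (c b) *\<^sub>R b)}" "B \<subseteq> L"
proof -
  obtain B where B: "independent B" "span B = UNIV" "L = {x. \<exists>c::_ \<Rightarrow> int. x = (\<Sum>b\<in>B. of_int (c b) *\<^sub>R b)}"
    using assms unfolding is_lattice_def by blast
  have fin: "finite B" using B(1) by (rule independent_imp_finite)
  have "b \<in> L" if "b \<in> B" for b
  proof -
    have "(\<Sum>b'\<in>B. of_int (if b' = b then 1 else 0) *\<^sub>R b') = (\<Sum>b'\<in>B. if b' = b then b else 0)"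
      by (rule sum.cong) auto
    also have "\<dots> = b" using fin that by simp
    finally show ?thesis unfolding B(3) by (auto intro!: exI[of _ "\<lambda>b'. if b' = b then 1 else 0"])
  qed
  then show ?thesis using that fin B by blast
qed

lemma lattice_closed:
  assumes "is_lattice L"
  shows "0 \<in> L" "x \<in> L \<Longrightarrow> y \<in> L \<Longrightarrow> x + y \<in> L" "x \<in> L \<Longrightarrow> of_int n *\<^sub>R x \<in> L" "x \<in> L \<Longrightarrow> - x \<in> L"
proof -
  obtain B where "finite B" "independent B" "span B = UNIV"
    and B: "L = {x. \<exists>c::_ \<Rightarrow> int. x = (\<Sum>b\<in>B. of_int (c b) *\<^sub>R b)}" and "B \<subseteq> L"
    by (rule lattice_obtain_basis[OF assms])
  show "0 \<in> L" unfolding B by (auto intro!: exI[of _ "\<lambda>_. 0"])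
  show "x + y \<in> L" if xy: "x \<in> L" "y \<in> L"
  proof -
    obtain c c' :: "_ \<Rightarrow> int" where "x = (\<Sum>b\<in>B. of_int (c b) *\<^sub>R b)" "y = (\<Sum>b\<in>B. of_int (c' b) *\<^sub>R b)" using xy unfolding B by auto
    then have "x + y = (\<Sum>b\<in>B. of_int (c b + c' b) *\<^sub>R b)" by (simp add: sum.distrib scaleR_add_left)
    then show ?thesis unfolding B mem_Collect_eq by (rule exI[of _ "\<lambda>b. c b + c' b"])
  qed
  have sc: "of_int n *\<^sub>R x \<in> L" if x: "x \<in> L" for n
  proof -
    obtain c :: "_ \<Rightarrow> int" where "x = (\<Sum>b\<in>B. of_int (c b) *\<^sub>R b)" using x unfolding B by auto
    then have "of_int n *\<^sub>R x = (\<Sum>b\<in>B. of_int (n * c b) *\<^sub>R b)" by (simp add: scaleR_sum_right)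
    then show ?thesis unfolding B mem_Collect_eq by (rule exI[of _ "\<lambda>b. n * c b"])
  qed
  show "of_int n *\<^sub>R x \<in> L" if "x \<in> L" using sc[OF that] .
  show "- x \<in> L" if "x \<in> L" using sc[OF that, of "- 1"] by simp
qed

text \<open>Modulo 1 the map from \<open>x\<close> to \<open>inner x x / 2\<close> is additive on
  \<open>L\<close>, because its defect \<open>inner x y\<close> is an integer. A linear functional
  with the right values on a basis therefore represents it; twice \<open>s\<close> is a
  characteristic vector.\<close>

lemma selfdual_half_norm_vector:
  fixes L :: "'a::euclidean_space set"
  assumes "selfdual_lattice L"
  obtains s where "\<And>x. x \<in> L \<Longrightarrow> inner x s - inner x x / 2 \<in> \<int>"
proof -
  have lat: "is_lattice L" and int: "\<And>x y. x \<in> L \<Longrightarrow> y \<in> L \<Longrightarrow> inner x y \<in> \<int>"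
    using assms by (auto simp: selfdual_lattice_def integral_lattice_def)
  obtain B where B: "finite B" "independent B" "span B = UNIV"
      "L = {x. \<exists>c::_ \<Rightarrow> int. x = (\<Sum>b\<in>B. of_int (c b) *\<^sub>R b)}" "B \<subseteq> L"
    by (rule lattice_obtain_basis[OF lat])
  obtain f :: "'a \<Rightarrow> real" where f: "linear f" "\<forall>b\<in>B. f b = inner b b / 2"
    using linear_independent_extend[OF B(2), of "\<lambda>b. inner b b / 2"] by blast
  define s where "s = (\<Sum>i\<in>Basis. f i *\<^sub>R i)"
  have fs: "f x = inner x s" for x
  proof -
    have "f x = f (\<Sum>i\<in>Basis. inner x i *\<^sub>R i)" by (simp add: euclidean_representation)
    also have "\<dots> = (\<Sum>i\<in>Basis. inner x i * f i)" using f(1) by (simp add: linear_sum linear_scale o_def)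
    finally show ?thesis by (simp add: s_def inner_sum_right mult.commute)
  qed
  define Q where "Q x \<longleftrightarrow> x \<in> L \<and> inner x s - inner x x / 2 \<in> \<int>" for x
  have Q0: "Q 0" using lattice_closed[OF lat] by (simp add: Q_def)
  have Qadd: "Q (x + y)" if "Q x" "Q y" for x y
  proof -
    have "inner (x + y) s - inner (x + y) (x + y) / 2 = (inner x s - inner x x / 2) + (inner y s - inner y y / 2) - inner x y"
      by (simp add: inner_add_left inner_add_right inner_commute field_simps)
    moreover have "(inner x s - inner x x / 2) + (inner y s - inner y y / 2) - inner x y \<in> \<int>"
      using that int unfolding Q_def by (metis Ints_diff Ints_add)
    ultimately show ?thesis using that lattice_closed(2)[OF lat] unfolding Q_def by metis
  qed
  have Qneg: "Q (- x)" if "Q x" for x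
  proof -
    have "inner (- x) s - inner (- x) (- x) / 2 = - (inner x s - inner x x / 2) - inner x x" by (simp add: field_simps)
    moreover have "- (inner x s - inner x x / 2) - inner x x \<in> \<int>" using that int unfolding Q_def by (metis Ints_diff Ints_minus)
    ultimately show ?thesis using that lattice_closed(4)[OF lat] unfolding Q_def by metis
  qed
  have Qint: "Q (of_int n *\<^sub>R x)" if x: "Q x" for n x
  proof (induction n rule: int_induct[of _ 0])
    case base then show ?case using Q0 by simp
  next
    case (step1 i) then show ?case using Qadd[OF step1.IH x] by (simp add: algebra_simps)
  next
    case (step2 i) then show ?case using Qadd[OF step2.IH Qneg[OF x]] by (simp add: algebra_simps)
  qed
  have "Q x" if x: "x \<in> L" for x
  proof -
    obtain c :: "_ \<Rightarrow> int" where c: "x = (\<Sum>b\<in>B. of_int (c b) *\<^sub>R b)" using x unfolding B(4) by auto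
    have "Q (\<Sum>b\<in>A. of_int (c b) *\<^sub>R b)" if "finite A" "A \<subseteq> B" for A
      using that
    proof (induction A rule: finite_induct)
      case (insert b A)
      have "f b - inner b b / 2 = 0" using insert.prems f(2) by simp
      then have "inner b s - inner b b / 2 \<in> \<int>" unfolding fs by (metis Ints_0)
      then have "Q b" using insert.prems B(5) unfolding Q_def by blast
      then show ?case using insert by (simp add: Qadd Qint)
    qed (simp add: Q0)
    then show ?thesis unfolding c using B(1) by blast
  qed
  then show ?thesis using that[of s] by (auto simp: Q_def)
qed

lemma half_Ints_cases:
  fixes x :: real
  assumes "x \<in> \<int>" "x / 2 \<notin> \<int>"
  shows "x / 2 - 1 / 2 \<in> \<int>"
proof -
  obtain n where n: "x = of_int n" using assms(1) by (rule Ints_cases)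
  have "odd n"
  proof
    assume "even n"
    then obtain k where "n = 2 * k" by (rule evenE)
    then show False using assms(2) n by simp
  qed
  then obtain k where "n = 2 * k + 1" by (rule oddE)
  then have "x / 2 - 1 / 2 = of_int k" using n by (simp add: field_simps)
  then show ?thesis by simp
qed

text \<open>A vector \<open>y\<close> of the shadow pairs integrally with the even vectors of
  \<open>L\<close>, but not with all of \<open>L\<close>. Twice an odd vector is even, so
  \<open>y\<close> pairs with an odd vector into 1/2 + Z. This is the behaviour of \<open>s\<close>,
  hence \<open>y - s\<close> pairs integrally with \<open>L\<close> and lies in it by
  selfduality.\<close>

lemma shadow_odd:
  fixes L :: "'a::euclidean_space set"
  assumes sd: "selfdual_lattice L" and odd: "\<not> even_lattice L"
    and s: "\<And>x. x \<in> L \<Longrightarrow> inner x s - inner x x / 2 \<in> \<int>"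
  shows "shadow L = {x. x - s \<in> L}"
proof -
  have lat: "is_lattice L" and int: "\<And>x y. x \<in> L \<Longrightarrow> y \<in> L \<Longrightarrow> inner x y \<in> \<int>" and dual: "dual_lattice L = L"
    using sd by (auto simp: selfdual_lattice_def integral_lattice_def)
  have mem: "y \<in> L \<longleftrightarrow> (\<forall>x\<in>L. inner x y \<in> \<int>)" for y using dual unfolding dual_lattice_def by blast
  have half: "inner x y \<in> \<int> \<longleftrightarrow> inner x x / 2 \<in> \<int>" if "x \<in> L" "y - s \<in> L" for x y
  proof -
    have "inner x y - inner x x / 2 = (inner x s - inner x x / 2) + inner x (y - s)" by (simp add: inner_diff_right)
    also have "\<dots> \<in> \<int>" using s int that by (intro Ints_add) auto
    finally have *: "inner x y - inner x x / 2 \<in> \<int>" .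
    show ?thesis
    proof
      assume "inner x y \<in> \<int>"
      from Ints_diff[OF this *] show "inner x x / 2 \<in> \<int>" by simp
    next
      assume "inner x x / 2 \<in> \<int>"
      from Ints_add[OF this *] show "inner x y \<in> \<int>" by simp
    qed
  qed
  have "y \<in> dual_lattice (even_sublattice L) - L \<longleftrightarrow> y - s \<in> L" for y
  proof
    assume ys: "y - s \<in> L"
    obtain x1 where x1: "x1 \<in> L" "inner x1 x1 / 2 \<notin> \<int>" using odd by (auto simp: even_lattice_def)
    then have "y \<notin> L" using mem half[OF x1(1) ys] by blast
    moreover have "y \<in> dual_lattice (even_sublattice L)"
      using half[OF _ ys] by (auto simp: dual_lattice_def even_sublattice_def)
    ultimately show "y \<in> dual_lattice (even_sublattice L) - L" by blast
  next
    assume y: "y \<in> dual_lattice (even_sublattice L) - L"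
    then obtain x0 where x0: "x0 \<in> L" "inner x0 y \<notin> \<int>" using mem by blast
    have ev: "inner x y \<in> \<int>" if "x \<in> L" "inner x x / 2 \<in> \<int>" for x
      using y that by (auto simp: dual_lattice_def even_sublattice_def)
    have x0o: "inner x0 x0 / 2 \<notin> \<int>" using ev x0 by blast
    have "inner (of_int 2 *\<^sub>R x0) (of_int 2 *\<^sub>R x0) / 2 = 2 * inner x0 x0" by simp
    then have "inner (of_int 2 *\<^sub>R x0) y \<in> \<int>"
      using lattice_closed(3)[OF lat x0(1), of 2] int[OF x0(1) x0(1)] by (intro ev) auto
    then have "2 * inner x0 y \<in> \<int>" by simp
    then have h0: "inner x0 y - 1 / 2 \<in> \<int>" using half_Ints_cases[of "2 * inner x0 y"] x0(2) by simp
    have "inner x (y - s) \<in> \<int>" if x: "x \<in> L" for x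
    proof (cases "inner x x / 2 \<in> \<int>")
      case True
      have "inner x (y - s) = inner x y - inner x x / 2 - (inner x s - inner x x / 2)" by (simp add: inner_diff_right)
      then show ?thesis using Ints_diff[OF Ints_diff[OF ev[OF x True] True] s[OF x]] by simp
    next
      case False
      have d: "x - x0 \<in> L" using lattice_closed(2)[OF lat x lattice_closed(4)[OF lat x0(1)]] by simp
      have "inner (x - x0) (x - x0) / 2 = (inner x x / 2 - 1 / 2) + (inner x0 x0 / 2 - 1 / 2) + 1 - inner x x0"
        by (simp add: inner_diff_left inner_diff_right inner_commute field_simps)
      also have "\<dots> \<in> \<int>"
        by (rule Ints_diff[OF Ints_add[OF Ints_add[OF half_Ints_cases[OF int[OF x x] False] half_Ints_cases[OF int[OF x0(1) x0(1)] x0o]] Ints_1] int[OF x x0(1)]])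
      finally have "inner (x - x0) y \<in> \<int>" using ev[OF d] by blast
      then have "inner (x - x0) y + (inner x0 y - 1 / 2) - (inner x x / 2 - 1 / 2) - (inner x s - inner x x / 2) \<in> \<int>"
        by (rule Ints_diff[OF Ints_diff[OF Ints_add[OF _ h0] half_Ints_cases[OF int[OF x x] False]] s[OF x]])
      moreover have "inner (x - x0) y + (inner x0 y - 1 / 2) - (inner x x / 2 - 1 / 2) - (inner x s - inner x x / 2) = inner x (y - s)"
        by (simp add: inner_diff_left inner_diff_right)
      ultimately show ?thesis by simp
    qed
    then show "y - s \<in> L" using mem by blast
  qed
  then show ?thesis using odd by (auto simp: shadow_def)
qed

text \<open>An even lattice would have 0 in its shadow and \<sigma> = 0, so \<open>L\<close> is odd.
  On the coset of \<open>s\<close> all norms agree modulo 2, hence the infimum 4 is attained and all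
  norms are even integers.\<close>

lemma shadow_norms:
  fixes L :: "'a::euclidean_space set"
  assumes sd: "selfdual_lattice L" and sig: "sigma L = 16"
    and s: "\<And>x. x \<in> L \<Longrightarrow> inner x s - inner x x / 2 \<in> \<int>"
  shows "shadow L = {x. x - s \<in> L}" and "x \<in> shadow L \<Longrightarrow> \<exists>k::nat. inner x x = 2 * real k"
    and "x \<in> shadow L \<Longrightarrow> inner x x \<ge> 4"
proof -
  have lat: "is_lattice L" and int: "\<And>x y. x \<in> L \<Longrightarrow> y \<in> L \<Longrightarrow> inner x y \<in> \<int>"
    using sd by (auto simp: selfdual_lattice_def integral_lattice_def)
  have bdd: "bdd_below {inner x x |x. x \<in> shadow L}" by (rule bdd_belowI[of _ 0]) auto
  have "\<not> even_lattice L"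
  proof
    assume "even_lattice L"
    then have sh: "shadow L = L" by (simp add: shadow_def)
    have "Inf {inner x x |x. x \<in> shadow L} = 0"
      by (rule cInf_eq_minimum) (use lattice_closed(1)[OF lat] sh in \<open>auto intro!: exI[of _ 0]\<close>)
    then show False using sig by (simp add: sigma_def)
  qed
  then show sh: "shadow L = {x. x - s \<in> L}" by (rule shadow_odd[OF sd _ s])
  have "s \<in> shadow L" using lattice_closed(1)[OF lat] sh by simp
  then have ne: "{inner x x |x. x \<in> shadow L} \<noteq> {}" by blast
  have I4: "Inf {inner x x |x. x \<in> shadow L} = 4" using sig by (simp add: sigma_def)
  have ge: "inner x x \<ge> 4" if "x \<in> shadow L" for x
    using cInf_lower[OF _ bdd, of "inner x x"] that unfolding I4 by auto
  then show "x \<in> shadow L \<Longrightarrow> inner x x \<ge> 4" .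
  have cong0: "(inner x x - inner s s) / 2 \<in> \<int>" if "x \<in> shadow L" for x
  proof -
    define v where "v = x - s"
    have v: "v \<in> L" using that sh by (simp add: v_def)
    have "(inner x x - inner s s) / 2 = (inner v s - inner v v / 2) + inner v v"
      by (simp add: v_def inner_diff_left inner_diff_right inner_commute field_simps)
    then show ?thesis using Ints_add[OF s[OF v] int[OF v v]] by (simp only:)
  qed
  have cong: "(inner x x - inner y y) / 2 \<in> \<int>" if "x \<in> shadow L" "y \<in> shadow L" for x y
    using Ints_diff[OF cong0[OF that(1)] cong0[OF that(2)]] by (simp add: field_simps)
  \<comment> \<open>Norms in the shadow differ by multiples of 2. If the norm of \<open>x0\<close>
    were strictly between 4 and 6, a smaller norm that is still at least 4 would differ from it by
    less than 2.\<close>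
  obtain x0 where x0: "x0 \<in> shadow L" "inner x0 x0 < 6"
    using cInf_lessD[OF ne, of 6] I4 by auto
  have x04: "inner x0 x0 = 4"
  proof (rule ccontr)
    assume "inner x0 x0 \<noteq> 4"
    then have "4 < inner x0 x0" using ge[OF x0(1)] by simp
    then obtain y where y: "y \<in> shadow L" "inner y y < inner x0 x0"
      using cInf_lessD[OF ne, of "inner x0 x0"] I4 by auto
    obtain n where n: "(inner x0 x0 - inner y y) / 2 = of_int n" using cong[OF x0(1) y(1)] by (rule Ints_cases)
    have "(0::real) < of_int n" "of_int n < (1::real)" unfolding n[symmetric] using y(2) x0(2) ge[OF y(1)] by (simp_all add: field_simps)
    then have "0 < n" "n < 1" by (simp_all only: of_int_0_less_iff of_int_less_1_iff)
    then show False by simp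
  qed
  show "\<exists>k::nat. inner x x = 2 * real k" if x: "x \<in> shadow L"
  proof -
    obtain n where "(inner x x - inner x0 x0) / 2 = of_int n" using cong[OF x x0(1)] by (rule Ints_cases)
    then have n: "inner x x = 2 * (of_int n + 2)" using x04 by (simp add: field_simps)
    then have "n + 2 \<ge> 0" using ge[OF x] by (smt (verit) of_int_0_le_iff of_int_add of_int_numeral)
    then have "real (nat (n + 2)) = of_int n + 2" by (simp add: nat_add_distrib)
    then show ?thesis using n by (intro exI[of _ "nat (n + 2)"]) simp
  qed
qed

lemma selfdual_frame_exists:
  fixes L :: "(real^'n::finite) set"
  assumes sd: "selfdual_lattice L" and s: "\<And>x. x \<in> L \<Longrightarrow> inner x s - inner x x / 2 \<in> \<int>"
  obtains e d where "selfdual_frame e d L" "\<And>i. inner s (e i) \<in> \<int>"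
proof -
  have lat: "is_lattice L" and int: "\<And>x y. x \<in> L \<Longrightarrow> y \<in> L \<Longrightarrow> inner x y \<in> \<int>" and dual: "dual_lattice L = L"
    using sd by (auto simp: selfdual_lattice_def integral_lattice_def)
  obtain B where B: "finite B" "independent B" "span B = UNIV"
      "L = {x. \<exists>c::_ \<Rightarrow> int. x = (\<Sum>b\<in>B. of_int (c b) *\<^sub>R b)}" "B \<subseteq> L"
    by (rule lattice_obtain_basis[OF lat])
  obtain E where E: "finite E" "E \<subseteq> L" "pairwise orthogonal E" "0 \<notin> E" "span E = UNIV"
    using integral_orthogonal_set[OF lattice_closed(1)[OF lat] lattice_closed(2)[OF lat] lattice_closed(3)[OF lat] int B(1,5)] B(3)
    by auto
  have "independent E" using E(3,4) by (rule pairwise_orthogonal_independent)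
  then have "card E = dim (UNIV :: (real^'n) set)" using E(5) dim_eq_card[of E UNIV] by simp
  then have "card E = card (UNIV :: 'n set)" by simp
  then obtain f where f: "bij_betw f (UNIV :: 'n set) E"
    using E(1) finite_same_card_bij[of "UNIV :: 'n set" E] by auto
  \<comment> \<open>The doubling makes the pairing with \<open>s\<close> integral: it becomes twice
    \<open>inner s (f i)\<close>, which is congruent to \<open>inner (f i) (f i)\<close> modulo 2
    and so an integer.\<close>
  define e where "e i = 2 *\<^sub>R f i" for i
  have fE: "f i \<in> E" for i using f by (auto simp: bij_betw_def)
  have fL: "f i \<in> L" for i using fE E(2) by blast
  have eL: "e i \<in> L" for i using lattice_closed(3)[OF lat fL, of 2 i] by (simp add: e_def)
  have "inner (e i) (e i) \<in> \<int>" for i using int[OF eL eL] .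
  then have "\<forall>i. \<exists>n::int. inner (e i) (e i) = of_int n" by (auto elim: Ints_cases)
  then obtain d :: "'n \<Rightarrow> int" where d: "\<And>i. inner (e i) (e i) = of_int (d i)" by metis
  have e0: "e i \<noteq> 0" for i using fE[of i] E(4) by (auto simp: e_def)
  have "selfdual_frame e d L"
  proof
    show "inner (e i) (e j) = 0" if "i \<noteq> j" for i j
    proof -
      have "f i \<noteq> f j" using f that by (auto simp: bij_betw_def inj_def)
      then have "inner (f i) (f j) = 0" using E(3) fE by (auto simp: pairwise_def orthogonal_def)
      then show ?thesis by (simp add: e_def)
    qed
    show "inner (e i) (e i) = of_int (d i)" for i by (rule d)
    show "d i > 0" for i
    proof -
      have "inner (e i) (e i) > 0" using e0 by simp
      then show ?thesis unfolding d by simp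
    qed
    show "0 \<in> L" "dual_lattice L = L" "e i \<in> L" for i using lattice_closed(1)[OF lat] dual eL by auto
    show "x + y \<in> L" if "x \<in> L" "y \<in> L" for x y using lattice_closed(2)[OF lat that] .
    show "- x \<in> L" if "x \<in> L" for x using lattice_closed(4)[OF lat that] .
  qed
  moreover have "inner s (e i) \<in> \<int>" for i
  proof -
    have "inner s (e i) = (inner (f i) s - inner (f i) (f i) / 2) + (inner (f i) s - inner (f i) (f i) / 2) + inner (f i) (f i)"
      by (simp add: e_def inner_commute)
    then show ?thesis using s[OF fL[of i]] int[OF fL fL] by (metis Ints_add)
  qed
  ultimately show ?thesis by (rule that)
qed

theorem long_shadow_shell_designs:
  fixes L :: "(real^'n::finite) set"
  assumes n: "CARD('n) = 24" and sd: "selfdual_lattice L" and sig: "sigma L = 16"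
  shows "shell L (2 * 4 ^ a) \<noteq> {} \<Longrightarrow> spherical_3_design (shell L (2 * 4 ^ a))"
    and "shell (shadow L) (2 * 4 ^ a) \<noteq> {} \<Longrightarrow> spherical_3_design (shell (shadow L) (2 * 4 ^ a))"
proof -
  obtain s where s: "\<And>x. x \<in> L \<Longrightarrow> inner x s - inner x x / 2 \<in> \<int>"
    using selfdual_half_norm_vector[OF sd] by blast
  obtain e d where "selfdual_frame e d L" and se: "\<And>i. inner s (e i) \<in> \<int>"
    using selfdual_frame_exists[OF sd s] by blast
  then interpret selfdual_frame e d L by simp
  have sh: "shadow L = coset s" unfolding coset_def by (rule shadow_norms(1)[OF sd sig s])
  \<comment> \<open>Modulo 1 the pairing with \<open>s\<close> is half the norm, so the phase is
    exp(pi i) raised to the norm.\<close>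
  have chr: "cis (2 * pi * inner x s) = (- 1) ^ nat \<lfloor>inner x x\<rfloor>" if x: "x \<in> L" for x
  proof -
    have "inner x x \<in> \<int>" using x Lmem[of x] by blast
    then obtain k where k: "inner x x = of_int k" by (rule Ints_cases)
    have k0: "k \<ge> 0" using inner_ge_zero[of x] unfolding k by simp
    have "2 * pi * inner x s = 2 * pi * (inner x s - inner x x / 2) + pi * real (nat k)"
      using k k0 by (simp add: field_simps)
    then have "cis (2 * pi * inner x s) = cis (2 * pi * (inner x s - inner x x / 2)) * cis (pi * real (nat k))"
      by (simp only: cis_mult)
    also have "cis (2 * pi * (inner x s - inner x x / 2)) = 1" using s[OF x] by (simp only: cis_2pi_eq_1_iff)
    also have "cis (pi * real (nat k)) = (- 1) ^ nat k"
      using Complex.DeMoivre[of pi "nat k"] by (simp add: mult.commute)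
    finally show ?thesis using k by simp
  qed
  have even: "\<exists>k::nat. inner x x = 2 * real k" if "x \<in> coset s" for x
    using shadow_norms(2)[OF sd sig s] that sh by blast
  have no2: "inner x x \<noteq> 2" if "x \<in> coset s" for x
    using shadow_norms(3)[OF sd sig s, of x] that sh by auto
  note van = harmonic_sums_vanish[OF n _ se chr even no2]
  show "spherical_3_design (shell L (2 * 4 ^ a))" if "shell L (2 * 4 ^ a) \<noteq> {}"
    by (rule shell_design[OF L_frame_int Lneg that van(1)])
  have neg: "- x \<in> coset s" if x: "x \<in> coset s" for x
  proof -
    \<comment> \<open>Since twice \<open>s\<close> lies in \<open>L\<close>, the cosets of
      \<open>s\<close> and \<open>- s\<close> coincide, and the shadow is antipodal.\<close>
    have "2 *\<^sub>R s \<in> L"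
    proof -
      have "inner x (2 *\<^sub>R s) \<in> \<int>" if x: "x \<in> L" for x
      proof -
        have "inner x (2 *\<^sub>R s) = (inner x s - inner x x / 2) + (inner x s - inner x x / 2) + inner x x" by simp
        moreover have "inner x x \<in> \<int>" using x Lmem[of x] by blast
        ultimately show ?thesis using s[OF x] by (metis Ints_add)
      qed
      then show ?thesis using Lmem by blast
    qed
    then have "- ((x - s) + 2 *\<^sub>R s) \<in> L" using x by (intro Lneg Ladd) (simp_all add: coset_def)
    moreover have "- ((x - s) + 2 *\<^sub>R s) = - x - s" by (simp add: scaleR_2)
    ultimately show ?thesis unfolding coset_def by (simp only: mem_Collect_eq)
  qed
  show "spherical_3_design (shell (shadow L) (2 * 4 ^ a))" if ne: "shell (shadow L) (2 * 4 ^ a) \<noteq> {}"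
    unfolding sh by (rule shell_design[OF coset_frame_int[OF se] neg ne[unfolded sh] van(2)])
qed

theorem theorem12p5:
  shows "(\<forall>L :: (real^24) set. selfdual_lattice L \<and> sigma L = 16 \<longrightarrow>
            (\<forall>a::nat. (shell L (2 * 4 ^ a) \<noteq> {} \<longrightarrow> spherical_3_design (shell L (2 * 4 ^ a))) \<and>
                      (shell (shadow L) (2 * 4 ^ a) \<noteq> {} \<longrightarrow>
                          spherical_3_design (shell (shadow L) (2 * 4 ^ a)))))
       \<and> (\<forall>a b :: nat. spherical_3_design (shell Z3_W8 (4 ^ a * (8 * real b + 7))))"
  using long_shadow_shell_designs[where ?'n = 24] Z3_W8_shell_design by simp

end
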